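(* Let $K$ be a field, let $t\ge 1$ be an integer, and let $M_t$ be the ideal generated by the $2t$-pfaffians of a $(2t+1)\times(2t+1)$ skew-symmetric matrix of indeterminates over $K$. Then the $h$-vector of $M_t$ is of decreasing type.
   Context: A skew-symmetric matrix of indeterminates $X=(x_{ij})$ has entries $x_{ij}$, $i<j$, that are independent indeterminates over $K$, with $x_{ji}=-x_{ij}$ and $x_{ii}=0$; $R=K[X]=K[x_{ij}\mid i<j]$ is standard graded. A $2t$-pfaffian is the pfaffian of the submatrix of $X$ with rows and columns indexed by the same set of $2t$ indices. For a homogeneous ideal $I\subset R$, the Hilbert series $\sum_{m\in\mathbb{Z}}\dim_K(R/I)_m\,z^m$ of $R/I$ can be written as $\frac{h_I(0)+h_I(1)z+\cdots+h_I(s)z^s}{(1-z)^d}$ with $d=\dim(R/I)$, $h_I(i)\in\mathbb{Z}$ and $h_I(s)\neq 0$; the vector $(h_I(0),\ldots,h_I(s))$ is the $h$-vector of $I$. A vector $h=(h_0,h_1,\ldots,h_s)\in\mathbb{Z}^{s+1}$ is of decreasing type if whenever $h_i>h_{i+1}$ for some index $i$, then $h_j>h_{j+1}$ for every $j>i$ (with $j+1\le s$). *)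

theory Defs
  imports
    "HOL-Library.Poly_Mapping"
    "HOL-Library.Extended_Nat"
    "HOL-Combinatorics.Permutations"
    "HOL-Computational_Algebra.Polynomial_FPS"
    "HOL-Algebra.QuotRing"
    "HOL-Algebra.Embedded_Algebras"
begin

text \<open>
  A polynomial with coefficients in \<open>'a\<close> and variables in \<open>'v\<close> is a finitely supported map from
  exponent vectors \<open>'v \<Rightarrow>\<^sub>0 nat\<close> to \<open>'a\<close>; \<^theory>\<open>HOL-Library.Poly_Mapping\<close> makes these a commutative
  ring under convolution. \<open>poly_ring V\<close> is the subring \<open>K[V]\<close> of the polynomials that involve only
  variables from \<open>V\<close>.
\<close>

type_synonym ('v, 'a) mpoly = "('v \<Rightarrow>\<^sub>0 nat) \<Rightarrow>\<^sub>0 'a"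

definition poly_ring :: "'v set \<Rightarrow> ('v, 'a::field) mpoly ring" where
  "poly_ring V = \<lparr>carrier = {p. \<forall>e\<in>Poly_Mapping.keys p. Poly_Mapping.keys e \<subseteq> V},
     mult = (*), one = 1, zero = 0, add = (+)\<rparr>"

definition mpoly_const :: "'a::field \<Rightarrow> ('v, 'a) mpoly" where
  "mpoly_const c = Poly_Mapping.single 0 c"

definition mpoly_var :: "'v \<Rightarrow> ('v, 'a::field) mpoly" where
  "mpoly_var v = Poly_Mapping.single (Poly_Mapping.single v 1) 1"

definition total_degree :: "('v \<Rightarrow>\<^sub>0 nat) \<Rightarrow> nat" where
  "total_degree e = (\<Sum>v\<in>Poly_Mapping.keys e. Poly_Mapping.lookup e v)"

text \<open>Degree-\<open>m\<close> component of \<open>K[V]\<close> in the standard grading.\<close>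

definition graded_part :: "'v set \<Rightarrow> nat \<Rightarrow> ('v, 'a::field) mpoly set" where
  "graded_part V m = {p \<in> carrier (poly_ring V). \<forall>e\<in>Poly_Mapping.keys p. total_degree e = m}"

text \<open>
  \<open>dim\<^sub>K (R/I)\<^sub>m\<close> for \<open>R = K[V]\<close> with \<open>V\<close> finite and \<open>I\<close> a homogeneous ideal. Inside \<open>R/I\<close>, the field
  \<open>K\<close> is the set of cosets of constants and \<open>(R/I)\<^sub>m\<close> is the set of cosets of forms of degree \<open>m\<close>.
\<close>

definition hilbert_function :: "'v set \<Rightarrow> ('v, 'a::field) mpoly set \<Rightarrow> nat \<Rightarrow> nat" where
  "hilbert_function V I m =
     (let R = poly_ring V in
      ring.dim (R Quot I) ((\<lambda>c. I +>\<^bsub>R\<^esub> mpoly_const c) ` UNIV) ((\<lambda>f. I +>\<^bsub>R\<^esub> f) ` graded_part V m))"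

text \<open>Components of negative degree vanish, so the Hilbert series is a power series.\<close>

definition hilbert_series :: "'v set \<Rightarrow> ('v, 'a::field) mpoly set \<Rightarrow> int fps" where
  "hilbert_series V I = Abs_fps (\<lambda>m. int (hilbert_function V I m))"

text \<open>Krull dimension of a commutative ring, with value \<open>0\<close> rather than \<open>-\<infinity>\<close> for the zero ring.\<close>

definition krull_dim :: "('a, 'm) ring_scheme \<Rightarrow> enat" where
  "krull_dim A = (SUP n \<in> {n. \<exists>P. (\<forall>i\<le>n. primeideal (P i) A) \<and> (\<forall>i<n. P i \<subset> P (Suc i))}. enat n)"

text \<open>
  \<open>h\<close> is the \<open>h\<close>-vector of the homogeneous ideal \<open>I\<close> of \<open>K[V]\<close>. The equation says that the Hilbert
  series is \<open>(\<Sum>i<length h. h ! i * z ^ i) / (1 - z) ^ d\<close> with \<open>d = dim (R/I)\<close>, the unit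
  \<open>(1 - z) ^ d\<close> of the ring of integer power series having been multiplied across.
\<close>

definition is_h_vector :: "'v set \<Rightarrow> ('v, 'a::field) mpoly set \<Rightarrow> int list \<Rightarrow> bool" where
  "is_h_vector V I h \<longleftrightarrow> h \<noteq> [] \<and> last h \<noteq> 0 \<and>
     (\<exists>d::nat. krull_dim (poly_ring V Quot I) = enat d \<and>
        hilbert_series V I * (1 - fps_X) ^ d = fps_of_poly (Poly h))"

definition decreasing_type :: "int list \<Rightarrow> bool" where
  "decreasing_type h \<longleftrightarrow>
     (\<forall>i. i + 1 < length h \<and> h ! i > h ! (i + 1) \<longrightarrow>
       (\<forall>j>i. j + 1 < length h \<longrightarrow> h ! j > h ! (j + 1)))"

text \<open>
  The pfaffian of the skew-symmetric matrix \<open>(A k l)\<close>, \<open>k, l < 2 * n\<close>, as the signed sum over the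
  perfect matchings \<open>{\<pi> 0, \<pi> 1}, {\<pi> 2, \<pi> 3}, \<dots>\<close> of the index set. Each matching is listed once, by
  the permutation \<open>\<pi>\<close> with increasing pairs and increasing first elements, so the formula is valid
  in every characteristic.
\<close>

definition pfaffian :: "nat \<Rightarrow> (nat \<Rightarrow> nat \<Rightarrow> 'r::comm_ring_1) \<Rightarrow> 'r" where
  "pfaffian n A =
     (\<Sum>\<pi> | \<pi> permutes {..<2 * n} \<and> (\<forall>i<n. \<pi> (2 * i) < \<pi> (2 * i + 1)) \<and>
            (\<forall>i j. i < j \<and> j < n \<longrightarrow> \<pi> (2 * i) < \<pi> (2 * j)).
        of_int (sign \<pi>) * (\<Prod>i<n. A (\<pi> (2 * i)) (\<pi> (2 * i + 1))))"

text \<open>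
  The indeterminates of an \<open>n \<times> n\<close> skew-symmetric matrix, with rows and columns numbered from \<open>0\<close>.
\<close>

definition skew_vars :: "nat \<Rightarrow> (nat \<times> nat) set" where
  "skew_vars n = {(i, j). i < j \<and> j < n}"

definition skew_matrix :: "nat \<Rightarrow> nat \<Rightarrow> (nat \<times> nat, 'a::field) mpoly" where
  "skew_matrix i j =
     (if i < j then mpoly_var (i, j) else if j < i then - mpoly_var (j, i) else 0)"

text \<open>Pfaffian of the submatrix with rows and columns in \<open>S\<close>, where \<open>card S = 2 * t\<close>.\<close>

definition sub_pfaffian :: "nat \<Rightarrow> nat set \<Rightarrow> (nat \<times> nat, 'a::field) mpoly" where
  "sub_pfaffian t S =
     (let s = sorted_list_of_set S in pfaffian t (\<lambda>k l. skew_matrix (s ! k) (s ! l)))"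

definition pfaffian_ideal :: "nat \<Rightarrow> nat \<Rightarrow> (nat \<times> nat, 'a::field) mpoly set" where
  "pfaffian_ideal n t =
     Idl\<^bsub>poly_ring (skew_vars n)\<^esub> {sub_pfaffian t S | S. S \<subseteq> {..<n} \<and> card S = 2 * t}"

lemma is_h_vector_unique:
  assumes "is_h_vector V I h" and "is_h_vector V I h'"
  shows "h = h'"
proof -
  from assms have "fps_of_poly (Poly h) = fps_of_poly (Poly h')"
    unfolding is_h_vector_def by (metis enat.inject)
  then have "Poly h = Poly h'"
    by simp
  then have "coeffs (Poly h) = coeffs (Poly h')"
    by simp
  moreover have "coeffs (Poly g) = g" if "is_h_vector V I g" for g
  proof -
    from that have "no_trailing ((=) 0) g"
      by (auto simp: is_h_vector_def no_trailing_unfold)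
    then show ?thesis
      by (simp add: strip_while_idem_iff)
  qed
  ultimately show ?thesis
    using assms by metis
qed

lemma mpoly_keys_mult:
  fixes p q :: "('v, 'a::field) mpoly"
  assumes "e \<in> Poly_Mapping.keys (p * q)"
  obtains a b where "a \<in> Poly_Mapping.keys p" "b \<in> Poly_Mapping.keys q" "e = a + b"
  using Poly_Mapping.keys_mult[of p q] assms by blast

lemma poly_ring_cring: "cring (poly_ring V :: ('v, 'a::field) mpoly ring)"
proof (intro cringI abelian_groupI comm_monoidI)
  fix x assume x: "x \<in> carrier (poly_ring V :: ('v, 'a) mpoly ring)"
  show "\<exists>y\<in>carrier (poly_ring V). y \<oplus>\<^bsub>poly_ring V\<^esub> x = \<zero>\<^bsub>poly_ring V\<^esub>"
    by (rule bexI[of _ "- x"]) (use x in \<open>auto simp: poly_ring_def\<close>)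
next
  fix x y assume xy: "x \<in> carrier (poly_ring V :: ('v, 'a) mpoly ring)" "y \<in> carrier (poly_ring V :: ('v, 'a) mpoly ring)"
  show "x \<oplus>\<^bsub>poly_ring V\<^esub> y \<in> carrier (poly_ring V)"
    using xy Poly_Mapping.keys_add[of x y] by (fastforce simp: poly_ring_def)
  show "x \<otimes>\<^bsub>poly_ring V\<^esub> y \<in> carrier (poly_ring V)"
    using xy Poly_Mapping.keys_add by (fastforce simp: poly_ring_def elim!: mpoly_keys_mult)
qed (auto simp: poly_ring_def algebra_simps)

end

theory Submission
  imports Defs "HOL-Library.Product_Lexorder"
begin

text \<open>
  Let \<open>Pf\<^sub>j\<close> be the pfaffian of the matrix without row and column \<open>j\<close>. Giving \<open>x\<^sub>i\<^sub>j\<close> the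
  weight \<open>i * j\<close>, the term of least weight of each \<open>Pf\<^sub>j\<close> is the monomial of the nested matching. The
  syzygies \<open>\<Sum>\<^sub>j \<plusminus> Pf(T \<union> j) Pf\<^sub>j = 0\<close> for odd sets \<open>T\<close> show that these monomials
  generate the initial ideal, so that counting the monomials outside it gives the Hilbert series
  \<open>(1 - (2t+1) z^t + (2t+1) z^(t+1) - z^(2t+1)) / (1 - z)^N\<close> with \<open>N = t(2t+1)\<close>. The numerator is
  \<open>(1 - z)^3\<close> times a symmetric polynomial whose coefficients are the triangular numbers
  \<open>1, 3, 6, \<dots>\<close> up to the middle, so what remains is that the Krull dimension is \<open>N - 3\<close>. The upper
  bound holds because along a chain of primes the growth exponent of the affine Hilbert function
  drops at each step; the lower bound comes from an explicit chain of kernels of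
  specializations of a polynomial parametrization of the matrices of rank at most \<open>2t - 2\<close>.
\<close>

section \<open>Pfaffians as iterated contractions\<close>

text \<open>A weight, unlike a monomial order, leaves ties between terms, so the initial ideal is
  reached by direct rewriting. Each generator \<open>gen t j\<close> gets a set of permitted
  multipliers such that every monomial divisible by some \<open>lead t i\<close> is
  \<open>lead t j + u\<close> with \<open>u\<close> permitted for \<open>j\<close>, for exactly one
  \<open>j\<close>. A product with a forbidden multiplier is rewritten by a syzygy all of whose
  other terms weigh more, or weigh the same and have a smaller index; weights are bounded in each
  degree, so this ends. Relative to the whole polynomial ring, the permitted sets have the series
  \<open>1\<close>, then \<open>t\<close> times \<open>1 - z\<close>, then
  \<open>(1 - z)(1 - z^s)\<close> for \<open>s = 1, ..., t\<close>; their sum explains the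
  coefficients \<open>2t + 1\<close> of the numerator.

  The h-vector refers to the Krull dimension, so the factor \<open>(1 - z)^3\<close> of the
  numerator must be matched with lengths of chains of primes. On the side of matrices, 3 counts the
  indeterminates among the last three indices: a matrix of rank at most \<open>2t - 2\<close> in
  echelon form has parameters only for the others.

  Everything has to hold in characteristic 2, so alternation is always proved together with
  vanishing on repeated entries.\<close>

text \<open>
  A function of lists stands for a multilinear form and \<open>contract v\<close> for interior multiplication
  by \<open>v\<close>, so that \<open>pf (a # L) = contract (A a) L (pf A)\<close> is the expansion along the row \<open>a\<close>.
\<close>

fun contract :: "('a \<Rightarrow> 'r) \<Rightarrow> 'a list \<Rightarrow> ('a list \<Rightarrow> 'r) \<Rightarrow> 'r::comm_ring_1" where
  "contract v [] G = 0"
| "contract v (b # L) G = v b * G L - contract v L (\<lambda>M. G (b # M))"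

lemma contract_cong_length:
  assumes "\<And>M. Suc (length M) = length L \<Longrightarrow> G M = G' M"
  shows "contract v L G = contract v L G'"
  using assms
proof (induction L arbitrary: G G')
  case (Cons b L)
  have "contract v L (\<lambda>M. G (b # M)) = contract v L (\<lambda>M. G' (b # M))"
    by (rule Cons.IH) (simp add: Cons.prems)
  with Cons.prems[of L] show ?case by simp
qed simp

text \<open>The recursive calls of \<open>pf\<close> hide in the argument \<open>pf A\<close> of
  \<open>contract\<close>; this rule tells the termination check that they only meet lists shorter
  than \<open>L\<close>.\<close>

lemma contract_cong [fundef_cong]:
  assumes "v = v'" "L = L'" "\<And>M. length M < length L' \<Longrightarrow> G M = G' M"
  shows "contract v L G = contract v' L' G'"
  unfolding assms(1,2) by (rule contract_cong_length) (simp add: assms(3))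

lemma contract_add: "contract v L (\<lambda>M. G M + G' M) = contract v L G + contract v L G'"
  by (induction L arbitrary: G G') (auto simp: algebra_simps)

lemma contract_scale: "contract v L (\<lambda>M. c * G M) = c * contract v L G"
  by (induction L arbitrary: G) (auto simp: algebra_simps)

lemma contract_uminus: "contract v L (\<lambda>M. - G M) = - contract v L G"
  using contract_scale[of v L "-1" G] by simp

lemma contract_diff: "contract v L (\<lambda>M. G M - G' M) = contract v L G - contract v L G'"
  using contract_add[of v L G "\<lambda>M. - G' M"] by (simp add: contract_uminus)

lemma contract_zero [simp]: "contract v L (\<lambda>M. 0) = 0"
  by (induction L) auto

lemma contract_vec_add: "contract (\<lambda>x. v x + w x) L G = contract v L G + contract w L G"
  by (induction L arbitrary: G) (auto simp: algebra_simps)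

lemma contract_vec_scale: "contract (\<lambda>x. c * v x) L G = c * contract v L G"
  by (induction L arbitrary: G) (auto simp: algebra_simps)

lemma contract_vec_uminus: "contract (\<lambda>x. - v x) L G = - contract v L G"
  using contract_vec_scale[of "-1" v L G] by simp

lemma contract_vec_diff: "contract (\<lambda>x. v x - w x) L G = contract v L G - contract w L G"
  using contract_vec_add[of v "\<lambda>x. - w x" L G] by (simp add: contract_vec_uminus)

lemma contract_vec_zero [simp]: "contract (\<lambda>x. 0) L G = 0"
  by (induction L arbitrary: G) auto

lemma contract_anticommute:
  "contract v L (\<lambda>M. contract w M G) = - contract w L (\<lambda>M. contract v M G)"
proof (induction L arbitrary: G)
  case (Cons b L)
  show ?case
    unfolding contract.simps contract_diff contract_scale Cons.IH[of "\<lambda>N. G (b # N)"]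
    by (simp add: algebra_simps)
qed simp

text \<open>Anticommutation with \<open>w = v\<close> shows only that twice this value is zero,
  which is void in characteristic 2; hence a separate induction, in which the two mixed terms
  cancel.\<close>

lemma contract_twice: "contract v L (\<lambda>M. contract v M G) = 0"
proof (induction L arbitrary: G)
  case (Cons b L)
  show ?case
    unfolding contract.simps contract_diff contract_scale Cons.IH by simp
qed simp

definition del :: "nat \<Rightarrow> 'a list \<Rightarrow> 'a list" where
  "del i L = take i L @ drop (Suc i) L"

lemma del_0 [simp]: "del 0 (x # L) = L"
  and del_Suc [simp]: "del (Suc i) (x # L) = x # del i L"
  by (auto simp: del_def)

lemma length_del [simp]: "i < length L \<Longrightarrow> length (del i L) = length L - 1"
  by (auto simp: del_def)

lemma contract_expand:
  "contract v L G = (\<Sum>i<length L. (-1)^i * v (L ! i) * G (del i L))"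
proof (induction L arbitrary: G)
  case (Cons b L)
  show ?case
    unfolding list.size(4) add_Suc_right add_0_right sum.lessThan_Suc_shift contract.simps
    by (simp add: Cons.IH sum_negf)
qed simp

function pf :: "('a \<Rightarrow> 'a \<Rightarrow> 'r) \<Rightarrow> 'a list \<Rightarrow> 'r::comm_ring_1" where
  "pf A [] = 1"
| "pf A (a # L) = contract (A a) L (pf A)"
  by pat_completeness auto
termination
  by (relation "measure (\<lambda>(A, L). length L)") auto

text \<open>Only neighbouring entries are compared, which suits recursion on lists. Vanishing on a
  repeated entry is a clause of its own because in characteristic 2 the sign rule does not give it.
  The fixed length \<open>n\<close> is there for induction.\<close>

definition alt_swap :: "nat \<Rightarrow> ('a list \<Rightarrow> 'r::comm_ring_1) \<Rightarrow> bool" where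
  "alt_swap n G \<longleftrightarrow> (\<forall>P a b Q. length P + length Q + 2 = n \<longrightarrow>
     G (P @ a # b # Q) = - G (P @ b # a # Q) \<and> G (P @ a # a # Q) = 0)"

lemma alt_swapD:
  assumes "alt_swap n G" "length P + length Q + 2 = n"
  shows "G (P @ a # b # Q) = - G (P @ b # a # Q)" "G (P @ a # a # Q) = 0"
  using assms unfolding alt_swap_def by blast+

lemma alt_swap_Cons:
  assumes "alt_swap (Suc n) G" shows "alt_swap n (\<lambda>M. G (b # M))"
  unfolding alt_swap_def
proof (intro allI impI conjI)
  fix P Q :: "'a list" and a c assume "length P + length Q + 2 = n"
  then have "length (b # P) + length Q + 2 = Suc n" by simp
  from alt_swapD[OF assms this]
  show "G (b # P @ a # c # Q) = - G (b # P @ c # a # Q)" "G (b # P @ a # a # Q) = 0"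
    unfolding append_Cons by blast+
qed

text \<open>Interior multiplication keeps a form alternating. If the pair is at the head, the two
  summands that remove one of its entries are exchanged with opposite signs, or cancel, and the
  others inherit alternation from \<open>G\<close>; prefix entries are peeled off by
  induction.\<close>

lemma contract_alternating:
  assumes "alt_swap n G" "length P + length Q + 1 = n"
  shows "contract v (P @ a # b # Q) G = - contract v (P @ b # a # Q) G
       \<and> contract v (P @ a # a # Q) G = 0"
  using assms
proof (induction P arbitrary: G n)
  case Nil
  have *: "contract v Q (\<lambda>M. G (a # b # M)) = - contract v Q (\<lambda>M. G (b # a # M))"
    unfolding contract_uminus[symmetric]
    by (rule contract_cong_length) (use alt_swapD(1)[OF Nil(1), of "[]" _ a b] Nil(2) in simp)
  have "contract v Q (\<lambda>M. G (a # a # M)) = contract v Q (\<lambda>M. 0)"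
    by (rule contract_cong_length) (use alt_swapD(2)[OF Nil(1), of "[]" _ a] Nil(2) in simp)
  with * show ?case by simp
next
  case (Cons p P)
  then obtain m where n: "n = Suc m" by (cases n) auto
  have "alt_swap m (\<lambda>M. G (p # M))" using Cons.prems n by (auto intro: alt_swap_Cons)
  from Cons.IH[OF this] alt_swapD(1)[OF Cons.prems(1), of P Q a b]
    alt_swapD(2)[OF Cons.prems(1), of P Q a] Cons.prems(2) n
  show ?case by simp
qed

locale alternating =
  fixes A :: "'a \<Rightarrow> 'a \<Rightarrow> 'r::comm_ring_1"
  assumes skew: "A a b = - A b a" and diag: "A a a = 0"
begin

text \<open>A pair at the head is expanded twice: besides the term with \<open>A a b\<close> there
  is a double contraction, and contractions anticommute. A pair behind a first entry
  \<open>p\<close> lies inside one contraction of a shorter pfaffian, so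
  \<open>contract_alternating\<close> applies.\<close>

lemma pf_alt_swap: "alt_swap n (pf A)"
proof (induction n rule: less_induct)
  case (less n)
  show ?case
    unfolding alt_swap_def
  proof (intro allI impI)
    fix P Q :: "'a list" and a b assume n: "length P + length Q + 2 = n"
    show "pf A (P @ a # b # Q) = - pf A (P @ b # a # Q) \<and> pf A (P @ a # a # Q) = 0"
    proof (cases P)
      case Nil
      have "pf A (a # b # Q) = - pf A (b # a # Q)"
        unfolding pf.simps contract.simps contract_anticommute[of "A a" _ "A b"] skew[of a b] by simp
      moreover have "pf A (a # a # Q) = 0"
        by (simp add: contract_twice diag)
      ultimately show ?thesis using Nil by simp
    next
      case (Cons p P')
      then show ?thesis
        using contract_alternating[OF less.IH[of "n - 2"], of P' Q "A p" a b] n by simp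
    qed
  qed
qed

lemma pf_move: "pf A (P @ a # L @ Q) = (-1)^length L * pf A (P @ L @ a # Q)"
proof (induction L arbitrary: P)
  case (Cons b L)
  have "pf A (P @ a # b # (L @ Q)) = - pf A ((P @ [b]) @ a # L @ Q)"
    using alt_swapD(1)[OF pf_alt_swap refl, of P a b "L @ Q"] by simp
  also have "\<dots> = - ((-1)^length L * pf A ((P @ [b]) @ L @ a # Q))"
    using Cons.IH[of "P @ [b]"] by simp
  finally show ?case by simp
qed simp

lemma pf_repeated:
  assumes "a \<in> set L" shows "pf A (a # L) = 0"
proof -
  from assms obtain L1 L2 where L: "L = L1 @ a # L2" by (auto simp: in_set_conv_decomp)
  have "pf A (L1 @ a # a # L2) = 0"
    using alt_swapD(2)[OF pf_alt_swap refl] .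
  with pf_move[of "[]" a L1 "a # L2"] show ?thesis by (simp add: L)
qed

text \<open>The sum is the row expansion of \<open>pf A (i # F)\<close>, in which \<open>i\<close>
  occurs twice.\<close>

lemma pf_row_relation:
  assumes "i \<in> set F"
  shows "(\<Sum>j<length F. (-1)^j * A i (F ! j) * pf A (del j F)) = 0"
  using pf_repeated[OF assms] by (simp add: contract_expand)

text \<open>By expansion along its first row, \<open>pf A (x # T)\<close> is as a function of
  \<open>x\<close> a combination of the entries \<open>A x (T ! i)\<close>; so the sum is a
  combination of the row relations for the members of \<open>T\<close>.\<close>

lemma pf_exchange_relation:
  assumes "set T \<subseteq> set F"
  shows "(\<Sum>j<length F. (-1)^j * pf A (F ! j # T) * pf A (del j F)) = 0"
proof -
  have "contract (\<lambda>x. \<Sum>i<n. c i * A x (T ! i)) F (pf A) = 0" if "n \<le> length T" for n and c :: "nat \<Rightarrow> 'r"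
    using that
  proof (induction n)
    case (Suc n)
    have "contract (A (T ! n)) F (pf A) = 0"
      using pf_repeated[of "T ! n" F] Suc.prems assms by (auto simp: subset_iff)
    then have "contract (\<lambda>x. c n * A x (T ! n)) F (pf A) = 0"
      unfolding skew[of _ "T ! n"] by (simp add: contract_vec_uminus contract_vec_scale)
    with Suc show ?case by (simp add: contract_vec_add)
  qed simp
  from this[of "length T" "\<lambda>i. (-1)^i * pf A (del i T)"]
  have "contract (\<lambda>x. pf A (x # T)) F (pf A) = 0"
    by (simp add: contract_expand mult_ac)
  then show ?thesis by (simp add: contract_expand)
qed

end

text \<open>The right side is the exponential of the double contraction by \<open>v\<close> and
  \<open>w\<close>, applied to \<open>pf A\<close>; it stops after the linear term because a
  contraction squares to zero.\<close>

lemma pf_add_rank_two: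
  "pf (\<lambda>a b. A a b + (v a * w b - w a * v b)) L
     = pf A L + contract v L (\<lambda>M. contract w M (pf A))"
proof (induction "length L" arbitrary: L rule: less_induct)
  case less
  let ?B = "\<lambda>a b. A a b + (v a * w b - w a * v b)"
  let ?G = "\<lambda>M. contract v M (\<lambda>M. contract w M (pf A))"
  show ?case
  proof (cases L)
    case (Cons a L')
    have anti: "contract (A a) L' ?G = contract v L' (\<lambda>M. contract w M (\<lambda>N. contract (A a) N (pf A)))"
      unfolding contract_anticommute[of "A a" _ v] contract_anticommute[of "A a" _ w]
      by (simp add: contract_uminus)
    have 0: "contract w L' ?G = 0"
      by (subst contract_anticommute) (simp add: contract_twice contract_uminus)
    have "pf ?B L = contract (?B a) L' (\<lambda>M. pf A M + ?G M)"
      unfolding Cons pf.simps by (rule contract_cong) (use less Cons in auto)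
    also have "\<dots> = contract (A a) L' (pf A) + contract (A a) L' ?G
       + v a * contract w L' (pf A) - w a * contract v L' (pf A)"
      unfolding contract_add contract_vec_add contract_vec_diff contract_vec_scale contract_twice 0
      by (simp add: algebra_simps)
    also have "\<dots> = pf A L + ?G L"
      by (simp add: Cons anti contract_diff contract_scale)
    finally show ?thesis .
  qed simp
qed

text \<open>Each rank-two summand adds a doubly contracted pfaffian, on lists shorter by two. The
  induction on \<open>r\<close> ends at the zero matrix, whose pfaffian vanishes on nonempty
  lists.\<close>

lemma pf_low_rank:
  assumes "2 * r < length L"
  shows "pf (\<lambda>a b. \<Sum>i<r. v i a * w i b - w i a * v i b) L = 0"
  using assms
proof (induction r arbitrary: L)
  case 0
  then show ?case by (cases L) auto
next
  case (Suc r)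
  have "contract (v r) L (\<lambda>M. contract (w r) M (pf (\<lambda>a b. \<Sum>i<r. v i a * w i b - w i a * v i b)))
      = contract (v r) L (\<lambda>M. contract (w r) M (\<lambda>N. 0))"
    by (rule contract_cong_length, rule contract_cong_length, rule Suc.IH) (use Suc.prems in auto)
  with Suc show ?case by (simp add: pf_add_rank_two)
qed

section \<open>Matchings\<close>

definition matchings :: "nat \<Rightarrow> (nat \<Rightarrow> nat) set" where
  "matchings n = {\<pi>. \<pi> permutes {..<2 * n} \<and> (\<forall>i<n. \<pi> (2 * i) < \<pi> (2 * i + 1)) \<and>
     (\<forall>i j. i < j \<and> j < n \<longrightarrow> \<pi> (2 * i) < \<pi> (2 * j))}"

lemma pfaffian_matchings:
  "pfaffian n A = (\<Sum>\<pi>\<in>matchings n. of_int (sign \<pi>) * (\<Prod>i<n. A (\<pi> (2 * i)) (\<pi> (2 * i + 1))))"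
  unfolding pfaffian_def matchings_def by simp

text \<open>The cycle that puts the index \<open>j + 1\<close> into position 1, right behind 0, and
  leaves the other indices in increasing order.\<close>

definition cyc :: "nat \<Rightarrow> nat \<Rightarrow> nat" where
  "cyc j m = (if m = 1 then j + 1 else if 2 \<le> m \<and> m \<le> j + 1 then m - 1 else m)"

definition cyc_inv :: "nat \<Rightarrow> nat \<Rightarrow> nat" where
  "cyc_inv j m = (if m = j + 1 then 1 else if 1 \<le> m \<and> m \<le> j then m + 1 else m)"

lemma cyc_cyc_inv [simp]: "cyc j (cyc_inv j m) = m"
  and cyc_inv_cyc [simp]: "cyc_inv j (cyc j m) = m"
  by (auto simp: cyc_def cyc_inv_def split: if_splits)

lemma cyc_mono: "2 \<le> a \<Longrightarrow> 2 \<le> b \<Longrightarrow> cyc j a < cyc j b \<longleftrightarrow> a < b"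
  by (auto simp: cyc_def)

lemma cyc_permutation_sign: "permutation (cyc j) \<and> sign (cyc j) = (-1) ^ j"
proof (induction j)
  case 0
  have "cyc 0 = id" by (auto simp: cyc_def)
  then show ?case by simp
next
  case (Suc j)
  have eq: "cyc (Suc j) = transpose (j + 1) (j + 2) \<circ> cyc j"
    by (auto simp: fun_eq_iff cyc_def transpose_def)
  have "permutation (transpose (j + 1) (j + 2))" "sign (transpose (j + 1) (j + 2)) = -1"
    by (simp_all add: permutation_swap_id sign_swap_id)
  then show ?case
    unfolding eq using Suc by (auto simp only: permutation_compose sign_compose power_Suc)
qed

lemma cyc_permutes:
  assumes "j < 2 * n + 1" shows "cyc j permutes {..<2 * n + 2}"
proof (rule bij_imp_permutes)
  show "bij_betw (cyc j) {..<2 * n + 2} {..<2 * n + 2}"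
    by (rule bij_betwI[of _ _ _ "cyc_inv j"]) (use assms in \<open>auto simp: cyc_def cyc_inv_def\<close>)
qed (use assms in \<open>auto simp: cyc_def\<close>)

definition shift2 :: "(nat \<Rightarrow> nat) \<Rightarrow> nat \<Rightarrow> nat" where
  "shift2 \<pi> k = (if k < 2 then k else \<pi> (k - 2) + 2)"

lemma shift2_permutes_sign:
  assumes "\<pi> permutes {..<m}"
  shows "shift2 \<pi> permutes {..<m + 2} \<and> sign (shift2 \<pi>) = sign \<pi>"
proof -
  let ?f = "\<lambda>k::nat. k + 2"
  have im: "?f ` {..<m} = {2..<m + 2}"
    using image_add_atLeastLessThan'[of 2 0 m] by (simp add: atLeast0LessThan numeral_2_eq_2)
  have "map_permutation {..<m} ?f \<pi> = shift2 \<pi>"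
  proof
    fix k
    show "map_permutation {..<m} ?f \<pi> k = shift2 \<pi> k"
    proof (cases "k \<in> ?f ` {..<m}")
      case True
      then obtain x where "x < m" "k = ?f x" by auto
      moreover have "inv_into {..<m} ?f (?f x) = x"
        by (rule inv_into_f_f) (use \<open>x < m\<close> in \<open>auto simp: inj_on_def\<close>)
      ultimately show ?thesis
        by (simp add: map_permutation_def restrict_id_def shift2_def)
    next
      case False
      then have "k < 2 \<or> k - 2 \<notin> {..<m}" unfolding im by auto
      with False show ?thesis
        using permutes_not_in[OF assms, of "k - 2"]
        by (auto simp: map_permutation_def restrict_id_def shift2_def)
    qed
  qed
  moreover have "map_permutation {..<m} ?f \<pi> permutes ?f ` {..<m}"
    by (rule map_permutation_permutes) (use assms in \<open>auto simp: bij_betw_def inj_on_def\<close>)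
  moreover have "sign (map_permutation {..<m} ?f \<pi>) = sign \<pi>"
    by (rule sign_map_permutation) (use assms in \<open>auto simp: inj_on_def\<close>)
  ultimately show ?thesis
    unfolding im by (metis permutes_subset ivl_subset le0 order_refl atLeast0LessThan)
qed

text \<open>A matching of \<open>2n + 2\<close> points is the partner \<open>j + 1\<close> of 0
  together with a matching of the other points; \<open>cyc j\<close> renames
  \<open>2, 3, ...\<close> monotonically to those points, so increasing pairs stay
  increasing.\<close>

definition extend_matching :: "nat \<Rightarrow> (nat \<Rightarrow> nat) \<Rightarrow> nat \<Rightarrow> nat" where
  "extend_matching j \<pi> = cyc j \<circ> shift2 \<pi>"

lemma extend_matching_simps [simp]:
  "extend_matching j \<pi> 0 = 0"
  "extend_matching j \<pi> (Suc 0) = j + 1"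
  "extend_matching j \<pi> (Suc (Suc k)) = cyc j (\<pi> k + 2)"
  by (auto simp: extend_matching_def shift2_def cyc_def)

lemma extend_matching_in:
  assumes "j < 2 * n + 1" "\<pi> \<in> matchings n"
  shows "extend_matching j \<pi> \<in> matchings (Suc n)"
proof -
  have "extend_matching j \<pi> permutes {..<2 * Suc n}"
    using permutes_compose[OF conjunct1[OF shift2_permutes_sign] cyc_permutes[OF assms(1)]] assms(2)
    by (auto simp: matchings_def extend_matching_def)
  moreover have "extend_matching j \<pi> (2 * i) < extend_matching j \<pi> (2 * i + 1)" if "i < Suc n" for i
    using that assms(2) by (cases i) (auto simp: cyc_mono matchings_def)
  moreover have "extend_matching j \<pi> (2 * i) < extend_matching j \<pi> (2 * k)" if "i < k" "k < Suc n" for i k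
  proof -
    have "0 < cyc j (x + 2)" for x by (simp add: cyc_def)
    then show ?thesis
      using that assms(2) by (cases i; cases k) (auto simp: cyc_mono matchings_def)
  qed
  ultimately show ?thesis by (auto simp: matchings_def)
qed

lemma extend_matching_inj:
  assumes "extend_matching j \<pi> = extend_matching j' \<pi>'"
  shows "j = j' \<and> \<pi> = \<pi>'"
proof -
  have j: "j = j'" using fun_cong[OF assms, of "Suc 0"] by simp
  have "\<pi> k = \<pi>' k" for k
    using fun_cong[OF assms, of "Suc (Suc k)"] j
    by simp (metis add_right_cancel cyc_inv_cyc add_2_eq_Suc')
  with j show ?thesis by auto
qed

lemma extend_matching_surj:
  assumes "\<rho> \<in> matchings (Suc n)"
  obtains j \<pi> where "j < 2 * n + 1" "\<pi> \<in> matchings n" "\<rho> = extend_matching j \<pi>"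
proof -
  have perm: "\<rho> permutes {..<2 * n + 2}"
    and m1: "\<And>i. i < Suc n \<Longrightarrow> \<rho> (2 * i) < \<rho> (2 * i + 1)"
    and m2: "\<And>i k. i < k \<Longrightarrow> k < Suc n \<Longrightarrow> \<rho> (2 * i) < \<rho> (2 * k)"
    using assms by (auto simp: matchings_def)
  have inj: "\<rho> x = \<rho> y \<longleftrightarrow> x = y" for x y
    using permutes_inj[OF perm] by (auto dest: injD)
  obtain m where m: "\<rho> m = 0" using permutes_surj[OF perm] by (metis surjD)
  \<comment> \<open>The value 0 can stand only at position 0: at an odd position its partner would
    be smaller, at a later even position the first pair would start lower.\<close>
  have r0: "\<rho> 0 = 0"
  proof (cases "m < 2 * n + 2")
    case True
    show ?thesis
    proof (cases "even m")
      case True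
      then obtain i where "m = 2 * i" by auto
      then show ?thesis using m m2[of 0 i] \<open>m < 2 * n + 2\<close> by (cases i) auto
    next
      case False
      then obtain i where "m = 2 * i + 1" by (auto elim: oddE)
      then show ?thesis using m m1[of i] \<open>m < 2 * n + 2\<close> by auto
    qed
  next
    case False
    then show ?thesis using m permutes_not_in[OF perm, of m] by auto
  qed
  define j where "j = \<rho> 1 - 1"
  have r1: "\<rho> 1 = j + 1" using m1[of 0] r0 by (simp add: j_def)
  have j: "j < 2 * n + 1" using permutes_in_image[OF perm, of 1] r1 by simp
  \<comment> \<open>Undo \<open>cyc j\<close>, then drop the two leading positions;
    \<open>ge\<close> shows that the subtraction of 2 does not truncate.\<close>
  define \<pi> where "\<pi> k = cyc_inv j (\<rho> (k + 2)) - 2" for k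
  have ge: "2 \<le> cyc_inv j (\<rho> (k + 2))" for k
    using inj[of "k + 2" 0] inj[of "k + 2" 1] r0 r1 by (auto simp: cyc_inv_def)
  have cyc_pi: "cyc j (\<pi> k + 2) = \<rho> (k + 2)" for k
    using ge[of k] unfolding \<pi>_def by (metis le_add_diff_inverse2 cyc_cyc_inv)
  have rho: "\<rho> = extend_matching j \<pi>"
  proof
    fix k show "\<rho> k = extend_matching j \<pi> k"
    proof (cases "k < 2")
      case True
      then have "k = 0 \<or> k = 1" by auto
      then show ?thesis using r0 r1 by auto
    next
      case False
      then obtain k' where "k = k' + 2" by (metis add.commute le_Suc_ex not_less)
      then show ?thesis using cyc_pi[of k'] by simp
    qed
  qed
  have fixed: "\<pi> k = k" if "2 * n \<le> k" for k
    using permutes_not_in[OF perm, of "k + 2"] that j by (auto simp: \<pi>_def cyc_inv_def)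
  have "inj \<pi>"
    by (rule injI) (metis cyc_pi inj add_right_cancel)
  have "\<pi> k < 2 * n" if "k < 2 * n" for k
  proof (rule ccontr)
    assume "\<not> ?thesis"
    then have "\<pi> (\<pi> k) = \<pi> k" by (intro fixed) auto
    with \<open>inj \<pi>\<close> have "\<pi> k = k" by (auto dest: injD)
    with that \<open>\<not> ?thesis\<close> show False by auto
  qed
  then have "\<pi> ` {..<2 * n} = {..<2 * n}"
    using \<open>inj \<pi>\<close> by (intro endo_inj_surj) (auto intro: inj_on_subset)
  then have "\<pi> permutes {..<2 * n}"
    using \<open>inj \<pi>\<close> by (intro bij_imp_permutes) (auto simp: bij_betw_def fixed intro: inj_on_subset)
  moreover have "\<pi> (2 * i) < \<pi> (2 * i + 1)" if "i < n" for i
    using m1[of "Suc i"] that cyc_mono[of "\<pi> (2 * i) + 2" "\<pi> (2 * i + 1) + 2" j]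
    by (simp add: cyc_pi rho)
  moreover have "\<pi> (2 * i) < \<pi> (2 * k)" if "i < k" "k < n" for i k
    using m2[of "Suc i" "Suc k"] that cyc_mono[of "\<pi> (2 * i) + 2" "\<pi> (2 * k) + 2" j]
    by (simp add: cyc_pi rho)
  ultimately have "\<pi> \<in> matchings n" by (auto simp: matchings_def)
  from that[OF j this rho] show ?thesis .
qed

lemma pfaffian_expand:
  "pfaffian (Suc n) A = (\<Sum>j<2 * n + 1. (-1) ^ j * A 0 (j + 1) *
     pfaffian n (\<lambda>k l. A (cyc j (k + 2)) (cyc j (l + 2))))"
proof -
  let ?e = "\<lambda>(j, \<pi>). extend_matching j \<pi>"
  have "matchings (Suc n) = ?e ` ({..<2 * n + 1} \<times> matchings n)"
    by (auto intro: extend_matching_in elim!: extend_matching_surj)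
  moreover have "inj_on ?e ({..<2 * n + 1} \<times> matchings n)"
    by (auto simp: inj_on_def dest: extend_matching_inj)
  ultimately have "pfaffian (Suc n) A = (\<Sum>(j, \<pi>)\<in>{..<2 * n + 1} \<times> matchings n.
      of_int (sign (extend_matching j \<pi>)) *
      (\<Prod>i<Suc n. A (extend_matching j \<pi> (2 * i)) (extend_matching j \<pi> (2 * i + 1))))"
    by (simp add: pfaffian_matchings sum.reindex case_prod_unfold)
  also have "\<dots> = (\<Sum>j<2 * n + 1. \<Sum>\<pi>\<in>matchings n. (-1) ^ j * A 0 (j + 1) *
      (of_int (sign \<pi>) * (\<Prod>i<n. A (cyc j (\<pi> (2 * i) + 2)) (cyc j (\<pi> (2 * i + 1) + 2)))))"
    unfolding sum.cartesian_product[symmetric]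
  proof (intro sum.cong refl, goal_cases)
    case (1 j \<pi>)
    then have perm: "\<pi> permutes {..<2 * n}" by (simp add: matchings_def)
    have "permutation (shift2 \<pi>)"
      using shift2_permutes_sign[OF perm] by (auto intro: permutation_permutes[THEN iffD2])
    then have "sign (extend_matching j \<pi>) = (-1) ^ j * sign \<pi>"
      unfolding extend_matching_def using cyc_permutation_sign[of j] shift2_permutes_sign[OF perm]
      by (simp add: sign_compose)
    then show ?case
      unfolding prod.lessThan_Suc_shift by (simp add: mult_ac)
  qed
  finally show ?thesis
    by (simp add: pfaffian_matchings sum_distrib_left)
qed

lemma pfaffian_cong:
  assumes "\<And>k l. k < 2 * n \<Longrightarrow> l < 2 * n \<Longrightarrow> A k l = B k l"
  shows "pfaffian n A = pfaffian n B"
  unfolding pfaffian_matchings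
proof (intro sum.cong refl arg_cong2[of _ _ _ _ "(*)"] prod.cong, goal_cases)
  case (1 \<pi> i)
  then have "\<pi> permutes {..<2 * n}" by (simp add: matchings_def)
  from permutes_in_image[OF this, of "2 * i"] permutes_in_image[OF this, of "2 * i + 1"] 1
  show ?case by (intro assms) auto
qed

text \<open>Both sides have the same row expansion: once 0 and \<open>j + 1\<close> are removed,
  \<open>cyc j\<close> enumerates the remaining positions in order, just as \<open>del j\<close>
  does on the tail of \<open>L\<close>.\<close>

lemma pfaffian_eq_pf:
  assumes "length L = 2 * n"
  shows "pfaffian n (\<lambda>k l. A (L ! k) (L ! l)) = pf A L"
  using assms
proof (induction n arbitrary: L)
  case 0
  have "matchings 0 = {id}" by (auto simp: matchings_def)
  with 0 show ?case by (simp add: pfaffian_matchings)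
next
  case (Suc n)
  then obtain a L' where L: "L = a # L'" "length L' = 2 * n + 1" by (cases L) auto
  have "pfaffian n (\<lambda>k l. A (L ! cyc j (k + 2)) (L ! cyc j (l + 2))) = pf A (del j L')"
    if "j < 2 * n + 1" for j
  proof -
    have "L ! cyc j (k + 2) = del j L' ! k" if "k < 2 * n" for k
      using that \<open>j < 2 * n + 1\<close> L by (auto simp: cyc_def del_def nth_append)
    then have "pfaffian n (\<lambda>k l. A (L ! cyc j (k + 2)) (L ! cyc j (l + 2)))
        = pfaffian n (\<lambda>k l. A (del j L' ! k) (del j L' ! l))"
      by (intro pfaffian_cong) simp
    also have "\<dots> = pf A (del j L')"
      using that L by (intro Suc.IH) simp
    finally show ?thesis .
  qed
  then show ?case
    by (simp add: pfaffian_expand L contract_expand)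
qed

section \<open>Bases given by terms of least weight\<close>

abbreviation monom_of :: "('v \<Rightarrow>\<^sub>0 nat) \<Rightarrow> ('v, 'a::field) mpoly" where
  "monom_of e \<equiv> Poly_Mapping.single e 1"

abbreviation coef :: "('v, 'a::field) mpoly \<Rightarrow> ('v \<Rightarrow>\<^sub>0 nat) \<Rightarrow> 'a" where
  "coef \<equiv> Poly_Mapping.lookup"

lemma poly_mapping_sum_single:
  "p = (\<Sum>e\<in>Poly_Mapping.keys p. Poly_Mapping.single e (Poly_Mapping.lookup p e))"
proof (rule poly_mapping_eqI)
  fix k
  have "(\<Sum>e\<in>Poly_Mapping.keys p. Poly_Mapping.lookup (Poly_Mapping.single e (Poly_Mapping.lookup p e)) k)
      = (\<Sum>e\<in>Poly_Mapping.keys p. if e = k then Poly_Mapping.lookup p e else 0)"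
    by (intro sum.cong) (auto simp: lookup_single when_def)
  then show "Poly_Mapping.lookup p k = Poly_Mapping.lookup
      (\<Sum>e\<in>Poly_Mapping.keys p. Poly_Mapping.single e (Poly_Mapping.lookup p e)) k"
    by (auto simp: lookup_sum in_keys_iff)
qed

lemma mult_sum_single:
  fixes p q :: "('v, 'a::field) mpoly"
  shows "q * p = (\<Sum>e\<in>Poly_Mapping.keys q. mpoly_const (coef q e) * (p * monom_of e))"
proof -
  have "q * p = (\<Sum>e\<in>Poly_Mapping.keys q. Poly_Mapping.single e (coef q e)) * p"
    using poly_mapping_sum_single[of q] by simp
  also have "\<dots> = (\<Sum>e\<in>Poly_Mapping.keys q. Poly_Mapping.single e (coef q e) * p)"
    by (rule sum_distrib_right)
  also have "\<dots> = (\<Sum>e\<in>Poly_Mapping.keys q. mpoly_const (coef q e) * (p * monom_of e))"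
    by (intro sum.cong refl)
      (simp add: mpoly_const_def mult_single mult.commute[of p] flip: mult.assoc)
  finally show ?thesis .
qed

lemma coef_mult_monom:
  fixes p :: "('v, 'a::field) mpoly"
  shows "coef (p * monom_of u) (e + u) = coef p e"
proof -
  have "p * monom_of u = (\<Sum>e\<in>Poly_Mapping.keys p. Poly_Mapping.single (e + u) (coef p e))"
    using arg_cong[OF poly_mapping_sum_single[of p], of "\<lambda>p. p * monom_of u"]
    by (simp add: sum_distrib_right mult_single)
  then have "coef (p * monom_of u) (e + u) = (\<Sum>e'\<in>Poly_Mapping.keys p. if e' = e then coef p e' else 0)"
    by (auto simp: lookup_sum lookup_single when_def intro!: sum.cong)
  then show ?thesis by (auto simp: in_keys_iff)
qed

lemma keys_mult_monom:
  fixes p :: "('v, 'a::field) mpoly"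
  shows "Poly_Mapping.keys (p * monom_of u) = (\<lambda>e. e + u) ` Poly_Mapping.keys p"
proof
  show "Poly_Mapping.keys (p * monom_of u) \<subseteq> (\<lambda>e. e + u) ` Poly_Mapping.keys p"
    by (auto elim!: mpoly_keys_mult split: if_splits)
  show "(\<lambda>e. e + u) ` Poly_Mapping.keys p \<subseteq> Poly_Mapping.keys (p * monom_of u)"
    by (auto simp: in_keys_iff coef_mult_monom)
qed

lemma coef_const_mult: "coef (mpoly_const c * p) e = c * coef p e"
proof -
  have "mpoly_const c * p = (\<Sum>e\<in>Poly_Mapping.keys p. Poly_Mapping.single e (c * coef p e))"
    using arg_cong[OF poly_mapping_sum_single[of p], of "\<lambda>p. mpoly_const c * p"]
    by (simp add: sum_distrib_left mult_single mpoly_const_def)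
  then have "coef (mpoly_const c * p) e = (\<Sum>e'\<in>Poly_Mapping.keys p. if e' = e then c * coef p e' else 0)"
    by (auto simp: lookup_sum lookup_single when_def intro!: sum.cong)
  then show ?thesis by (auto simp: in_keys_iff)
qed

lemma keys_const_mult: "Poly_Mapping.keys (mpoly_const c * p) \<subseteq> Poly_Mapping.keys p"
  by (auto simp: in_keys_iff coef_const_mult)

lemma keys_sum_subset:
  "Poly_Mapping.keys (sum f A) \<subseteq> (\<Union>a\<in>A. Poly_Mapping.keys (f a))"
  by (induction A rule: infinite_finite_induct) (use Poly_Mapping.keys_add in \<open>fastforce+\<close>)

lemma keys_minus_subset:
  fixes p q :: "'v \<Rightarrow>\<^sub>0 'b::ab_group_add"
  shows "Poly_Mapping.keys (p - q) \<subseteq> Poly_Mapping.keys p \<union> Poly_Mapping.keys q"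
  by (auto simp: in_keys_iff lookup_minus)

lemma keys_add_nat: "Poly_Mapping.keys (e + u) = Poly_Mapping.keys e \<union> Poly_Mapping.keys u"
  for e u :: "'v \<Rightarrow>\<^sub>0 nat"
  by (auto simp: in_keys_iff lookup_add)

lemma keys_sum_nat:
  "finite A \<Longrightarrow> Poly_Mapping.keys (sum f A) = (\<Union>a\<in>A. Poly_Mapping.keys (f a))"
  for f :: "'b \<Rightarrow> 'v \<Rightarrow>\<^sub>0 nat"
  by (induction A rule: finite_induct) (auto simp: keys_add_nat)

lemma total_degree_add [simp]: "total_degree (e + u) = total_degree e + total_degree u"
  unfolding total_degree_def by (rule setsum_keys_plus_distrib) auto

lemma total_degree_zero [simp]: "total_degree 0 = 0"
  by (simp add: total_degree_def)

lemma total_degree_single [simp]: "total_degree (Poly_Mapping.single v k) = k"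
  by (simp add: total_degree_def)

lemma total_degree_sum: "total_degree (sum f A) = (\<Sum>a\<in>A. total_degree (f a))"
  by (induction A rule: infinite_finite_induct) auto

text \<open>
  The weight of \<open>x\<^sub>i\<^sub>j\<close> is \<open>i * j\<close>. Among the monomials of a pfaffian, the one of the
  nested matching has the least weight, by the rearrangement inequality; lowest-weight forms take the
  place of leading terms.
\<close>

definition weight :: "(nat \<times> nat \<Rightarrow>\<^sub>0 nat) \<Rightarrow> nat" where
  "weight e = (\<Sum>v\<in>Poly_Mapping.keys e. Poly_Mapping.lookup e v * (fst v * snd v))"

lemma weight_add [simp]: "weight (e + u) = weight e + weight u"
  unfolding weight_def by (rule setsum_keys_plus_distrib) (auto simp: algebra_simps)

lemma weight_zero [simp]: "weight 0 = 0"
  by (simp add: weight_def)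

lemma weight_single [simp]: "weight (Poly_Mapping.single (i, j) k) = k * (i * j)"
  by (simp add: weight_def)

lemma weight_sum: "weight (sum f A) = (\<Sum>a\<in>A. weight (f a))"
  by (induction A rule: infinite_finite_induct) auto

definition lowest :: "(nat \<times> nat \<Rightarrow>\<^sub>0 nat) \<Rightarrow> (nat \<times> nat, 'a::field) mpoly \<Rightarrow> bool" where
  "lowest e p \<longleftrightarrow> coef p e = 1 \<and> (\<forall>e'\<in>Poly_Mapping.keys p. e' \<noteq> e \<longrightarrow> weight e < weight e')"

lemma lowest_le: "lowest e p \<Longrightarrow> e' \<in> Poly_Mapping.keys p \<Longrightarrow> weight e \<le> weight e'"
  unfolding lowest_def by (metis order.strict_implies_order order_refl)

section \<open>Rewriting by syzygies and standard monomials\<close>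

definition monomials :: "'v set \<Rightarrow> nat \<Rightarrow> ('v \<Rightarrow>\<^sub>0 nat) set" where
  "monomials V m = {e. Poly_Mapping.keys e \<subseteq> V \<and> total_degree e = m}"

lemma monomials_add:
  "e \<in> monomials V m \<Longrightarrow> u \<in> monomials V k \<Longrightarrow> e + u \<in> monomials V (m + k)"
  by (auto simp: monomials_def keys_add_nat)

lemma monomials_add_cancel:
  "e + u \<in> monomials V m \<Longrightarrow> e \<in> monomials V k \<Longrightarrow> u \<in> monomials V (m - k)"
  by (auto simp: monomials_def keys_add_nat)

lemma graded_part_iff: "p \<in> graded_part V m \<longleftrightarrow> Poly_Mapping.keys p \<subseteq> monomials V m"
  by (auto simp: graded_part_def poly_ring_def monomials_def)

lemma carrier_poly_ring_iff:
  "p \<in> carrier (poly_ring V) \<longleftrightarrow> (\<forall>e\<in>Poly_Mapping.keys p. Poly_Mapping.keys e \<subseteq> V)"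
  by (simp add: poly_ring_def)

text \<open>A rewriting rule for \<open>p j\<close> times the monomial \<open>u\<close>: the term
  \<open>e0\<close> of \<open>q j\<close> divides \<open>u\<close>, and every other term of the
  syzygy leads to a larger weight, or to the same weight and a smaller index. The common degree
  \<open>g\<close> keeps the rewriting within one degree.\<close>

definition syzygy_reduction ::
  "(nat \<times> nat) set \<Rightarrow> nat \<Rightarrow> (nat \<Rightarrow> (nat \<times> nat, 'a::field) mpoly) \<Rightarrow>
    (nat \<Rightarrow> (nat \<times> nat \<Rightarrow>\<^sub>0 nat)) \<Rightarrow> nat \<Rightarrow> (nat \<times> nat \<Rightarrow>\<^sub>0 nat) \<Rightarrow> bool" where
  "syzygy_reduction V n p l j u \<longleftrightarrow> (\<exists>q g e0 u'. (\<Sum>i<n. q i * p i) = 0 \<and>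
     (\<forall>i<n. q i \<in> graded_part V g) \<and> e0 \<in> Poly_Mapping.keys (q j) \<and> u = e0 + u' \<and>
     (\<forall>i<n. \<forall>e\<in>Poly_Mapping.keys (q i). (i, e) \<noteq> (j, e0) \<longrightarrow>
       weight (l j) + weight e0 < weight (l i) + weight e \<or>
       (weight (l j) + weight e0 = weight (l i) + weight e \<and> i < j)))"

lemma syzygy_reductionI:
  assumes "(\<Sum>i<n. q i * p i) = 0" "\<And>i. i < n \<Longrightarrow> q i \<in> graded_part V g"
    "e0 \<in> Poly_Mapping.keys (q j)" "u = e0 + u'"
    "\<And>i e. i < n \<Longrightarrow> e \<in> Poly_Mapping.keys (q i) \<Longrightarrow> (i, e) \<noteq> (j, e0) \<Longrightarrow>
       weight (l j) + weight e0 < weight (l i) + weight e \<or>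
       (weight (l j) + weight e0 = weight (l i) + weight e \<and> i < j)"
  shows "syzygy_reduction V n p l j u"
  unfolding syzygy_reduction_def using assms by blast

text \<open>\<open>S j\<close> holds the multipliers permitted for \<open>p j\<close>: all others
  can be rewritten, and permitted products have distinct lowest terms. This serves as a Groebner
  basis criterion for a comparison that is only partial; as rewriting moves towards larger weights,
  the bound \<open>C\<close> per degree takes the place of a well-ordering.\<close>

locale lowest_basis =
  fixes V :: "(nat \<times> nat) set" and n D C :: nat
    and p :: "nat \<Rightarrow> (nat \<times> nat, 'a::field) mpoly"
    and l :: "nat \<Rightarrow> (nat \<times> nat \<Rightarrow>\<^sub>0 nat)"
    and S :: "nat \<Rightarrow> (nat \<times> nat \<Rightarrow>\<^sub>0 nat) \<Rightarrow> bool"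
  assumes weight_bound: "e \<in> monomials V m \<Longrightarrow> weight e \<le> C * m"
    and lowest_p: "j < n \<Longrightarrow> lowest (l j) (p j)"
    and graded_p: "j < n \<Longrightarrow> p j \<in> graded_part V D"
    and reduce: "j < n \<Longrightarrow> u \<in> monomials V m \<Longrightarrow> \<not> S j u \<Longrightarrow>
      syzygy_reduction V n p l j u"
    and disjoint: "i < n \<Longrightarrow> j < n \<Longrightarrow> S i u \<Longrightarrow> S j v \<Longrightarrow> l i + u = l j + v \<Longrightarrow> i = j"
begin

definition represented :: "(nat \<times> nat, 'a) mpoly \<Rightarrow> bool" where
  "represented f \<longleftrightarrow> (\<exists>q. f = (\<Sum>i<n. q i * p i) \<and>
     (\<forall>i<n. \<forall>e\<in>Poly_Mapping.keys (q i). S i e \<and> Poly_Mapping.keys e \<subseteq> V))"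

lemma l_in: "j < n \<Longrightarrow> l j \<in> monomials V D"
  using lowest_p[of j] graded_p[of j] unfolding lowest_def graded_part_iff
  by (metis in_keys_iff subsetD zero_neq_one)

lemma represented_zero: "represented 0"
  unfolding represented_def by (rule exI[of _ "\<lambda>_. 0"]) simp

lemma represented_add:
  assumes "represented f" "represented g" shows "represented (f + g)"
proof -
  from assms obtain q r where qr: "f = (\<Sum>i<n. q i * p i)" "g = (\<Sum>i<n. r i * p i)"
    "\<forall>i<n. \<forall>e\<in>Poly_Mapping.keys (q i). S i e \<and> Poly_Mapping.keys e \<subseteq> V"
    "\<forall>i<n. \<forall>e\<in>Poly_Mapping.keys (r i). S i e \<and> Poly_Mapping.keys e \<subseteq> V"
    unfolding represented_def by blast
  have "f + g = (\<Sum>i<n. (q i + r i) * p i)" by (simp add: qr sum.distrib algebra_simps)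
  moreover have "S i e \<and> Poly_Mapping.keys e \<subseteq> V" if "i < n" "e \<in> Poly_Mapping.keys (q i + r i)" for i e
    using that qr Poly_Mapping.keys_add[of "q i" "r i"] by blast
  ultimately show ?thesis unfolding represented_def by (intro exI[of _ "\<lambda>i. q i + r i"]) blast
qed

lemma represented_const_mult:
  assumes "represented f" shows "represented (mpoly_const c * f)"
proof -
  from assms obtain q where q: "f = (\<Sum>i<n. q i * p i)"
    "\<forall>i<n. \<forall>e\<in>Poly_Mapping.keys (q i). S i e \<and> Poly_Mapping.keys e \<subseteq> V"
    unfolding represented_def by blast
  have "mpoly_const c * f = (\<Sum>i<n. (mpoly_const c * q i) * p i)"
    by (simp add: q(1) sum_distrib_left mult.assoc)
  moreover have "S i e \<and> Poly_Mapping.keys e \<subseteq> V" if "i < n" "e \<in> Poly_Mapping.keys (mpoly_const c * q i)" for i e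
    using that q(2) keys_const_mult by blast
  ultimately show ?thesis unfolding represented_def
    by (intro exI[of _ "\<lambda>i. mpoly_const c * q i"]) blast
qed

lemma represented_sum: "(\<And>a. a \<in> A \<Longrightarrow> represented (f a)) \<Longrightarrow> represented (sum f A)"
  by (induction A rule: infinite_finite_induct) (auto intro: represented_zero represented_add)

lemma represented_monom:
  assumes "j < n" "u \<in> monomials V m"
  shows "represented (p j * monom_of u)"
  using assms
\<comment> \<open>The measure is the room left below the weight bound, then the index: rewriting
  raises the weight, or keeps it and lowers the index.\<close>
proof (induction "(C * (D + m) - (weight (l j) + weight u), j)" arbitrary: j u
    rule: wf_induct[OF wf_lex_prod[OF wf_less_than wf_less_than]])
  case (1 j u)
  note IH = 1(1)[rule_format, OF _ refl]
  show ?case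
  proof (cases "S j u")
    case True
    define q :: "nat \<Rightarrow> (nat \<times> nat, 'a) mpoly" where "q i = (if i = j then monom_of u else 0)" for i
    have "(\<Sum>i<n. q i * p i) = (\<Sum>i<n. if i = j then p j * monom_of u else 0)"
      by (intro sum.cong) (auto simp: q_def mult.commute)
    then have "p j * monom_of u = (\<Sum>i<n. q i * p i)" using 1(2) by simp
    moreover have "\<forall>i<n. \<forall>e\<in>Poly_Mapping.keys (q i). S i e \<and> Poly_Mapping.keys e \<subseteq> V"
      using True 1(3) by (auto simp: q_def monomials_def)
    ultimately show ?thesis unfolding represented_def by blast
  next
    case False
    from reduce[OF 1(2,3) False] obtain q g e0 u' where
      rel: "(\<Sum>i<n. q i * p i) = 0" and q: "\<And>i. i < n \<Longrightarrow> q i \<in> graded_part V g"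
      and e0: "e0 \<in> Poly_Mapping.keys (q j)" and u: "u = e0 + u'"
      and lt: "\<And>i e. i < n \<Longrightarrow> e \<in> Poly_Mapping.keys (q i) \<Longrightarrow> (i, e) \<noteq> (j, e0) \<Longrightarrow>
          weight (l j) + weight e0 < weight (l i) + weight e \<or>
          (weight (l j) + weight e0 = weight (l i) + weight e \<and> i < j)"
      unfolding syzygy_reduction_def by blast
    define Z where "Z = Sigma {..<n} (\<lambda>i. Poly_Mapping.keys (q i))"
    define f where "f = (\<lambda>(i, e). mpoly_const (coef (q i) e) * (p i * monom_of (e + u')))"
    have fin: "finite Z" by (simp add: Z_def)
    have inZ: "(j, e0) \<in> Z" using e0 1(2) by (simp add: Z_def)
    \<comment> \<open>The syzygy times the monomial \<open>u'\<close> is a vanishing combination of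
      products of generators and monomials. It is solved for its term \<open>(j, e0)\<close>, a
      nonzero multiple of the product to be represented.\<close>
    have "0 = (\<Sum>i<n. q i * p i) * monom_of u'" using rel by simp
    also have "\<dots> = (\<Sum>i<n. \<Sum>e\<in>Poly_Mapping.keys (q i). f (i, e))"
      unfolding sum_distrib_right mult.assoc mult_sum_single[of "q _" "p _ * monom_of u'"]
      by (intro sum.cong refl) (simp add: f_def mult.assoc mult_single add.commute)
    also have "\<dots> = sum f Z" unfolding Z_def by (simp add: sum.Sigma)
    also have "\<dots> = f (j, e0) + sum f (Z - {(j, e0)})"
      by (rule sum.remove[OF fin inZ])
    finally have *: "f (j, e0) = - sum f (Z - {(j, e0)})" by (simp add: eq_neg_iff_add_eq_0)
    have rep: "represented (f z)" if "z \<in> Z - {(j, e0)}" for z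
    proof -
      obtain i e where z: "z = (i, e)" "i < n" "e \<in> Poly_Mapping.keys (q i)" "(i, e) \<noteq> (j, e0)"
        using \<open>z \<in> _\<close> by (auto simp: Z_def)
      have eg: "e \<in> monomials V g" "e0 \<in> monomials V g"
        using q[of i] q[of j] z 1(2) e0 by (auto simp: graded_part_iff)
      have u': "u' \<in> monomials V (m - g)"
        using 1(3) eg(2) unfolding u by (rule monomials_add_cancel)
      have "m = g + (m - g)"
        using 1(3) eg(2) unfolding u by (auto simp: monomials_def)
      then have in_m: "e + u' \<in> monomials V m" using monomials_add[OF eg(1) u'] by simp
      have "weight (l i + (e + u')) \<le> C * (D + m)"
        by (rule weight_bound[OF monomials_add[OF l_in[OF z(2)] in_m]])
      then have "((C * (D + m) - (weight (l i) + weight (e + u')), i),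
           (C * (D + m) - (weight (l j) + weight u), j)) \<in> less_than <*lex*> less_than"
        using lt[OF z(2-4)] by (auto simp: u)
      from IH[OF this z(2) in_m] show ?thesis
        by (simp add: f_def z(1) represented_const_mult)
    qed
    have "p j * monom_of u = mpoly_const (inverse (coef (q j) e0)) * f (j, e0)"
      using e0 by (simp add: f_def u mpoly_const_def mult.assoc[symmetric] mult_single in_keys_iff)
    also have "\<dots> = mpoly_const (- inverse (coef (q j) e0)) * sum f (Z - {(j, e0)})"
      unfolding * by (simp add: mpoly_const_def single_uminus)
    finally show ?thesis
      using represented_const_mult[OF represented_sum[of _ f, OF rep]] by (simp only:)
  qed
qed

lemma represented_combination:
  assumes "\<And>i. i < n \<Longrightarrow> f i \<in> carrier (poly_ring V)"
  shows "represented (\<Sum>i<n. f i * p i)"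
proof (rule represented_sum)
  fix i assume "i \<in> {..<n}"
  then have "i < n" by simp
  show "represented (f i * p i)"
    unfolding mult_sum_single[of "f i" "p i"]
    using assms[OF \<open>i < n\<close>] \<open>i < n\<close>
    by (intro represented_sum represented_const_mult represented_monom[of _ _ "total_degree _"])
      (auto simp: carrier_poly_ring_iff monomials_def)
qed

text \<open>Permitted products have pairwise different lowest terms, so a product of least weight in
  the representation contributes a lowest term that nothing cancels.\<close>

lemma represented_key:
  assumes "represented f" "f \<noteq> 0"
  obtains j u where "j < n" "S j u" "l j + u \<in> Poly_Mapping.keys f"
proof -
  from assms(1) obtain q where f: "f = (\<Sum>i<n. q i * p i)"
    and q: "\<And>i e. i < n \<Longrightarrow> e \<in> Poly_Mapping.keys (q i) \<Longrightarrow> S i e"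
    unfolding represented_def by blast
  define Z where "Z = Sigma {..<n} (\<lambda>i. Poly_Mapping.keys (q i))"
  have "finite Z" by (simp add: Z_def)
  have "Z \<noteq> {}"
  proof
    assume "Z = {}"
    then have "Poly_Mapping.keys (q i) = {}" if "i < n" for i
      using that unfolding Z_def by blast
    then have "q i = 0" if "i < n" for i
      using that by (intro poly_mapping_eqI) (metis empty_iff in_keys_iff lookup_zero)
    with f assms(2) show False by simp
  qed
  define w where "w = (\<lambda>(i, e). weight (l i + e))"
  obtain j u where ju: "(j, u) \<in> Z" "\<And>z. z \<in> Z \<Longrightarrow> w (j, u) \<le> w z"
    using arg_min_least[OF \<open>finite Z\<close> \<open>Z \<noteq> {}\<close>, of _ w] arg_min_if_finite(1)[OF \<open>finite Z\<close> \<open>Z \<noteq> {}\<close>, of w]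
    by (metis surj_pair)
  have "coef f (l j + u) = (\<Sum>(i, e)\<in>Z. coef (q i) e * coef (p i * monom_of e) (l j + u))"
    unfolding f Z_def mult_sum_single[of "q _" "p _"]
    by (auto simp: lookup_sum coef_const_mult sum.Sigma intro!: sum.cong)
  also have "\<dots> = (\<Sum>z\<in>Z. if z = (j, u) then coef (q j) u else 0)"
  proof (intro sum.cong refl, clarify)
    fix i e assume ie: "(i, e) \<in> Z"
    show "coef (q i) e * coef (p i * monom_of e) (l j + u) = (if (i, e) = (j, u) then coef (q j) u else 0)"
    proof (cases "(i, e) = (j, u)")
      case True
      then show ?thesis using lowest_p[of j] ju(1) by (simp add: coef_mult_monom lowest_def Z_def)
    next
      case False
      have "coef (p i * monom_of e) (l j + u) = 0"
      proof (rule ccontr)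
        assume "coef (p i * monom_of e) (l j + u) \<noteq> 0"
        then have "l j + u \<in> Poly_Mapping.keys (p i * monom_of e)" by (simp add: in_keys_iff)
        then obtain e' where e': "e' \<in> Poly_Mapping.keys (p i)" "l j + u = e' + e"
          by (auto simp: keys_mult_monom)
        have "weight (l j + u) \<le> weight (l i + e)" using ju(2)[OF ie] by (simp add: w_def)
        then have "weight e' \<le> weight (l i)" unfolding e'(2) by simp
        then have "e' = l i" using e'(1) lowest_p[of i] ie
          unfolding lowest_def Z_def by (metis SigmaD1 lessThan_iff not_le)
        with e'(2) have eq: "l i + e = l j + u" by simp
        have "i = j"
          using disjoint[OF _ _ _ _ eq] q ie ju(1) by (auto simp: Z_def)
        with eq False show False by simp
      qed
      with False show ?thesis by auto
    qed
  qed
  also have "\<dots> = coef (q j) u" using ju(1) \<open>finite Z\<close> by simp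
  finally have "l j + u \<in> Poly_Mapping.keys f" using ju(1) by (simp add: Z_def in_keys_iff)
  with that q ju(1) show ?thesis by (auto simp: Z_def)
qed

definition standard :: "nat \<Rightarrow> (nat \<times> nat \<Rightarrow>\<^sub>0 nat) set" where
  "standard m = {e \<in> monomials V m. \<forall>j<n. \<forall>u. e \<noteq> l j + u}"

definition combinations :: "(nat \<times> nat, 'a) mpoly set" where
  "combinations = {\<Sum>i<n. f i * p i | f. \<forall>i<n. f i \<in> carrier (poly_ring V)}"

text \<open>By \<open>represented_key\<close>, a nonzero element of the ideal has a term divisible
  by some \<open>l j\<close>.\<close>

lemma standard_independent:
  assumes "f \<in> combinations" "Poly_Mapping.keys f \<subseteq> (\<Union>m. standard m)"
  shows "f = 0"
proof (rule ccontr)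
  assume "f \<noteq> 0"
  moreover have "represented f"
    using assms(1) represented_combination by (auto simp: combinations_def)
  ultimately show False
    using assms(2) represented_key[of f] unfolding standard_def by blast
qed

lemma combinations_add:
  assumes "f \<in> combinations" "g \<in> combinations" shows "f + g \<in> combinations"
proof -
  from assms obtain q r where qr: "f = (\<Sum>i<n. q i * p i)" "g = (\<Sum>i<n. r i * p i)"
    "\<forall>i<n. q i \<in> carrier (poly_ring V)" "\<forall>i<n. r i \<in> carrier (poly_ring V)"
    unfolding combinations_def by blast
  have "f + g = (\<Sum>i<n. (q i + r i) * p i)" by (simp add: qr sum.distrib algebra_simps)
  moreover have "q i + r i \<in> carrier (poly_ring V)" if "i < n" for i
    using qr that Poly_Mapping.keys_add[of "q i" "r i"] by (fastforce simp: carrier_poly_ring_iff)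
  ultimately show ?thesis
    unfolding combinations_def by (auto intro!: exI[of _ "\<lambda>i. q i + r i"])
qed

lemma combinations_mult:
  assumes "f \<in> combinations" "r \<in> carrier (poly_ring V)" shows "r * f \<in> combinations"
proof -
  interpret R: cring "poly_ring V :: (nat \<times> nat, 'a) mpoly ring" by (rule poly_ring_cring)
  from assms obtain q where q: "f = (\<Sum>i<n. q i * p i)" "\<forall>i<n. q i \<in> carrier (poly_ring V)"
    unfolding combinations_def by blast
  have "r * f = (\<Sum>i<n. (r * q i) * p i)" by (simp add: q sum_distrib_left mult.assoc)
  moreover have "r * q i \<in> carrier (poly_ring V)" if "i < n" for i
    using R.m_closed[of r "q i"] assms(2) q that by (simp add: poly_ring_def)
  ultimately show ?thesis
    unfolding combinations_def by (auto intro!: exI[of _ "\<lambda>i. r * q i"])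
qed

lemma combinations_generator: "j < n \<Longrightarrow> p j \<in> combinations"
proof -
  assume "j < n"
  have "(\<Sum>i<n. (if i = j then 1 else 0) * p i) = (\<Sum>i<n. if i = j then p i else 0)"
    by (intro sum.cong) auto
  with \<open>j < n\<close> have "p j = (\<Sum>i<n. (if i = j then 1 else 0) * p i)" by simp
  then show ?thesis unfolding combinations_def carrier_poly_ring_iff
    by (auto intro!: exI[of _ "\<lambda>i. if i = j then 1 else 0"] split: if_splits)
qed

lemma const_carrier: "mpoly_const c \<in> carrier (poly_ring V)"
  by (auto simp: mpoly_const_def carrier_poly_ring_iff)

lemma monom_carrier: "e \<in> monomials V m \<Longrightarrow> monom_of e \<in> carrier (poly_ring V)"
  by (auto simp: monomials_def carrier_poly_ring_iff)

lemma combinations_zero: "0 \<in> combinations"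
  unfolding combinations_def by (auto intro!: exI[of _ "\<lambda>_. 0"] simp: carrier_poly_ring_iff)

definition reducible :: "nat \<Rightarrow> (nat \<times> nat, 'a) mpoly \<Rightarrow> bool" where
  "reducible m f \<longleftrightarrow> (\<exists>r. Poly_Mapping.keys r \<subseteq> standard m \<and> f - r \<in> combinations)"

lemma reducible_add:
  assumes "reducible m f" "reducible m g" shows "reducible m (f + g)"
proof -
  from assms obtain r s where "Poly_Mapping.keys r \<subseteq> standard m" "f - r \<in> combinations"
    "Poly_Mapping.keys s \<subseteq> standard m" "g - s \<in> combinations" unfolding reducible_def by blast
  moreover have "(f + g) - (r + s) = (f - r) + (g - s)" by simp
  ultimately show ?thesis
    unfolding reducible_def using Poly_Mapping.keys_add[of r s] combinations_add
    by (metis (no_types, lifting) Un_least order_trans)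
qed

lemma reducible_const_mult:
  assumes "reducible m f" shows "reducible m (mpoly_const c * f)"
proof -
  from assms obtain r where "Poly_Mapping.keys r \<subseteq> standard m" "f - r \<in> combinations"
    unfolding reducible_def by blast
  then have "Poly_Mapping.keys (mpoly_const c * r) \<subseteq> standard m"
    "mpoly_const c * f - mpoly_const c * r \<in> combinations"
    using keys_const_mult[of c r] combinations_mult[OF _ const_carrier, of "f - r" c]
    by (auto simp: right_diff_distrib)
  then show ?thesis unfolding reducible_def by blast
qed

lemma reducible_zero: "reducible m 0"
  unfolding reducible_def by (rule exI[of _ 0]) (simp add: combinations_zero)

lemma reducible_sum: "(\<And>a. a \<in> A \<Longrightarrow> reducible m (f a)) \<Longrightarrow> reducible m (sum f A)"
  by (induction A rule: infinite_finite_induct) (auto intro: reducible_zero reducible_add)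

lemma reducible_combination: "f \<in> combinations \<Longrightarrow> reducible m f"
  unfolding reducible_def by (rule exI[of _ 0]) simp

text \<open>Division with remainder: \<open>l j + u\<close> is traded for the other terms of
  \<open>p j\<close> times \<open>u\<close>, which weigh more, and weights are bounded in degree
  \<open>m\<close>.\<close>

lemma reducible_monom:
  assumes "e \<in> monomials V m" shows "reducible m (monom_of e)"
  using assms
proof (induction "C * m - weight e" arbitrary: e rule: less_induct)
  case (less e)
  show ?case
  proof (cases "e \<in> standard m")
    case True
    then show ?thesis
      unfolding reducible_def by (intro exI[of _ "monom_of e"]) (simp add: combinations_zero)
  next
    case False
    then obtain j u where j: "j < n" and e: "e = l j + u" using less.prems by (auto simp: standard_def)
    let ?f = "p j * monom_of u"
    have u: "u \<in> monomials V (m - D)" and m: "m = D + (m - D)"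
      using less.prems l_in[OF j] unfolding e
      by (auto intro: monomials_add_cancel) (auto simp: monomials_def)
    have keys: "Poly_Mapping.keys ?f \<subseteq> monomials V m"
      using graded_p[OF j] monomials_add[OF _ u, of _ D] m
      by (auto simp: keys_mult_monom graded_part_iff subset_iff)
    have coef1: "coef ?f e = 1" using lowest_p[OF j] unfolding e by (simp add: coef_mult_monom lowest_def)
    then have "e \<in> Poly_Mapping.keys ?f" by (simp add: in_keys_iff)
    have "?f = (\<Sum>e'\<in>Poly_Mapping.keys ?f. mpoly_const (coef ?f e') * monom_of e')"
      using poly_mapping_sum_single[of ?f] by (simp add: mpoly_const_def mult_single)
    also have "\<dots> = monom_of e +
        (\<Sum>e'\<in>Poly_Mapping.keys ?f - {e}. mpoly_const (coef ?f e') * monom_of e')"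
      by (subst sum.remove[OF _ \<open>e \<in> Poly_Mapping.keys ?f\<close>]) (auto simp: coef1 mpoly_const_def)
    finally have eq: "monom_of e = ?f + mpoly_const (-1) *
        (\<Sum>e'\<in>Poly_Mapping.keys ?f - {e}. mpoly_const (coef ?f e') * monom_of e')"
      by (simp add: mpoly_const_def single_uminus algebra_simps)
    have "reducible m (monom_of e' :: (nat \<times> nat, 'a) mpoly)" if "e' \<in> Poly_Mapping.keys ?f - {e}" for e'
    proof (rule less.hyps)
      show in_m: "e' \<in> monomials V m" using that keys by blast
      have "weight e < weight e'"
        using that lowest_p[OF j] unfolding e by (auto simp: keys_mult_monom lowest_def)
      with weight_bound[OF in_m] show "C * m - weight e' < C * m - weight e" by linarith
    qed
    moreover have "?f \<in> combinations"
      using combinations_mult[OF combinations_generator[OF j] monom_carrier[OF u]]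
      by (simp add: mult.commute)
    ultimately show ?thesis
      by (subst eq, intro reducible_add[OF reducible_combination] reducible_const_mult reducible_sum)
  qed
qed

lemma standard_spanning:
  assumes "f \<in> graded_part V m" shows "reducible m f"
proof -
  have "f = (\<Sum>e\<in>Poly_Mapping.keys f. mpoly_const (coef f e) * monom_of e)"
    using poly_mapping_sum_single[of f] by (simp add: mpoly_const_def mult_single)
  also have "reducible m \<dots>"
    using assms by (intro reducible_sum reducible_const_mult reducible_monom) (auto simp: graded_part_iff)
  finally show ?thesis .
qed

end

section \<open>Terms of least weight in pfaffians\<close>

lemma graded_part_zero [simp]: "0 \<in> graded_part V m"
  by (simp add: graded_part_iff)

lemma graded_part_add: "p \<in> graded_part V m \<Longrightarrow> q \<in> graded_part V m \<Longrightarrow> p + q \<in> graded_part V m"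
  using Poly_Mapping.keys_add[of p q] by (auto simp: graded_part_iff)

lemma graded_part_sum:
  "(\<And>a. a \<in> A \<Longrightarrow> f a \<in> graded_part V m) \<Longrightarrow> sum f A \<in> graded_part V m"
  by (induction A rule: infinite_finite_induct) (auto intro: graded_part_add)

lemma keys_sign_mult [simp]:
  "Poly_Mapping.keys ((-1) ^ i * p) = Poly_Mapping.keys (p :: ('v, 'a::field) mpoly)"
  by (cases "even i") (auto simp: in_keys_iff)

lemma graded_part_sign [simp]: "(-1) ^ i * p \<in> graded_part V m \<longleftrightarrow> p \<in> graded_part V m"
  by (simp add: graded_part_iff)

lemma graded_part_mult:
  assumes "p \<in> graded_part V m" "q \<in> graded_part V k"
  shows "p * q \<in> graded_part V (m + k)"
  using assms by (auto simp: graded_part_iff subset_iff elim!: mpoly_keys_mult intro!: monomials_add)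

interpretation skew: alternating "skew_matrix :: nat \<Rightarrow> nat \<Rightarrow> (nat \<times> nat, 'a::field) mpoly"
  by unfold_locales (auto simp: skew_matrix_def)

lemma keys_skew_matrix:
  "Poly_Mapping.keys (skew_matrix i j :: (nat \<times> nat, 'a::field) mpoly) =
     (if i = j then {} else {Poly_Mapping.single (min i j, max i j) 1})"
  by (auto simp: skew_matrix_def mpoly_var_def)

lemma skew_matrix_graded:
  "i < n \<Longrightarrow> j < n \<Longrightarrow> skew_matrix i j \<in> graded_part (skew_vars n) 1"
  by (auto simp: graded_part_iff keys_skew_matrix monomials_def skew_vars_def)

lemma set_del: "set (del i L) \<subseteq> set L"
  unfolding del_def using set_take_subset set_drop_subset by fastforce

lemma sorted_del: "sorted_wrt (<) L \<Longrightarrow> sorted_wrt (<) (del i L)" for L :: "nat list"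
proof (induction L arbitrary: i)
  case (Cons x L)
  then show ?case
    using set_del[of _ L] by (cases i) (auto simp: subset_iff)
qed (simp add: del_def)

text \<open>Exponent of the nested matching: first with last, second with second to last, and so on
  inwards.\<close>

function nest :: "nat list \<Rightarrow> (nat \<times> nat \<Rightarrow>\<^sub>0 nat)" where
  "nest [] = 0"
| "nest [a] = 0"
| "nest (a # b # L) = Poly_Mapping.single (a, last (b # L)) 1 + nest (butlast (b # L))"
  by pat_completeness auto
termination by (relation "measure length") auto

lemma nest_wrap [simp]: "nest (a # M @ [z]) = Poly_Mapping.single (a, z) 1 + nest M"
  by (cases M) (auto simp: butlast_append)

lemma del_last: "del (length M) (M @ [z]) = M"
  by (simp add: del_def)

lemma del_append: "i < length M \<Longrightarrow> del i (M @ Q) = del i M @ Q"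
  by (simp add: del_def)

lemma rearrange_less: "a < c \<Longrightarrow> x < y \<Longrightarrow> a * y + c * x < a * x + c * (y::nat)"
  by (auto simp: less_iff_Suc_add algebra_simps)

text \<open>If \<open>a\<close> is paired with an inner \<open>M ! i\<close>, then in the nested
  rest \<open>z\<close> is paired with the first remaining entry \<open>c\<close>. Uncrossing the
  two pairs into \<open>(a, z)\<close> and \<open>c\<close> with \<open>M ! i\<close> lowers the
  weight by \<open>rearrange_less\<close>; what remains inside is compared with the nested matching
  of \<open>M\<close> by induction.\<close>

lemma nest_weight_less:
  assumes "sorted_wrt (<) (a # M @ [z])" "even (length M)" "i < length M"
  shows "weight (nest (a # M @ [z])) < a * (M ! i) + weight (nest (del i (M @ [z])))"
  using assms
proof (induction "length M" arbitrary: a M z i rule: less_induct)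
  case less
  then obtain x M1 where M: "M = x # M1" by (cases M) auto
  with less.prems have "M1 \<noteq> []" by auto
  then obtain M' y where M1: "M1 = M' @ [y]" by (metis rev_exhaust)
  have even: "even (length M')" using less.prems by (simp add: M M1)
  have ord: "a < x" "x < y" "y < z" using less.prems by (auto simp: M M1 sorted_wrt_append)
  \<comment> \<open>At the last place of \<open>M1\<close> both sides are the nested matching
    itself, hence only a weak inequality.\<close>
  have IH: "x * y + weight (nest M') \<le> x * (M1 ! k) + weight (nest (del k M1))" if "k < length M1" for k
  proof (cases "k < length M'")
    case True
    have "weight (nest (x # M' @ [y])) < x * (M' ! k) + weight (nest (del k (M' @ [y])))"
      by (rule less.hyps) (use less.prems True even in \<open>auto simp: M M1 sorted_wrt_append\<close>)
    then show ?thesis using True by (simp add: M1 nth_append)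
  next
    case False
    then have "k = length M'" using that by (simp add: M1)
    then show ?thesis by (simp add: M1 del_last)
  qed
  have lhs: "weight (nest (a # M @ [z])) = a * z + x * y + weight (nest M')"
    using nest_wrap[of a M z] nest_wrap[of x M' y] by (simp add: M M1 del: nest_wrap)
  show ?case
  proof (cases i)
    case 0
    obtain x2 M2 where M1': "M1 = x2 # M2" using \<open>M1 \<noteq> []\<close> by (cases M1) auto
    have "x < x2" "x2 < z" using less.prems by (auto simp: M M1')
    from rearrange_less[of a x2 x z] ord this
    have "a * z + x2 * x < a * x + x2 * z" by simp
    moreover have "x * y + weight (nest M') \<le> x * x2 + weight (nest M2)"
      using IH[of 0] by (simp add: M1')
    moreover have "weight (nest (del i (M @ [z]))) = x2 * z + weight (nest M2)"
      by (simp add: 0 M M1')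
    ultimately show ?thesis unfolding lhs by (simp add: 0 M algebra_simps)
  next
    case (Suc k)
    then have k: "k < length M1" using less.prems by (simp add: M)
    then have "M1 ! k < z" "M1 ! k \<in> set M1"
      using less.prems by (auto simp: M sorted_wrt_append)
    from rearrange_less[OF \<open>a < x\<close> this(1)]
    have "a * z + x * (M1 ! k) < a * (M1 ! k) + x * z" .
    moreover have "weight (nest (del i (M @ [z]))) = x * z + weight (nest (del k M1))"
      using k by (simp add: Suc M del_append)
    ultimately show ?thesis using IH[OF k] unfolding lhs by (simp add: Suc M)
  qed
qed

lemma lowest_add:
  assumes "lowest e p" "\<And>e'. e' \<in> Poly_Mapping.keys q \<Longrightarrow> weight e < weight e'"
  shows "lowest e (p + q)"
proof -
  have "coef q e = 0" using assms(2)[of e] by (auto simp: in_keys_iff)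
  then show ?thesis
    using assms Poly_Mapping.keys_add[of p q] unfolding lowest_def by (auto simp: lookup_add)
qed

lemma lowest_mult_var:
  assumes "lowest e p" shows "lowest (Poly_Mapping.single v 1 + e) (mpoly_var v * p)"
  using assms coef_mult_monom[of p "Poly_Mapping.single v 1" e]
  by (auto simp: lowest_def mpoly_var_def keys_mult_monom mult.commute[of _ p] add.commute[of _ e])

lemma keys_skew_mult:
  assumes "e \<in> Poly_Mapping.keys (skew_matrix i j * p)"
  obtains e' where "e' \<in> Poly_Mapping.keys p" "weight e = i * j + weight e'"
proof -
  from assms obtain a b where "a \<in> Poly_Mapping.keys (skew_matrix i j :: (nat \<times> nat, 'a) mpoly)"
    "b \<in> Poly_Mapping.keys p" "e = a + b" by (elim mpoly_keys_mult)
  with that show ?thesis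
    by (auto simp: keys_skew_matrix min_def max_def split: if_splits)
qed

text \<open>In the expansion along the least index \<open>a\<close>, each summand weighs at least as
  much as its nested term, and \<open>nest_weight_less\<close> makes every partner of
  \<open>a\<close> but the last one strictly heavier.\<close>

lemma lowest_pf:
  assumes "sorted_wrt (<) L" "even (length L)"
  shows "lowest (nest L) (pf skew_matrix L :: (nat \<times> nat, 'a::field) mpoly)"
  using assms
proof (induction "length L" arbitrary: L rule: less_induct)
  case less
  show ?case
  proof (cases L)
    case Nil
    then show ?thesis by (simp add: lowest_def)
  next
    case (Cons a L')
    with less.prems have "L' \<noteq> []" by auto
    then obtain M z where L': "L' = M @ [z]" by (metis rev_exhaust)
    have evM: "even (length M)" using less.prems by (simp add: Cons L')
    have "a < z" using less.prems by (simp add: Cons L')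
    let ?X = "skew_matrix :: nat \<Rightarrow> nat \<Rightarrow> (nat \<times> nat, 'a) mpoly"
    let ?q = "\<Sum>i<length M. (-1) ^ i * ?X a (L' ! i) * pf ?X (del i L')"
    have "lowest (Poly_Mapping.single (a, z) 1 + nest M) (mpoly_var (a, z) * pf ?X M)"
      by (intro lowest_mult_var less.hyps) (use less.prems evM in \<open>auto simp: Cons L' sorted_wrt_append\<close>)
    moreover have "weight (nest L) < weight e" if e: "e \<in> Poly_Mapping.keys ?q" for e
    proof -
      from e keys_sum_subset[of "\<lambda>i. (-1) ^ i * ?X a (L' ! i) * pf ?X (del i L')" "{..<length M}"]
      obtain i where i: "i < length M" "e \<in> Poly_Mapping.keys (?X a (L' ! i) * pf ?X (del i L'))"
        by (auto simp: mult.assoc)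
      from i(2) obtain e' where e': "e' \<in> Poly_Mapping.keys (pf ?X (del i L'))"
        "weight e = a * (L' ! i) + weight e'" by (elim keys_skew_mult)
      have "lowest (nest (del i L')) (pf ?X (del i L'))"
        by (rule less.hyps)
          (use less.prems i evM sorted_del[of L' i] in \<open>auto simp: Cons L'\<close>)
      from lowest_le[OF this e'(1)] have "weight (nest (del i L')) \<le> weight e'" .
      moreover have "weight (nest L) < a * (L' ! i) + weight (nest (del i L'))"
        using nest_weight_less[of a M z i] less.prems i evM by (simp add: Cons L' nth_append)
      ultimately show ?thesis using e'(2) by simp
    qed
    \<comment> \<open>The last summand has a positive sign because \<open>length M\<close> is even;
      this gives the coefficient 1 demanded by \<open>lowest\<close>.\<close>
    moreover have "pf ?X L = mpoly_var (a, z) * pf ?X M + ?q"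
      using evM \<open>a < z\<close> by (simp add: Cons L' contract_expand del_last skew_matrix_def)
    ultimately show ?thesis
      using lowest_add[of "nest L" "mpoly_var (a, z) * pf ?X M" ?q] by (simp add: Cons L')
  qed
qed

lemma pf_graded:
  assumes "set L \<subseteq> {..<n}" "length L = 2 * k"
  shows "(pf skew_matrix L :: (nat \<times> nat, 'a::field) mpoly) \<in> graded_part (skew_vars n) k"
  using assms
proof (induction k arbitrary: L)
  case 0
  then show ?case by (simp add: graded_part_iff monomials_def)
next
  case (Suc k)
  then obtain a L' where L: "L = a # L'" "length L' = 2 * k + 1" by (cases L) auto
  let ?X = "skew_matrix :: nat \<Rightarrow> nat \<Rightarrow> (nat \<times> nat, 'a) mpoly"
  have "?X a (L' ! i) * pf ?X (del i L') \<in> graded_part (skew_vars n) (1 + k)"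
    if "i < 2 * k + 1" for i
  proof (intro graded_part_mult skew_matrix_graded Suc.IH)
    show "L' ! i < n" using Suc.prems that nth_mem[of i L'] by (auto simp: L subset_iff)
  qed (use Suc.prems that set_del[of i L'] in \<open>auto simp: L\<close>)
  then show ?case
    unfolding L pf.simps contract_expand mult.assoc by (intro graded_part_sum) (auto simp: L)
qed

section \<open>The generators and the weights of their lowest terms\<close>

definition gen :: "nat \<Rightarrow> nat \<Rightarrow> (nat \<times> nat, 'a::field) mpoly" where
  "gen t j = pf skew_matrix (del j [0..<2 * t + 1])"

abbreviation var_exp :: "nat \<Rightarrow> nat \<Rightarrow> (nat \<times> nat \<Rightarrow>\<^sub>0 nat)" where
  "var_exp i j \<equiv> Poly_Mapping.single (i, j) 1"

text \<open>
  The exponent of the nested matching of \<open>{0..2t} - {j}\<close>: the outer pairs \<open>(i, 2t - i)\<close> avoid \<open>j\<close>,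
  and from the omitted index on the pairs are shifted by one.
\<close>

definition lead :: "nat \<Rightarrow> nat \<Rightarrow> (nat \<times> nat \<Rightarrow>\<^sub>0 nat)" where
  "lead t j = (if j \<le> t
     then (\<Sum>i<j. var_exp i (2 * t - i)) + (\<Sum>i\<in>{j + 1..t}. var_exp i (2 * t + 1 - i))
     else (\<Sum>i<2 * t - j. var_exp i (2 * t - i)) + (\<Sum>i\<in>{2 * t - j..<t}. var_exp i (2 * t - 1 - i)))"

lemma lead_ge:
  assumes "t \<le> j" "j \<le> 2 * t"
  shows "lead t j = (\<Sum>i<2 * t - j. var_exp i (2 * t - i)) + (\<Sum>i\<in>{2 * t - j..<t}. var_exp i (2 * t - 1 - i))"
  using assms by (cases "j = t") (auto simp: lead_def)

lemma nest_outer: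
  assumes "k \<le> q"
  shows "nest ([p..<p + k] @ M @ [q - k..<q]) = (\<Sum>i<k. var_exp (p + i) (q - 1 - i)) + nest M"
  using assms
proof (induction k arbitrary: M)
  case (Suc k)
  have "[q - Suc k..<q] = (q - Suc k) # [q - k..<q]"
    using Suc.prems by (metis Suc_diff_Suc Suc_le_lessD diff_less upt_conv_Cons zero_less_Suc less_le_trans)
  then have "[p..<p + Suc k] @ M @ [q - Suc k..<q]
      = [p..<p + k] @ ((p + k) # M @ [q - Suc k]) @ [q - k..<q]" by simp
  then have "nest ([p..<p + Suc k] @ M @ [q - Suc k..<q])
      = (\<Sum>i<k. var_exp (p + i) (q - 1 - i)) + nest ((p + k) # M @ [q - Suc k])"
    using Suc.IH[of "(p + k) # M @ [q - Suc k]"] Suc.prems by (simp only: Suc_leD)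
  then show ?case by (simp add: add.assoc)
qed simp

lemma nest_interval: "nest [p..<p + 2 * k] = (\<Sum>i<k. var_exp (p + i) (p + 2 * k - 1 - i))"
proof -
  have "[p..<p + 2 * k] = [p..<p + k] @ [] @ [(p + 2 * k) - k..<p + 2 * k]"
    using upt_add_eq_append[of p "p + k" k] by (simp add: mult_2 add.assoc)
  then show ?thesis using nest_outer[of k "p + 2 * k" p "[]"] by simp
qed

lemma nest_interval':
  assumes "p + q = 2 * r"
  shows "nest [p..<q] = (\<Sum>i\<in>{p..<r}. var_exp i (2 * r - 1 - i))"
proof (cases "p \<le> r")
  case True
  then have "q = p + 2 * (r - p)" using assms by simp
  then have "nest [p..<q] = (\<Sum>i<r - p. var_exp (p + i) (p + 2 * (r - p) - 1 - i))"
    by (simp only: nest_interval)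
  also have "\<dots> = (\<Sum>i\<in>{p..<r}. var_exp i (2 * r - 1 - i))"
    by (rule sum.reindex_bij_witness[of _ "\<lambda>i. i - p" "\<lambda>i. i + p"])
      (use True in \<open>auto simp: diff_mult_distrib2 intro!: arg_cong2[of _ _ _ _ Pair] arg_cong2[of _ _ _ _ Poly_Mapping.single]\<close>)
  finally show ?thesis .
next
  case False
  with assms show ?thesis by simp
qed

lemma nest_del:
  assumes "j \<le> 2 * t" shows "nest (del j [0..<2 * t + 1]) = lead t j"
proof -
  have del: "del j [0..<2 * t + 1] = [0..<j] @ [Suc j..<2 * t + 1]"
    using assms by (simp add: del_def take_upt drop_upt)
  show ?thesis
  proof (cases "j \<le> t")
    case True
    have "[Suc j..<2 * t + 1] = [Suc j..<2 * t + 1 - j] @ [2 * t + 1 - j..<2 * t + 1]"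
      using upt_add_eq_append[of "Suc j" "2 * t + 1 - j" j] True by simp
    then have "nest (del j [0..<2 * t + 1]) =
        (\<Sum>i<j. var_exp i (2 * t - i)) + nest [Suc j..<2 * t + 1 - j]"
      unfolding del using nest_outer[of j "2 * t + 1" 0 "[Suc j..<2 * t + 1 - j]"] True by simp
    moreover have "nest [Suc j..<2 * t + 1 - j] = (\<Sum>i\<in>{Suc j..<Suc t}. var_exp i (2 * t + 1 - i))"
      using nest_interval'[of "Suc j" "2 * t + 1 - j" "Suc t"] True by simp
    ultimately show ?thesis using True by (simp add: lead_def atLeastLessThanSuc_atLeastAtMost)
  next
    case False
    define k where "k = 2 * t - j"
    have k: "j = 2 * t - k" "k \<le> 2 * t" "k \<le> j" using assms False by (auto simp: k_def)
    have "[0..<j] = [0..<k] @ [k..<j]"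
      using upt_add_eq_append[of 0 k "j - k"] k by simp
    moreover have "2 * t + 1 - k = Suc j" using k by simp
    ultimately have "nest (del j [0..<2 * t + 1]) =
        (\<Sum>i<k. var_exp i (2 * t - i)) + nest [k..<j]"
      unfolding del using nest_outer[of k "2 * t + 1" 0 "[k..<j]"] k by simp
    moreover have "nest [k..<j] = (\<Sum>i\<in>{k..<t}. var_exp i (2 * t - 1 - i))"
      using nest_interval'[of k j t] k by simp
    ultimately show ?thesis using False by (simp add: lead_def k_def)
  qed
qed

lemma lowest_gen: "j \<le> 2 * t \<Longrightarrow> lowest (lead t j) (gen t j)"
  unfolding gen_def nest_del[symmetric] by (intro lowest_pf sorted_del) (auto simp del: upt_Suc)

lemma gen_graded: "j \<le> 2 * t \<Longrightarrow> gen t j \<in> graded_part (skew_vars (2 * t + 1)) t"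
  unfolding gen_def by (rule pf_graded) (use set_del[of j "[0..<2 * t + 1]"] in auto)

text \<open>Moving the gap from \<open>j\<close> to \<open>j + 1\<close> changes a single pair: for
  \<open>j < t\<close> the pair \<open>(j + 1, 2t - j)\<close> becomes \<open>(j, 2t - j)\<close>;
  otherwise, with \<open>k = 2t - 1 - j\<close>, the pair \<open>(k, j + 1)\<close> becomes
  \<open>(k, j)\<close>.\<close>

lemma weight_lead_Suc:
  assumes "j < 2 * t"
  shows "weight (lead t j) = weight (lead t (Suc j)) + (if j < t then 2 * t - j else 2 * t - 1 - j)"
proof (cases "j < t")
  case True
  have "{j + 1..t} = insert (Suc j) {Suc j + 1..t}" using True by auto
  then show ?thesis using True
    by (simp add: lead_def weight_sum)
next
  case False
  define k where "k = 2 * t - Suc j"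
  have k: "2 * t - j = Suc k" "2 * t - Suc j = k" "k < t" "2 * t - 1 - j = k" using assms False by (auto simp: k_def)
  have "{k..<t} = insert k {Suc k..<t}" using k by auto
  moreover have "Suc k * (2 * t - Suc k) + k = 0 + Suc k * (2 * t - Suc k) + k" by simp
  moreover have "k * (2 * t - k) = k * (2 * t - 1 - k) + k"
    using k(3) by (cases "2 * t - k") (auto simp: Suc_diff_Suc)
  ultimately show ?thesis using False assms k
    by (subst (1 2) lead_ge) (auto simp: weight_sum)
qed

text \<open>The summand \<open>j\<close> of the row relation of \<open>i\<close> has least weight
  \<open>weight (lead t j) + i * j\<close>. From \<open>j\<close> to \<open>j + 1\<close> it changes
  by \<open>i\<close> minus the drop of \<open>weight_lead_Suc\<close>. The drops
  \<open>2t, ..., t + 1, t - 1, ..., 0\<close> decrease strictly, so the weight first falls and then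
  rises, with a tie where the drop equals \<open>i\<close>.\<close>

lemma weight_lead_row:
  assumes "j < 2 * t"
  shows "weight (lead t (Suc j)) + i * Suc j + (if j < t then 2 * t - j else 2 * t - 1 - j)
    = weight (lead t j) + i * j + i"
  using weight_lead_Suc[OF assms] by simp

lemma step_chain:
  fixes f :: "nat \<Rightarrow> 'b"
  assumes "transp R" "\<And>j. a \<le> j \<Longrightarrow> j < b \<Longrightarrow> R (f j) (f (Suc j))" "a < b"
  shows "R (f a) (f b)"
  using assms(3,2)
proof (induction b rule: less_induct)
  case (less b)
  then obtain c where b: "b = Suc c" by (cases b) auto
  show ?case
  proof (cases "a = c")
    case True
    then show ?thesis using less.prems b by auto
  next
    case False
    then have "R (f a) (f c)" using less b by auto
    moreover have "R (f c) (f b)" using less.prems b by auto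
    ultimately show ?thesis using assms(1) by (blast dest: transpD)
  qed
qed

text \<open>
  In a syzygy \<open>\<Sum>\<^sub>j \<plusminus> x\<^sub>i\<^sub>j Pf\<^sub>j = 0\<close> exactly two consecutive summands
  have the least weight.
\<close>

lemma weight_lead_row_descent:
  assumes "a < b" "b \<le> 2 * t" "\<And>j. a \<le> j \<Longrightarrow> j < b \<Longrightarrow> i < (if j < t then 2 * t - j else 2 * t - 1 - j)"
  shows "weight (lead t b) + i * b < weight (lead t a) + i * a"
proof (rule step_chain[where f = "\<lambda>j. weight (lead t j) + i * j" and R = "(>)", OF _ _ assms(1)])
  fix j assume "a \<le> j" "j < b"
  then show "weight (lead t (Suc j)) + i * Suc j < weight (lead t j) + i * j"
    using assms(3)[of j] weight_lead_row[of j t i] assms(2) by linarith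
qed (auto intro: transpI)

lemma weight_lead_row_ascent:
  assumes "a < b" "b \<le> 2 * t" "\<And>j. a \<le> j \<Longrightarrow> j < b \<Longrightarrow> (if j < t then 2 * t - j else 2 * t - 1 - j) < i"
  shows "weight (lead t a) + i * a < weight (lead t b) + i * b"
proof (rule step_chain[where f = "\<lambda>j. weight (lead t j) + i * j" and R = "(<)", OF _ _ assms(1)])
  fix j assume "a \<le> j" "j < b"
  then show "weight (lead t j) + i * j < weight (lead t (Suc j)) + i * Suc j"
    using assms(3)[of j] weight_lead_row[of j t i] assms(2) by linarith
qed (auto intro: transpI)

text \<open>Nested matching of the interval from \<open>k + 1\<close> to \<open>2t - k\<close>; it
  is a common part of all \<open>lead t i\<close> with \<open>i <= k\<close>.\<close>

definition tail_exp :: "nat \<Rightarrow> nat \<Rightarrow> (nat \<times> nat \<Rightarrow>\<^sub>0 nat)" where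
  "tail_exp t k = (\<Sum>i\<in>{Suc k..t}. var_exp i (2 * t + 1 - i))"

definition pdvd :: "('v \<Rightarrow>\<^sub>0 nat) \<Rightarrow> ('v \<Rightarrow>\<^sub>0 nat) \<Rightarrow> bool" where
  "pdvd e u \<longleftrightarrow> (\<exists>u'. u = e + u')"

lemma pdvd_iff: "pdvd e u \<longleftrightarrow> (\<forall>v. Poly_Mapping.lookup e v \<le> Poly_Mapping.lookup u v)"
proof
  assume "\<forall>v. Poly_Mapping.lookup e v \<le> Poly_Mapping.lookup u v"
  then have "u = e + (u - e)"
    by (intro poly_mapping_eqI) (simp add: lookup_add lookup_minus)
  then show "pdvd e u" unfolding pdvd_def by blast
qed (auto simp: pdvd_def lookup_add)

text \<open>
  The monomials \<open>u\<close> for which \<open>lead t j + u\<close> is not a multiple of an earlier \<open>lead t i\<close>, \<open>i < j\<close>.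
\<close>

definition multipliers :: "nat \<Rightarrow> nat \<Rightarrow> (nat \<times> nat \<Rightarrow>\<^sub>0 nat) \<Rightarrow> bool" where
  "multipliers t j u \<longleftrightarrow> (if j = 0 then True
     else if j \<le> t then \<not> pdvd (var_exp j (2 * t + 1 - j)) u
     else \<not> pdvd (var_exp (2 * t - j) j) u \<and> \<not> pdvd (tail_exp t (2 * t - j)) u)"

section \<open>Syzygies that rewrite forbidden multipliers\<close>

lemma row_relation:
  assumes "i \<le> 2 * t"
  shows "(\<Sum>j<2 * t + 1. ((-1) ^ j * skew_matrix i j) * gen t j) = 0"
  using skew.pf_row_relation[of i "[0..<2 * t + 1]"] assms by (simp add: gen_def del: upt_Suc)

lemma exchange_relation:
  assumes "set T \<subseteq> {..2 * t}"
  shows "(\<Sum>j<2 * t + 1. ((-1) ^ j * pf skew_matrix (j # T)) * gen t j) = 0"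
proof -
  have "{..2 * t} = set [0..<2 * t + 1]" by auto
  with skew.pf_exchange_relation[of T "[0..<2 * t + 1]"] assms
  show ?thesis by (simp add: gen_def del: upt_Suc)
qed

lemma reduce_row:
  fixes t j i :: nat and u :: "nat \<times> nat \<Rightarrow>\<^sub>0 nat"
  assumes ij: "i \<le> 2 * t" "j \<le> 2 * t" "i \<noteq> j" "pdvd (var_exp (min i j) (max i j)) u"
    and wt: "\<And>i'. i' \<le> 2 * t \<Longrightarrow> i' \<noteq> j \<Longrightarrow>
      weight (lead t j) + i * j < weight (lead t i') + i * i' \<or>
      weight (lead t j) + i * j = weight (lead t i') + i * i' \<and> i' < j"
  shows "syzygy_reduction (skew_vars (2 * t + 1)) (2 * t + 1)
    (gen t :: nat \<Rightarrow> (nat \<times> nat, 'a::field) mpoly) (lead t) j u"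
proof -
  let ?q = "\<lambda>m. (-1) ^ m * skew_matrix i m :: (nat \<times> nat, 'a) mpoly"
  let ?e0 = "var_exp (min i j) (max i j)"
  have min_max: "min a b * max a b = a * (b::nat)" for a b by (auto simp: min_def max_def)
  obtain u' where u': "u = ?e0 + u'" using ij(4) by (auto simp: pdvd_def)
  show ?thesis
  proof (rule syzygy_reductionI[where q = ?q and g = 1, OF row_relation[OF ij(1)] _ _ u'])
    show "?q m \<in> graded_part (skew_vars (2 * t + 1)) 1" if "m < 2 * t + 1" for m
      unfolding graded_part_sign using that ij(1) by (intro skew_matrix_graded) auto
    show "?e0 \<in> Poly_Mapping.keys (?q j)" using ij(3) by (simp add: keys_skew_matrix)
    fix m e assume me: "m < 2 * t + 1" "e \<in> Poly_Mapping.keys (?q m)" "(m, e) \<noteq> (j, ?e0)"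
    have e: "e = var_exp (min i m) (max i m)" using me(2) by (simp add: keys_skew_matrix split: if_splits)
    with me(3) have "m \<noteq> j" by auto
    with wt[of m] me(1) show "weight (lead t j) + weight ?e0 < weight (lead t m) + weight e \<or>
      (weight (lead t j) + weight ?e0 = weight (lead t m) + weight e \<and> m < j)"
      by (simp add: e min_max)
  qed
qed

text \<open>The row \<open>2t + 1 - j\<close> is chosen because it equals the drop from
  \<open>j - 1\<close> to \<open>j\<close>: these two summands tie at the minimum, and the
  coefficient of \<open>gen t j\<close> is, up to sign, the variable
  \<open>(j, 2t + 1 - j)\<close>.\<close>

lemma reduce_low:
  assumes "1 \<le> j" "j \<le> t" "pdvd (var_exp j (2 * t + 1 - j)) u"
  shows "syzygy_reduction (skew_vars (2 * t + 1)) (2 * t + 1)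
    (gen t :: nat \<Rightarrow> (nat \<times> nat, 'a::field) mpoly) (lead t) j u"
proof (rule reduce_row[of "2 * t + 1 - j"])
  let ?i = "2 * t + 1 - j"
  fix m assume m: "m \<le> 2 * t" "m \<noteq> j"
  have tie: "weight (lead t j) + ?i * j = weight (lead t (j - 1)) + ?i * (j - 1)"
  proof -
    have "j - 1 < 2 * t" and eq: "Suc (j - 1) = j" "(if j - 1 < t then 2 * t - (j - 1) else 2 * t - 1 - (j - 1)) = ?i"
      using assms(1,2) by auto
    from weight_lead_row[OF this(1), of ?i, unfolded eq] show ?thesis by (rule add_right_imp_eq)
  qed
  consider "m < j - 1" | "m = j - 1" | "j < m" using m by linarith
  then show "weight (lead t j) + ?i * j < weight (lead t m) + ?i * m \<or>
      weight (lead t j) + ?i * j = weight (lead t m) + ?i * m \<and> m < j"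
  proof cases
    case 1
    have "weight (lead t (j - 1)) + ?i * (j - 1) < weight (lead t m) + ?i * m"
      by (rule weight_lead_row_descent[OF 1]) (use assms(1,2) in auto)
    then show ?thesis unfolding tie by simp
  next
    case 2
    then show ?thesis unfolding tie using assms(1) by simp
  next
    case 3
    have "weight (lead t j) + ?i * j < weight (lead t m) + ?i * m"
      by (rule weight_lead_row_ascent[OF 3 m(1)]) (use assms(1,2) m(1) in auto)
    then show ?thesis by simp
  qed
qed (use assms in auto)

text \<open>Beyond \<open>t\<close> the drop from \<open>j - 1\<close> to \<open>j\<close> is
  \<open>2t - j\<close>, so this row produces the tie.\<close>

lemma reduce_high:
  assumes "t < j" "j \<le> 2 * t" "pdvd (var_exp (2 * t - j) j) u"
  shows "syzygy_reduction (skew_vars (2 * t + 1)) (2 * t + 1)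
    (gen t :: nat \<Rightarrow> (nat \<times> nat, 'a::field) mpoly) (lead t) j u"
proof (rule reduce_row[of "2 * t - j"])
  let ?i = "2 * t - j"
  fix m assume m: "m \<le> 2 * t" "m \<noteq> j"
  have tie: "weight (lead t j) + ?i * j = weight (lead t (j - 1)) + ?i * (j - 1)"
  proof -
    have "j - 1 < 2 * t" and eq: "Suc (j - 1) = j" "(if j - 1 < t then 2 * t - (j - 1) else 2 * t - 1 - (j - 1)) = ?i"
      using assms(1,2) by auto
    from weight_lead_row[OF this(1), of ?i, unfolded eq] show ?thesis by (rule add_right_imp_eq)
  qed
  consider "m < j - 1" | "m = j - 1" | "j < m" using m by linarith
  then show "weight (lead t j) + ?i * j < weight (lead t m) + ?i * m \<or>
      weight (lead t j) + ?i * j = weight (lead t m) + ?i * m \<and> m < j"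
  proof cases
    case 1
    have "weight (lead t (j - 1)) + ?i * (j - 1) < weight (lead t m) + ?i * m"
      by (rule weight_lead_row_descent[OF 1]) (use assms(1,2) in auto)
    then show ?thesis unfolding tie by simp
  next
    case 2
    then show ?thesis unfolding tie using assms(1) by simp
  next
    case 3
    have "weight (lead t j) + ?i * j < weight (lead t m) + ?i * m"
      by (rule weight_lead_row_ascent[OF 3 m(1)]) (use assms(1,2) m(1) in auto)
    then show ?thesis by simp
  qed
qed (use assms in auto)

text \<open>The outer pairs \<open>(i, 2t - i)\<close> with \<open>i < k\<close> are common. Inside,
  \<open>lead t k\<close> has exactly \<open>tail_exp t k\<close> and
  \<open>lead t (2 * t - k)\<close> has exactly the nested matching of
  \<open>[k..<2 * t - k]\<close>.\<close>

lemma lead_exchange: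
  assumes "k < t"
  shows "lead t (2 * t - k) + tail_exp t k = lead t k + nest [k..<2 * t - k]"
proof -
  have "lead t (2 * t - k) = (\<Sum>i<k. var_exp i (2 * t - i)) + (\<Sum>i\<in>{k..<t}. var_exp i (2 * t - 1 - i))"
    using assms lead_ge[of t "2 * t - k"] by simp
  moreover have "nest [k..<2 * t - k] = (\<Sum>i\<in>{k..<t}. var_exp i (2 * t - 1 - i))"
    using nest_interval'[of k "2 * t - k" t] assms by simp
  moreover have "lead t k = (\<Sum>i<k. var_exp i (2 * t - i)) + tail_exp t k"
    using assms by (simp add: lead_def tail_exp_def)
  ultimately show ?thesis by (simp add: ac_simps)
qed

lemma upt_snoc: "i \<le> j \<Longrightarrow> [i..<j] @ [j] = [i..<Suc j]"
  by simp

lemma keys_pf_move_last: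
  "Poly_Mapping.keys (pf skew_matrix (m # T) :: (nat \<times> nat, 'a::field) mpoly)
    = Poly_Mapping.keys (pf skew_matrix (T @ [m]) :: (nat \<times> nat, 'a) mpoly)"
proof -
  have "pf (skew_matrix :: nat \<Rightarrow> nat \<Rightarrow> (nat \<times> nat, 'a) mpoly) (m # T)
      = (-1) ^ length T * pf skew_matrix (T @ [m])"
    using skew.pf_move[of "[]" m T "[]"] by (simp del: pf.simps)
  then show ?thesis by (simp del: pf.simps)
qed

text \<open>With \<open>k = 2t - j\<close>, the exchange relation for the interval \<open>T\<close>
  from \<open>k + 1\<close> to \<open>2t - k - 1\<close> is used. Its coefficients vanish for
  \<open>m\<close> in \<open>T\<close>; any other \<open>m\<close> lies before or after all of
  \<open>T\<close>, so the lowest term of the coefficient is again a nested matching. The summands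
  \<open>k\<close> and \<open>j\<close> tie at the least weight.\<close>

lemma reduce_tail:
  assumes "t < j" "j \<le> 2 * t" "pdvd (tail_exp t (2 * t - j)) u"
  shows "syzygy_reduction (skew_vars (2 * t + 1)) (2 * t + 1)
    (gen t :: nat \<Rightarrow> (nat \<times> nat, 'a::field) mpoly) (lead t) j u"
proof -
  define k where "k = 2 * t - j"
  have k: "k < t" "j = 2 * t - k" "2 * t - j = k" using assms by (auto simp: k_def)
  define T where "T = [Suc k..<2 * t - k]"
  have T: "length T + 1 = 2 * (t - k)" "set T \<subseteq> {..2 * t}" "sorted_wrt (<) T"
    using k by (auto simp: T_def)
  let ?X = "skew_matrix :: nat \<Rightarrow> nat \<Rightarrow> (nat \<times> nat, 'a) mpoly"
  let ?q = "\<lambda>m. (-1) ^ m * pf ?X (m # T)"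
  let ?e0 = "tail_exp t k"
  have low: "lowest (nest (m # T)) (pf ?X (m # T))" if "m \<le> k" for m
    by (rule lowest_pf) (use that T(1,3) in \<open>auto simp: T_def\<close>)
  have high: "lowest (nest (T @ [m])) (pf ?X (T @ [m]))" if "j \<le> m" for m
    by (rule lowest_pf) (use that T(1,3) k in \<open>auto simp: T_def sorted_wrt_append\<close>)
  have "Suc (2 * t - k - 1) = 2 * t - k" "Suc k \<le> 2 * t - k - 1" using k by simp_all
  then have Tk1: "T = [Suc k..<2 * t - k - 1] @ [2 * t - k - 1]"
    unfolding T_def by (metis upt_snoc)
  have Tk2: "T = Suc k # [k + 2..<2 * t - k]"
    using k upt_conv_Cons[of "Suc k" "2 * t - k"] by (simp add: T_def)
  have "T @ [j] = [Suc k..<Suc j]" using k by (simp add: T_def)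
  then have e0: "nest (T @ [j]) = ?e0"
    using nest_interval'[of "Suc k" "Suc j" "Suc t"] k
    by (simp add: tail_exp_def atLeastLessThanSuc_atLeastAtMost)
  have "k # T = [k..<2 * t - k]" using k upt_conv_Cons[of k "2 * t - k"] by (simp add: T_def)
  then have tie: "weight (lead t j) + weight ?e0 = weight (lead t k) + weight (nest (k # T))"
    using lead_exchange[OF k(1)] k(2) by (simp flip: weight_add)
  obtain u' where u': "u = ?e0 + u'" using assms(3) by (auto simp: pdvd_def k_def)
  show ?thesis
  proof (rule syzygy_reductionI[where q = ?q and g = "t - k", OF exchange_relation[OF T(2)] _ _ u'])
    show "?q m \<in> graded_part (skew_vars (2 * t + 1)) (t - k)" if "m < 2 * t + 1" for m
      unfolding graded_part_sign using that T(1,2) by (intro pf_graded) auto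
    show "?e0 \<in> Poly_Mapping.keys (?q j)"
      using high[of j] unfolding keys_sign_mult keys_pf_move_last e0
      by (auto simp: lowest_def in_keys_iff)
    fix m e assume me: "m < 2 * t + 1" "e \<in> Poly_Mapping.keys (?q m)" "(m, e) \<noteq> (j, ?e0)"
    then have e: "e \<in> Poly_Mapping.keys (pf ?X (m # T))" by simp
    have "m \<notin> set T"
    proof
      assume "m \<in> set T"
      then have "pf ?X (m # T) = 0" by (rule skew.pf_repeated)
      with e show False by simp
    qed
    then have "m < Suc k \<or> 2 * t - k \<le> m" by (auto simp: T_def)
    then consider "m < k" | "m = k" | "m = j" | "j < m" using k(2) by linarith
    then show "weight (lead t j) + weight ?e0 < weight (lead t m) + weight e \<or>
      (weight (lead t j) + weight ?e0 = weight (lead t m) + weight e \<and> m < j)"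
    proof cases
      case 1
      \<comment> \<open>Here \<open>m\<close> comes first and is paired with the last element of
        \<open>T\<close>, so the weight depends on \<open>m\<close> as in the row relation of
        \<open>2 * t - k - 1\<close>.\<close>
      have nest: "weight (nest (m # T)) = (2 * t - k - 1) * m + weight (nest [Suc k..<2 * t - k - 1])" for m
        unfolding Tk1 nest_wrap by simp
      have "weight (lead t k) + (2 * t - k - 1) * k < weight (lead t m) + (2 * t - k - 1) * m"
        by (rule weight_lead_row_descent[OF 1]) (use k in auto)
      moreover have "weight (nest (m # T)) \<le> weight e" using lowest_le[OF low e] 1 by simp
      ultimately show ?thesis unfolding tie nest by linarith
    next
      case 2
      have "weight (nest (k # T)) \<le> weight e" using lowest_le[OF low e] 2 by simp
      then show ?thesis unfolding tie using 2 k by auto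
    next
      case 3
      then show ?thesis
        using high[of j] e me(3) unfolding keys_pf_move_last e0 by (auto simp: lowest_def)
    next
      case 4
      \<comment> \<open>Here \<open>m\<close> comes last and is paired with \<open>k + 1\<close>, so
        the row relation of \<open>k + 1\<close> decides.\<close>
      have nest: "weight (nest (T @ [m])) = Suc k * m + weight (nest [k + 2..<2 * t - k])" for m
        unfolding Tk2 append_Cons nest_wrap by simp
      have "weight (lead t j) + Suc k * j < weight (lead t m) + Suc k * m"
        by (rule weight_lead_row_ascent[OF 4]) (use k me(1) in auto)
      moreover have "weight (nest (T @ [m])) \<le> weight e"
        using lowest_le[OF high[of m]] e 4 unfolding keys_pf_move_last by simp
      ultimately show ?thesis unfolding e0[symmetric] nest by linarith
    qed
  qed
qed

section \<open>The pfaffian ideal and its Hilbert function\<close>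

lemma keys_lead_low:
  "j \<le> t \<Longrightarrow> Poly_Mapping.keys (lead t j)
    = (\<lambda>i. (i, 2 * t - i)) ` {..<j} \<union> (\<lambda>i. (i, 2 * t + 1 - i)) ` {j + 1..t}"
  by (auto simp: lead_def keys_add_nat keys_sum_nat)

lemma keys_lead_high:
  "t \<le> j \<Longrightarrow> j \<le> 2 * t \<Longrightarrow> Poly_Mapping.keys (lead t j)
    = (\<lambda>i. (i, 2 * t - i)) ` {..<2 * t - j} \<union> (\<lambda>i. (i, 2 * t - 1 - i)) ` {2 * t - j..<t}"
  by (auto simp: lead_ge keys_add_nat keys_sum_nat)

lemma keys_tail_exp: "Poly_Mapping.keys (tail_exp t k) = (\<lambda>i. (i, 2 * t + 1 - i)) ` {Suc k..t}"
  by (auto simp: tail_exp_def keys_sum_nat)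

lemma pdvd_addI1: "pdvd e u \<Longrightarrow> pdvd e (u + v)"
  and pdvd_addI2: "pdvd e v \<Longrightarrow> pdvd e (u + v)"
  by (auto simp: pdvd_iff lookup_add trans_le_add1 trans_le_add2)

lemma pdvd_sum_subset: "finite A \<Longrightarrow> B \<subseteq> A \<Longrightarrow> pdvd (sum f B) (sum f A)"
  unfolding pdvd_def by (metis add.commute sum.subset_diff)

lemma pdvd_sum_member: "finite A \<Longrightarrow> a \<in> A \<Longrightarrow> pdvd (f a) (sum f A)"
  using pdvd_sum_subset[of A "{a}" f] by simp

lemma pdvd_transfer:
  assumes "e + u = e' + v" "pdvd b e" "Poly_Mapping.keys b \<inter> Poly_Mapping.keys e' = {}"
  shows "pdvd b v"
  unfolding pdvd_iff
proof
  fix w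
  show "Poly_Mapping.lookup b w \<le> Poly_Mapping.lookup v w"
  proof (cases "w \<in> Poly_Mapping.keys b")
    case True
    then have "Poly_Mapping.lookup e' w = 0" using assms(3) by (auto simp: in_keys_iff)
    moreover have "Poly_Mapping.lookup (e + u) w = Poly_Mapping.lookup (e' + v) w"
      using assms(1) by simp
    moreover have "Poly_Mapping.lookup b w \<le> Poly_Mapping.lookup e w" using assms(2) by (simp add: pdvd_iff)
    ultimately show ?thesis by (simp add: lookup_add)
  qed (simp add: in_keys_iff)
qed

text \<open>For \<open>i < j\<close>, \<open>lead t i\<close> contains the variable or the tail
  forbidden as a multiplier for \<open>j\<close>, in variables that do not occur in
  \<open>lead t j\<close>; so \<open>v\<close> would be divisible by it.\<close>

lemma multipliers_disjoint_less:
  assumes "i < j" "j \<le> 2 * t" "multipliers t j v" "lead t i + u = lead t j + v"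
  shows False
proof -
  note transfer = pdvd_transfer[OF assms(4)]
  show False
  proof (cases "j \<le> t")
    case True
    have "pdvd (var_exp j (2 * t + 1 - j)) (\<Sum>i\<in>{i + 1..t}. var_exp i (2 * t + 1 - i))"
      by (rule pdvd_sum_member) (use True assms(1) in auto)
    then have "pdvd (var_exp j (2 * t + 1 - j)) (lead t i)"
      unfolding lead_def using True assms(1) by (simp del: One_nat_def add: pdvd_addI2)
    moreover have "(j, 2 * t + 1 - j) \<notin> Poly_Mapping.keys (lead t j)"
      using True by (auto simp: keys_lead_low)
    ultimately have "pdvd (var_exp j (2 * t + 1 - j)) v" by (intro transfer) auto
    then show False using assms(1,3) True by (auto simp: multipliers_def split: if_splits)
  next
    case False
    define k where "k = 2 * t - j"
    have k: "k < t" "j = 2 * t - k" "2 * t - j = k" using False assms(2) by (auto simp: k_def)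
    have keys: "Poly_Mapping.keys (lead t j)
        = (\<lambda>i. (i, 2 * t - i)) ` {..<k} \<union> (\<lambda>i. (i, 2 * t - 1 - i)) ` {k..<t}"
      using keys_lead_high[of t j] False assms(2) k by simp
    have nd: "\<not> pdvd (var_exp k (2 * t - k)) v" "\<not> pdvd (tail_exp t k) v"
      using assms(3) False k by (auto simp: multipliers_def split: if_splits)
    show False
    proof (cases "i \<le> k")
      case True
      have "pdvd (tail_exp t k) (lead t i)"
        unfolding lead_def tail_exp_def using True k by (auto intro!: pdvd_addI2 pdvd_sum_subset)
      moreover have "Poly_Mapping.keys (tail_exp t k) \<inter> Poly_Mapping.keys (lead t j) = {}"
        unfolding keys keys_tail_exp by auto
      ultimately show False using nd transfer by blast
    next
      case False
      have "pdvd (var_exp k (2 * t - k)) (\<Sum>i<r. var_exp i (2 * t - i))" if "k < r" for r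
        by (rule pdvd_sum_member) (use that in auto)
      then have "pdvd (var_exp k (2 * t - k)) (lead t i)"
        unfolding lead_def using False k assms(1) by (auto simp del: One_nat_def intro!: pdvd_addI1)
      moreover have "(k, 2 * t - k) \<notin> Poly_Mapping.keys (lead t j)"
        unfolding keys by auto
      ultimately have "pdvd (var_exp k (2 * t - k)) v" by (intro transfer) auto
      with nd show False by simp
    qed
  qed
qed

text \<open>The tie of \<open>reduce_low\<close> as an equality of monomials.\<close>

lemma lead_step_low:
  assumes "1 \<le> j" "j \<le> t"
  shows "lead t j + var_exp j (2 * t + 1 - j) = lead t (j - 1) + var_exp (j - 1) (2 * t + 1 - j)"
proof -
  obtain i where i: "j = Suc i" using assms by (cases j) auto
  have "{i + 1..t} = insert j {j + 1..t}" using assms i by auto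
  then show ?thesis using assms by (simp add: lead_def i ac_simps)
qed

lemma lead_step_high:
  assumes "t < j" "j \<le> 2 * t"
  shows "lead t j + var_exp (2 * t - j) j = lead t (j - 1) + var_exp (2 * t - j) (j - 1)"
proof -
  define k where "k = 2 * t - j"
  have k: "2 * t - j = k" "2 * t - (j - 1) = Suc k" "k < t" "2 * t - k = j" "2 * t - 1 - k = j - 1"
    using assms by (auto simp: k_def)
  have "{k..<t} = insert k {Suc k..<t}" using k by auto
  then show ?thesis using assms k
    by (subst (1 2) lead_ge) (auto simp: ac_simps)
qed

text \<open>A forbidden multiplier contains the variable or tail that turns \<open>lead t j\<close>
  into a multiple of an earlier \<open>lead t i\<close>; the index is lowered until the multiplier
  is permitted.\<close>

lemma multipliers_cover:
  assumes "j \<le> 2 * t"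
  shows "\<exists>i\<le>2 * t. \<exists>v. multipliers t i v \<and> lead t j + u = lead t i + v"
  using assms
proof (induction j arbitrary: u rule: less_induct)
  case (less j)
  show ?case
  proof (cases "multipliers t j u")
    case True
    then show ?thesis using less.prems by blast
  next
    case False
    have "\<exists>i<j. \<exists>v. lead t j + u = lead t i + v"
    proof (cases "j \<le> t")
      case True
      with False have "pdvd (var_exp j (2 * t + 1 - j)) u" "j \<ge> 1"
        by (auto simp: multipliers_def split: if_splits)
      then obtain u' where u: "u = var_exp j (2 * t + 1 - j) + u'" by (auto simp: pdvd_def)
      have "lead t j + u = lead t (j - 1) + (var_exp (j - 1) (2 * t + 1 - j) + u')"
        unfolding u add.assoc[symmetric] lead_step_low[OF \<open>j \<ge> 1\<close> True] ..
      then show ?thesis using \<open>j \<ge> 1\<close> by (intro exI[of _ "j - 1"]) auto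
    next
      case high: False
      with False consider u' where "u = var_exp (2 * t - j) j + u'" | u' where "u = tail_exp t (2 * t - j) + u'"
        by (auto simp: multipliers_def pdvd_def split: if_splits)
      then show ?thesis
      proof cases
        case 1
        have "t < j" using high by simp
        have "lead t j + u = lead t (j - 1) + (var_exp (2 * t - j) (j - 1) + u')"
          unfolding 1 add.assoc[symmetric] lead_step_high[OF \<open>t < j\<close> less.prems] ..
        then show ?thesis using high by (intro exI[of _ "j - 1"]) auto
      next
        case 2
        have "lead t (2 * t - (2 * t - j)) + tail_exp t (2 * t - j)
            = lead t (2 * t - j) + nest [2 * t - j..<2 * t - (2 * t - j)]"
          by (rule lead_exchange) (use high less.prems in auto)
        then have "lead t j + u = lead t (2 * t - j) + (nest [2 * t - j..<j] + u')"
          using less.prems 2 by (simp add: add.assoc[symmetric])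
        then show ?thesis using high less.prems by (intro exI[of _ "2 * t - j"]) auto
      qed
    qed
    then obtain i v where "i < j" "lead t j + u = lead t i + v" by blast
    with less show ?thesis by (metis less_imp_le order_trans)
  qed
qed

lemma weight_le_degree:
  assumes "e \<in> monomials (skew_vars (2 * t + 1)) m"
  shows "weight e \<le> 4 * t * t * m"
proof -
  have keys: "Poly_Mapping.keys e \<subseteq> skew_vars (2 * t + 1)" and m: "total_degree e = m"
    using assms by (auto simp: monomials_def)
  have "fst v * snd v \<le> 4 * t * t" if "v \<in> Poly_Mapping.keys e" for v
  proof -
    have "fst v \<le> 2 * t" "snd v \<le> 2 * t" using that keys by (auto simp: skew_vars_def)
    from mult_le_mono[OF this] show ?thesis by simp
  qed
  then have "weight e \<le> (\<Sum>v\<in>Poly_Mapping.keys e. Poly_Mapping.lookup e v * (4 * t * t))"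
    unfolding weight_def by (intro sum_mono mult_le_mono2)
  also have "\<dots> = 4 * t * t * m"
    unfolding m[symmetric] total_degree_def by (simp add: sum_distrib_left mult_ac)
  finally show ?thesis .
qed

lemma lowest_basis_gen:
  "lowest_basis (skew_vars (2 * t + 1)) (2 * t + 1) t (4 * t * t)
     (gen t :: nat \<Rightarrow> (nat \<times> nat, 'a::field) mpoly) (lead t) (multipliers t)"
proof
  show "weight e \<le> 4 * t * t * m" if "e \<in> monomials (skew_vars (2 * t + 1)) m" for e m
    by (rule weight_le_degree[OF that])
  show "lowest (lead t j) (gen t j :: (nat \<times> nat, 'a) mpoly)" if "j < 2 * t + 1" for j
    using that by (intro lowest_gen) simp
  show "(gen t j :: (nat \<times> nat, 'a) mpoly) \<in> graded_part (skew_vars (2 * t + 1)) t" if "j < 2 * t + 1" for j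
    using that by (intro gen_graded) simp
  show "syzygy_reduction (skew_vars (2 * t + 1)) (2 * t + 1)
      (gen t :: nat \<Rightarrow> (nat \<times> nat, 'a) mpoly) (lead t) j u"
    if "j < 2 * t + 1" "u \<in> monomials (skew_vars (2 * t + 1)) m" "\<not> multipliers t j u" for j u m
  proof (cases "j \<le> t")
    case True
    with that(3) show ?thesis
      by (intro reduce_low) (auto simp: multipliers_def split: if_splits)
  next
    case False
    with that(3) have "pdvd (var_exp (2 * t - j) j) u \<or> pdvd (tail_exp t (2 * t - j)) u"
      by (auto simp: multipliers_def split: if_splits)
    moreover have "t < j" "j \<le> 2 * t" using False that(1) by auto
    ultimately show ?thesis using reduce_high[of t j u] reduce_tail[of t j u] by blast
  qed
  show "i = j" if "i < 2 * t + 1" "j < 2 * t + 1" "multipliers t i u" "multipliers t j v"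
    "lead t i + u = lead t j + v" for i j u v
    using multipliers_disjoint_less[of i j t v u] multipliers_disjoint_less[of j i t u v] that
    by (cases i j rule: linorder_cases) auto
qed

lemma sub_pfaffian_gen:
  assumes "j \<le> 2 * t"
  shows "sub_pfaffian t ({..<2 * t + 1} - {j}) = gen t j"
proof -
  let ?L = "del j [0..<2 * t + 1]"
  have "sorted_list_of_set ({..<2 * t + 1} - {j}) = ?L"
  proof (subst sorted_list_of_set_unique[symmetric], simp, intro conjI)
    show "sorted_wrt (<) ?L" by (intro sorted_del) (simp del: upt_Suc)
    have "?L = [0..<j] @ [Suc j..<2 * t + 1]"
      using assms by (simp add: del_def take_upt drop_upt)
    then show "set ?L = {..<2 * t + 1} - {j}" using assms by auto
    show "length ?L = card ({..<2 * t + 1} - {j})" using assms by simp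
  qed
  then show ?thesis
    using pfaffian_eq_pf[of ?L t skew_matrix] assms
    by (simp add: sub_pfaffian_def gen_def Let_def)
qed

lemma card_missing_one:
  assumes "S \<subseteq> {..<2 * t + 1}" "card S = 2 * t"
  obtains j where "j \<le> 2 * t" "S = {..<2 * t + 1} - {j}"
proof -
  have "card ({..<2 * t + 1} - S) = 1"
    using assms by (subst card_Diff_subset) (auto intro: finite_subset)
  then obtain j where "{..<2 * t + 1} - S = {j}" by (auto simp: card_1_singleton_iff)
  with assms(1) have "j \<le> 2 * t" "S = {..<2 * t + 1} - {j}" by auto
  with that show ?thesis .
qed

lemma pfaffian_generators:
  "{sub_pfaffian t S | S. S \<subseteq> {..<2 * t + 1} \<and> card S = 2 * t} = gen t ` {..2 * t}"
proof (intro equalityI subsetI)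
  fix p assume "p \<in> {sub_pfaffian t S | S. S \<subseteq> {..<2 * t + 1} \<and> card S = 2 * t}"
  then obtain S where S: "p = sub_pfaffian t S" "S \<subseteq> {..<2 * t + 1}" "card S = 2 * t" by blast
  from card_missing_one[OF S(2,3)] S(1) show "p \<in> gen t ` {..2 * t}"
    by (metis atMost_iff image_eqI sub_pfaffian_gen)
next
  fix p :: "(nat \<times> nat, 'a) mpoly" assume "p \<in> gen t ` {..2 * t}"
  then obtain j where j: "j \<le> 2 * t" "p = gen t j" by auto
  then have "p = sub_pfaffian t ({..<2 * t + 1} - {j})" by (simp only: sub_pfaffian_gen)
  with j(1) show "p \<in> {sub_pfaffian t S | S. S \<subseteq> {..<2 * t + 1} \<and> card S = 2 * t}"
    by (intro CollectI exI[of _ "{..<2 * t + 1} - {j}"]) auto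
qed

section \<open>Ideals, cosets and dimensions in the quotient ring\<close>

lemma poly_ring_simps [simp]:
  "\<zero>\<^bsub>poly_ring V\<^esub> = 0" "\<one>\<^bsub>poly_ring V\<^esub> = 1"
  "f \<oplus>\<^bsub>poly_ring V\<^esub> g = f + g" "f \<otimes>\<^bsub>poly_ring V\<^esub> g = f * g"
  by (simp_all add: poly_ring_def)

lemma poly_ring_uminus_closed: "f \<in> carrier (poly_ring V) \<Longrightarrow> - f \<in> carrier (poly_ring V)"
  by (auto simp: carrier_poly_ring_iff)

lemma poly_ring_a_inv:
  fixes f :: "('v, 'a::field) mpoly"
  assumes "f \<in> carrier (poly_ring V)" shows "\<ominus>\<^bsub>poly_ring V\<^esub> f = - f"
proof -
  interpret cring "poly_ring V :: ('v, 'a) mpoly ring" by (rule poly_ring_cring)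
  show ?thesis
    using assms poly_ring_uminus_closed[OF assms] by (intro minus_equality) auto
qed

lemma graded_part_carrier: "graded_part V m \<subseteq> carrier (poly_ring V)"
  by (auto simp: graded_part_def)

lemma (in lowest_basis) ideal_combinations: "ideal combinations (poly_ring V)"
proof -
  interpret R: cring "poly_ring V :: (nat \<times> nat, 'a) mpoly ring" by (rule poly_ring_cring)
  have carr: "p j \<in> carrier (poly_ring V)" if "j < n" for j
    using graded_p[OF that] graded_part_carrier by blast
  have sub: "combinations \<subseteq> carrier (poly_ring V)"
  proof
    fix f assume "f \<in> combinations"
    then obtain q where q: "f = (\<Sum>i<n. q i * p i)" "\<forall>i<n. q i \<in> carrier (poly_ring V)"
      by (auto simp: combinations_def)
    have "(\<Sum>i<m. q i * p i) \<in> carrier (poly_ring V)" if "m \<le> n" for m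
      using that
    proof (induction m)
      case 0
      then show ?case by (simp add: carrier_poly_ring_iff)
    next
      case (Suc m)
      then show ?case
        using R.a_closed[of "\<Sum>i<m. q i * p i" "q m * p m"] R.m_closed[of "q m" "p m"] q(2) carr[of m]
        by simp
    qed
    with q(1) show "f \<in> carrier (poly_ring V)" by simp
  qed
  have neg: "- f \<in> combinations" if "f \<in> combinations" for f
    using combinations_mult[OF that const_carrier[of "-1"]] by (simp add: mpoly_const_def single_uminus)
  show ?thesis
  proof (rule idealI[OF R.ring_axioms])
    show "subgroup combinations (add_monoid (poly_ring V))"
    proof (rule group.subgroupI[OF R.a_group])
      show "combinations \<noteq> {}" using combinations_zero by blast
      show "inv\<^bsub>add_monoid (poly_ring V)\<^esub> f \<in> combinations" if "f \<in> combinations" for f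
        using neg[OF that] poly_ring_a_inv[of f V] that sub by (auto simp: a_inv_def)
    qed (use sub combinations_add in auto)
  qed (use combinations_mult in \<open>auto simp: mult.commute\<close>)
qed

lemma (in lowest_basis) genideal_combinations: "Idl\<^bsub>poly_ring V\<^esub> (p ` {..<n}) = combinations"
proof -
  interpret R: cring "poly_ring V :: (nat \<times> nat, 'a) mpoly ring" by (rule poly_ring_cring)
  have carr: "p ` {..<n} \<subseteq> carrier (poly_ring V)"
    using graded_p graded_part_carrier by blast
  interpret I: ideal "Idl\<^bsub>poly_ring V\<^esub> (p ` {..<n})" "poly_ring V :: (nat \<times> nat, 'a) mpoly ring"
    by (rule R.genideal_ideal[OF carr])
  show ?thesis
  proof
    show "Idl\<^bsub>poly_ring V\<^esub> (p ` {..<n}) \<subseteq> combinations"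
      by (rule R.genideal_minimal[OF ideal_combinations]) (auto intro: combinations_generator)
    show "combinations \<subseteq> Idl\<^bsub>poly_ring V\<^esub> (p ` {..<n})"
    proof
      fix f assume "f \<in> combinations"
      then obtain q where q: "f = (\<Sum>i<n. q i * p i)" "\<forall>i<n. q i \<in> carrier (poly_ring V)"
        by (auto simp: combinations_def)
      have gens: "p i \<in> Idl\<^bsub>poly_ring V\<^esub> (p ` {..<n})" if "i < n" for i
        using R.genideal_self[OF carr] that by blast
      have "(\<Sum>i<m. q i * p i) \<in> Idl\<^bsub>poly_ring V\<^esub> (p ` {..<n})" if "m \<le> n" for m
        using that
      proof (induction m)
        case 0
        then show ?case using I.zero_closed by simp
      next
        case (Suc m)
        then show ?case
          using I.a_closed[of "\<Sum>i<m. q i * p i" "q m * p m"] I.I_l_closed[of "p m" "q m"] gens[of m] q(2)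
          by simp
      qed
      with q(1) show "f \<in> Idl\<^bsub>poly_ring V\<^esub> (p ` {..<n})" by simp
    qed
  qed
qed

lemma pfaffian_ideal_combinations:
  "pfaffian_ideal (2 * t + 1) t =
     (lowest_basis.combinations (skew_vars (2 * t + 1)) (2 * t + 1) (gen t) :: (nat \<times> nat, 'a::field) mpoly set)"
proof -
  interpret lowest_basis "skew_vars (2 * t + 1)" "2 * t + 1" t "4 * t * t"
    "gen t :: nat \<Rightarrow> (nat \<times> nat, 'a) mpoly" "lead t" "multipliers t"
    by (rule lowest_basis_gen)
  have "{..2 * t} = {..<2 * t + 1}" by auto
  then show ?thesis
    unfolding pfaffian_ideal_def pfaffian_generators using genideal_combinations by simp
qed

lemma coset_eq_iff:
  fixes f g :: "('v, 'a::field) mpoly"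
  assumes "ideal I (poly_ring V)"
  shows "I +>\<^bsub>poly_ring V\<^esub> f = I +>\<^bsub>poly_ring V\<^esub> g \<longleftrightarrow> f - g \<in> I"
proof -
  interpret ideal I "poly_ring V :: ('v, 'a) mpoly ring" by fact
  have neg: "- h \<in> I" if "h \<in> I" for h
    using additive_subgroup.a_inv_closed[OF additive_subgroup_axioms that] poly_ring_a_inv[of h V] that a_subset
    by auto
  have add: "h + k \<in> I" if "h \<in> I" "k \<in> I" for h k
    using additive_subgroup.a_closed[OF additive_subgroup_axioms that] by simp
  have coset: "I +>\<^bsub>poly_ring V\<^esub> h = (\<lambda>k. k + h) ` I" for h
    by (auto simp: a_r_coset_def')
  show ?thesis
  proof
    assume eq: "I +>\<^bsub>poly_ring V\<^esub> f = I +>\<^bsub>poly_ring V\<^esub> g"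
    have "0 + f \<in> (\<lambda>k. k + f) ` I"
      using additive_subgroup.zero_closed[OF additive_subgroup_axioms] by (intro imageI) simp
    with eq obtain k where "k \<in> I" "f = k + g" unfolding coset by auto
    then show "f - g \<in> I" by simp
  next
    assume fg: "f - g \<in> I"
    have "(\<lambda>k. k + f) ` I \<subseteq> (\<lambda>k. k + g) ` I" if "f - g \<in> I" for f g
    proof
      fix x assume "x \<in> (\<lambda>k. k + f) ` I"
      then obtain k where "k \<in> I" "x = k + f" by auto
      then have "x = (k + (f - g)) + g" "k + (f - g) \<in> I" using that add by auto
      then show "x \<in> (\<lambda>k. k + g) ` I" by blast
    qed
    from this[OF fg] this[of g f] neg[OF fg] show "I +>\<^bsub>poly_ring V\<^esub> f = I +>\<^bsub>poly_ring V\<^esub> g"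
      unfolding coset by auto
  qed
qed

lemma mpoly_const_add: "mpoly_const (a + b) = mpoly_const a + mpoly_const b"
  and mpoly_const_mult: "mpoly_const (a * b) = mpoly_const a * mpoly_const b"
  and mpoly_const_uminus: "mpoly_const (- a) = - mpoly_const a"
  and mpoly_const_one [simp]: "mpoly_const 1 = 1"
  and mpoly_const_zero [simp]: "mpoly_const 0 = 0"
  by (simp_all add: mpoly_const_def single_add mult_single single_uminus)

lemma mpoly_const_in_carrier [simp]: "mpoly_const c \<in> carrier (poly_ring V)"
  by (auto simp: mpoly_const_def carrier_poly_ring_iff)

lemma subfield_consts:
  "subfield (range mpoly_const) (poly_ring V :: ('v, 'a::field) mpoly ring)"
proof -
  let ?R = "poly_ring V :: ('v, 'a) mpoly ring" and ?K = "range mpoly_const :: ('v, 'a) mpoly set"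
  interpret R: cring ?R by (rule poly_ring_cring)
  have "subring ?K ?R"
    by (rule R.subringI)
      (auto simp: poly_ring_a_inv simp flip: mpoly_const_add mpoly_const_mult mpoly_const_uminus mpoly_const_one)
  then have "subcring ?K ?R" by (rule R.subcringI')
  moreover have "Units (?R \<lparr>carrier := ?K\<rparr>) = ?K - {\<zero>\<^bsub>?R\<^esub>}"
  proof (intro equalityI subsetI)
    fix k assume "k \<in> Units (?R \<lparr>carrier := ?K\<rparr>)"
    then show "k \<in> ?K - {\<zero>\<^bsub>?R\<^esub>}" by (auto simp: Units_def)
  next
    fix k assume "k \<in> ?K - {\<zero>\<^bsub>?R\<^esub>}"
    then obtain c where c: "k = mpoly_const c" "k \<noteq> 0" by auto
    then have "c \<noteq> 0" by auto
    then have "mpoly_const (inverse c) * k = 1" "k * mpoly_const (inverse c) = 1"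
      unfolding c(1) by (simp_all flip: mpoly_const_mult)
    with c(1) show "k \<in> Units (?R \<lparr>carrier := ?K\<rparr>)" by (auto simp: Units_def)
  qed
  ultimately show ?thesis by (rule R.subfieldI)
qed

text \<open>Dimension over the embedded field is built up by line extensions, so the space of cosets
  is enlarged one monomial of \<open>B\<close> at a time; independence modulo \<open>I\<close> makes
  every extension proper.\<close>

lemma hilbert_function_eq_card:
  fixes I :: "('v, 'a::field) mpoly set"
  assumes I: "ideal I (poly_ring V)" "1 \<notin> I"
    and B: "finite B" "B \<subseteq> monomials V m"
    and span: "\<And>f. f \<in> graded_part V m \<Longrightarrow> \<exists>r. Poly_Mapping.keys r \<subseteq> B \<and> f - r \<in> I"
    and indep: "\<And>r. Poly_Mapping.keys r \<subseteq> B \<Longrightarrow> r \<in> I \<Longrightarrow> r = 0"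
  shows "hilbert_function V I m = card B"
proof -
  let ?R = "poly_ring V :: ('v, 'a) mpoly ring"
  let ?Q = "?R Quot I" and ?h = "\<lambda>f. I +>\<^bsub>?R\<^esub> f"
  let ?K = "range (\<lambda>c. ?h (mpoly_const c))"
  interpret R: cring ?R by (rule poly_ring_cring)
  interpret I: ideal I ?R by fact
  interpret Q: cring ?Q by (rule I.quotient_is_cring[OF poly_ring_cring])
  interpret h: ring_hom_ring ?R ?Q ?h by (rule I.rcos_ring_hom_ring)
  note eq = coset_eq_iff[OF I(1)]
  \<comment> \<open>A nonzero quotient is what keeps the cosets of the constants a field.\<close>
  have "\<one>\<^bsub>?Q\<^esub> \<noteq> \<zero>\<^bsub>?Q\<^esub>"
    using eq[of 1 0] I(2) h.hom_one h.hom_zero by simp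
  from h.img_is_subfield(2)[OF subfield_consts this]
  have K: "subfield ?K ?Q" by (simp add: image_image)
  have carr: "f \<in> carrier ?R" if "Poly_Mapping.keys f \<subseteq> B" for f :: "('v, 'a) mpoly"
    using that B(2) by (auto simp: carrier_poly_ring_iff monomials_def)
  have dim: "Q.dimension (card A) ?K (?h ` {f. Poly_Mapping.keys f \<subseteq> A})" if "A \<subseteq> B" for A
    using finite_subset[OF that B(1)] that
  proof (induction A rule: finite_induct)
    case empty
    have "{f :: ('v, 'a) mpoly. Poly_Mapping.keys f \<subseteq> {}} = {0}"
      by (auto simp: poly_mapping_eq_iff fun_eq_iff in_keys_iff)
    then show ?case using Q.zero_dim h.hom_zero by simp
  next
    case (insert a A)
    let ?E = "?h ` {f. Poly_Mapping.keys f \<subseteq> A}"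
    have keys_a: "Poly_Mapping.keys (monom_of a :: ('v, 'a) mpoly) \<subseteq> B" using insert.prems by simp
    have "?h (monom_of a) \<notin> ?E"
    proof
      assume "?h (monom_of a) \<in> ?E"
      then obtain f where f: "Poly_Mapping.keys f \<subseteq> A" "monom_of a - f \<in> I" by (auto simp: eq)
      have "Poly_Mapping.keys (monom_of a - f) \<subseteq> B"
        using keys_minus_subset[of "monom_of a" f] f(1) insert.prems by auto
      with f(2) have "monom_of a - f = 0" by (intro indep)
      then have "monom_of a = f" by simp
      then have "a \<in> A" using f(1) by auto
      with insert.hyps show False by simp
    qed
    moreover have "Q.dimension (card A) ?K ?E" using insert by auto
    ultimately have "Q.dimension (Suc (card A)) ?K (Q.line_extension ?K (?h (monom_of a)) ?E)"
      by (intro Q.Suc_dim h.hom_closed carr[OF keys_a])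
    moreover have "Q.line_extension ?K (?h (monom_of a)) ?E = ?h ` {f. Poly_Mapping.keys f \<subseteq> insert a A}"
    proof -
      have hom: "?h (mpoly_const c) \<otimes>\<^bsub>?Q\<^esub> ?h (monom_of a) \<oplus>\<^bsub>?Q\<^esub> ?h f = ?h (mpoly_const c * monom_of a + f)"
        if "Poly_Mapping.keys f \<subseteq> A" for c f
      proof -
        have f: "f \<in> carrier ?R" using that insert.prems by (intro carr) auto
        have c: "mpoly_const c * monom_of a \<in> carrier ?R"
          using R.m_closed[OF mpoly_const_in_carrier carr[OF keys_a]] by simp
        show ?thesis
          using h.hom_mult[OF mpoly_const_in_carrier carr[OF keys_a], of c] h.hom_add[OF c f]
          unfolding poly_ring_simps by (simp only:)
      qed
      show ?thesis
      proof (intro equalityI subsetI)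
        fix x assume "x \<in> Q.line_extension ?K (?h (monom_of a)) ?E"
        then obtain c f where cf: "Poly_Mapping.keys f \<subseteq> A"
          "x = ?h (mpoly_const c) \<otimes>\<^bsub>?Q\<^esub> ?h (monom_of a) \<oplus>\<^bsub>?Q\<^esub> ?h f"
          by (auto simp: Q.line_extension_mem_iff)
        have "Poly_Mapping.keys (mpoly_const c * monom_of a + f) \<subseteq> insert a A"
          using Poly_Mapping.keys_add[of "mpoly_const c * monom_of a" f] keys_const_mult[of c "monom_of a"] cf(1)
          by auto
        then show "x \<in> ?h ` {f. Poly_Mapping.keys f \<subseteq> insert a A}"
          using cf hom by auto
      next
        fix x assume "x \<in> ?h ` {f. Poly_Mapping.keys f \<subseteq> insert a A}"
        then obtain g where g: "Poly_Mapping.keys g \<subseteq> insert a A" "x = ?h g" by auto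
        define f where "f = g - mpoly_const (coef g a) * monom_of a"
        have "Poly_Mapping.keys f \<subseteq> A"
        proof
          fix e assume e: "e \<in> Poly_Mapping.keys f"
          then have "e \<noteq> a" by (auto simp: f_def in_keys_iff lookup_minus coef_const_mult)
          moreover have "e \<in> insert a A"
            using e g(1) keys_minus_subset[of g "mpoly_const (coef g a) * monom_of a"]
              keys_const_mult[of "coef g a" "monom_of a"] by (auto simp: f_def)
          ultimately show "e \<in> A" by simp
        qed
        moreover have "x = ?h (mpoly_const (coef g a)) \<otimes>\<^bsub>?Q\<^esub> ?h (monom_of a) \<oplus>\<^bsub>?Q\<^esub> ?h f"
          using hom[OF \<open>Poly_Mapping.keys f \<subseteq> A\<close>] g(2) by (simp add: f_def)
        ultimately show "x \<in> Q.line_extension ?K (?h (monom_of a)) ?E"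
          by (auto simp: Q.line_extension_mem_iff)
      qed
    qed
    ultimately show ?case using insert.hyps by simp
  qed
  have "?h ` {f. Poly_Mapping.keys f \<subseteq> B} = ?h ` graded_part V m"
  proof (intro equalityI subsetI)
    fix x assume "x \<in> ?h ` {f. Poly_Mapping.keys f \<subseteq> B}"
    then show "x \<in> ?h ` graded_part V m" using B(2) by (auto simp: graded_part_iff)
  next
    fix x assume "x \<in> ?h ` graded_part V m"
    then obtain f where f: "f \<in> graded_part V m" "x = ?h f" by auto
    from span[OF f(1)] obtain r where "Poly_Mapping.keys r \<subseteq> B" "f - r \<in> I" by auto
    then show "x \<in> ?h ` {f. Poly_Mapping.keys f \<subseteq> B}" using f(2) eq[of f r] by auto
  qed
  with dim[of B] have "Q.dimension (card B) ?K (?h ` graded_part V m)" by simp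
  from Q.dimI[OF K this] show ?thesis
    by (simp add: hilbert_function_def Let_def over_def)
qed

lemma finite_monomials:
  assumes "finite V" shows "finite (monomials V m)"
proof -
  have "monomials V m \<subseteq> (\<lambda>g. Abs_poly_mapping (\<lambda>v. if v \<in> V then g v else 0)) ` (PiE V (\<lambda>_. {..m}))"
  proof
    fix e assume e: "e \<in> monomials V m"
    have le: "Poly_Mapping.lookup e v \<le> m" for v
    proof (cases "v \<in> Poly_Mapping.keys e")
      case True
      then have "Poly_Mapping.lookup e v \<le> total_degree e"
        unfolding total_degree_def by (intro member_le_sum) auto
      then show ?thesis using e by (simp add: monomials_def)
    qed (simp add: in_keys_iff)
    have "Poly_Mapping.lookup e v = 0" if "v \<notin> V" for v
      using that e by (auto simp: monomials_def in_keys_iff)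
    then have "e = Abs_poly_mapping (\<lambda>v. if v \<in> V then restrict (Poly_Mapping.lookup e) V v else 0)"
      using assms by (intro poly_mapping_eqI) (auto simp: lookup_Abs_poly_mapping)
    moreover have "restrict (Poly_Mapping.lookup e) V \<in> PiE V (\<lambda>_. {..m})" using le by auto
    ultimately show "e \<in> (\<lambda>g. Abs_poly_mapping (\<lambda>v. if v \<in> V then g v else 0)) ` (PiE V (\<lambda>_. {..m}))"
      by blast
  qed
  moreover have "finite ((\<lambda>g. Abs_poly_mapping (\<lambda>v. if v \<in> V then g v else 0)) ` (PiE V (\<lambda>_. {..m})))"
    using assms by (intro finite_imageI finite_PiE) auto
  ultimately show ?thesis by (rule finite_subset)
qed

lemma (in lowest_basis) combinations_proper:
  assumes "1 \<le> D" shows "1 \<notin> combinations"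
proof
  assume "1 \<in> combinations"
  moreover have "(0 :: nat \<times> nat \<Rightarrow>\<^sub>0 nat) \<in> standard 0"
  proof -
    have False if "j < n" "0 = l j + u" for j u
      using l_in[OF that(1)] arg_cong[OF that(2), of total_degree] assms by (simp add: monomials_def)
    then show ?thesis by (auto simp: standard_def monomials_def)
  qed
  ultimately have "(1 :: (nat \<times> nat, 'a) mpoly) = 0"
    by (intro standard_independent) auto
  then show False by simp
qed

lemma (in lowest_basis) hilbert_function_combinations:
  assumes "finite V" "1 \<le> D"
  shows "hilbert_function V combinations m = card (standard m)"
proof (rule hilbert_function_eq_card[OF ideal_combinations combinations_proper[OF assms(2)]])
  show "finite (standard m)" "standard m \<subseteq> monomials V m"
    using finite_monomials[OF assms(1), of m] by (auto simp: standard_def)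
  show "\<exists>r. Poly_Mapping.keys r \<subseteq> standard m \<and> f - r \<in> combinations" if "f \<in> graded_part V m" for f
    using standard_spanning[OF that] by (simp add: reducible_def)
  show "r = 0" if "Poly_Mapping.keys r \<subseteq> standard m" "r \<in> combinations" for r
    using that by (intro standard_independent) auto
qed

section \<open>The Hilbert series\<close>

unbundle fps_syntax

definition monomial_series :: "'v set \<Rightarrow> int fps" where
  "monomial_series V = Abs_fps (\<lambda>m. int (card (monomials V m)))"

lemma monomials_pdvd:
  assumes "b \<in> monomials V k"
  shows "{u \<in> monomials V m. pdvd b u} = (if k \<le> m then (+) b ` monomials V (m - k) else {})"
proof (cases "k \<le> m")
  case True
  have "{u \<in> monomials V m. pdvd b u} = (+) b ` monomials V (m - k)"
  proof (intro equalityI subsetI)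
    fix u assume "u \<in> {u \<in> monomials V m. pdvd b u}"
    then obtain u' where "u = b + u'" "b + u' \<in> monomials V m" by (auto simp: pdvd_def)
    with monomials_add_cancel[OF _ assms] show "u \<in> (+) b ` monomials V (m - k)" by blast
  next
    fix u assume "u \<in> (+) b ` monomials V (m - k)"
    then show "u \<in> {u \<in> monomials V m. pdvd b u}"
      using monomials_add[OF assms, of _ "m - k"] True by (auto simp: pdvd_def)
  qed
  with True show ?thesis by simp
next
  case False
  with assms show ?thesis by (auto simp: monomials_def pdvd_def)
qed

text \<open>Multiplication by \<open>b\<close> is injective and raises the degree by
  \<open>k\<close>, so the multiples of \<open>b\<close> have the full series shifted by
  \<open>k\<close>.\<close>

lemma card_monomials_not_pdvd:
  assumes "finite V" "b \<in> monomials V k"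
  shows "Abs_fps (\<lambda>m. int (card {u \<in> monomials V m. \<not> pdvd b u})) = monomial_series V * (1 - fps_X ^ k)"
proof (rule fps_ext)
  fix m
  have fin: "finite (monomials V m)" by (rule finite_monomials[OF assms(1)])
  have split: "monomials V m = {u \<in> monomials V m. \<not> pdvd b u} \<union> {u \<in> monomials V m. pdvd b u}" by auto
  have "card (monomials V m) = card {u \<in> monomials V m. \<not> pdvd b u} + card {u \<in> monomials V m. pdvd b u}"
    by (subst split, rule card_Un_disjoint) (use fin in auto)
  moreover have "card {u \<in> monomials V m. pdvd b u} = (if k \<le> m then card (monomials V (m - k)) else 0)"
    unfolding monomials_pdvd[OF assms(2)] by (simp add: card_image)
  ultimately show "Abs_fps (\<lambda>m. int (card {u \<in> monomials V m. \<not> pdvd b u})) $ m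
      = (monomial_series V * (1 - fps_X ^ k)) $ m"
    by (auto simp: monomial_series_def right_diff_distrib fps_X_power_mult_right_nth)
qed

lemma monomials_remove_var:
  "{u \<in> monomials V m. \<not> pdvd (Poly_Mapping.single v 1) u} = monomials (V - {v}) m"
  by (auto simp: monomials_def pdvd_iff lookup_single when_def in_keys_iff subset_iff Suc_le_eq)

lemma monomial_series_remove_var:
  assumes "finite V" "v \<in> V"
  shows "monomial_series (V - {v}) = monomial_series V * (1 - fps_X)"
  using card_monomials_not_pdvd[OF assms(1), of "Poly_Mapping.single v 1" 1] assms(2)
  unfolding monomials_remove_var by (simp add: monomial_series_def monomials_def)

lemma monomial_series_power:
  assumes "finite V" shows "monomial_series V * (1 - fps_X) ^ card V = 1"
  using assms
proof (induction V rule: finite_induct)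
  case empty
  have "monomials {} m = (if m = 0 then {0} else ({} :: ('a \<Rightarrow>\<^sub>0 nat) set))" for m
    by (auto simp: monomials_def)
  then show ?case by (intro fps_ext) (simp add: monomial_series_def)
next
  case (insert v V)
  then show ?case
    using monomial_series_remove_var[of "insert v V" v] by (simp add: mult.assoc)
qed

text \<open>\<open>cover\<close> and \<open>disjoint\<close> split the nonstandard monomials into
  translates by \<open>l j\<close> of the permitted multipliers, one for each
  \<open>j\<close>.\<close>

lemma (in lowest_basis) card_standard:
  assumes "finite V"
    and cover: "\<And>j u. j < n \<Longrightarrow> \<exists>i<n. \<exists>v. S i v \<and> l j + u = l i + v"
  shows "Abs_fps (\<lambda>m. int (card (standard m))) = monomial_series V
    - fps_X ^ D * (\<Sum>j<n. Abs_fps (\<lambda>m. int (card {u \<in> monomials V m. S j u})))"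
proof (rule fps_ext)
  fix m
  let ?N = "\<lambda>j. {u \<in> monomials V (m - D). S j u}"
  let ?T = "\<Union>j<n. (+) (l j) ` ?N j"
  have fin: "finite (monomials V k)" for k by (rule finite_monomials[OF assms(1)])
  show "Abs_fps (\<lambda>m. int (card (standard m))) $ m = (monomial_series V
      - fps_X ^ D * (\<Sum>j<n. Abs_fps (\<lambda>m. int (card {u \<in> monomials V m. S j u})))) $ m"
  proof (cases "D \<le> m")
    case True
    have "monomials V m = standard m \<union> ?T"
    proof (intro equalityI subsetI)
      fix e assume e: "e \<in> monomials V m"
      show "e \<in> standard m \<union> ?T"
      proof (cases "e \<in> standard m")
        case False
        with e obtain j u where "j < n" "e = l j + u" by (auto simp: standard_def)
        with cover obtain i v where iv: "i < n" "S i v" "e = l i + v" by metis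
        then have "v \<in> monomials V (m - D)"
          using e l_in[OF iv(1)] monomials_add_cancel by blast
        with iv show ?thesis by auto
      qed simp
    next
      fix e assume "e \<in> standard m \<union> ?T"
      then show "e \<in> monomials V m"
        using monomials_add[OF l_in, of _ _ "m - D"] True by (auto simp: standard_def)
    qed
    moreover have "standard m \<inter> ?T = {}" by (auto simp: standard_def)
    moreover have "finite (standard m)" using fin[of m] by (simp add: standard_def)
    moreover have "finite ?T" using fin by simp
    ultimately have "card (monomials V m) = card (standard m) + card ?T"
      by (simp add: card_Un_disjoint)
    moreover have "card ?T = (\<Sum>j<n. card ((+) (l j) ` ?N j))"
    proof (rule card_UN_disjoint)
      show "\<forall>i\<in>{..<n}. \<forall>j\<in>{..<n}. i \<noteq> j \<longrightarrow> (+) (l i) ` ?N i \<inter> (+) (l j) ` ?N j = {}"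
        using disjoint by fastforce
    qed (use fin in auto)
    moreover have "\<dots> = (\<Sum>j<n. card (?N j))" by (simp add: card_image)
    ultimately show ?thesis using True
      by (simp add: monomial_series_def fps_X_power_mult_nth fps_sum_nth)
  next
    case False
    have "standard m = monomials V m"
      using False l_in by (auto simp: standard_def monomials_def)
    with False show ?thesis by (simp add: monomial_series_def fps_X_power_mult_nth)
  qed
qed

lemma finite_skew_vars: "finite (skew_vars n)"
proof -
  have "skew_vars n \<subseteq> {..<n} \<times> {..<n}" by (auto simp: skew_vars_def)
  then show ?thesis by (rule finite_subset) simp
qed

lemma card_skew_vars: "2 * card (skew_vars n) = n * (n - 1)"
proof (induction n)
  case (Suc n)
  have "skew_vars (Suc n) = skew_vars n \<union> (\<lambda>i. (i, n)) ` {..<n}"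
    by (auto simp: skew_vars_def less_Suc_eq)
  moreover have "card (skew_vars n \<union> (\<lambda>i. (i, n)) ` {..<n}) = card (skew_vars n) + card ((\<lambda>i. (i, n)) ` {..<n})"
    by (rule card_Un_disjoint[OF finite_skew_vars]) (auto simp: skew_vars_def)
  moreover have "card ((\<lambda>i. (i, n)) ` {..<n}) = n" by (subst card_image) (auto simp: inj_on_def)
  ultimately show ?case using Suc by (cases n) (auto simp: algebra_simps)
qed (simp add: skew_vars_def)

lemma card_skew_vars_odd: "card (skew_vars (2 * t + 1)) = t * (2 * t + 1)"
  using card_skew_vars[of "2 * t + 1"] by simp

text \<open>For \<open>j > t\<close> the two exclusions concern disjoint sets of variables, so their
  factors multiply: first the variable \<open>(2 * t - j, j)\<close> is dropped, then the multiples
  of a tail of degree \<open>j - t\<close> in the remaining variables.\<close>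

lemma multipliers_series:
  assumes "j \<le> 2 * t"
  shows "Abs_fps (\<lambda>m. int (card {u \<in> monomials (skew_vars (2 * t + 1)) m. multipliers t j u}))
    = monomial_series (skew_vars (2 * t + 1)) *
      (if j = 0 then 1 else if j \<le> t then 1 - fps_X else (1 - fps_X) * (1 - fps_X ^ (j - t)))"
proof -
  let ?V = "skew_vars (2 * t + 1)"
  consider "j = 0" | "1 \<le> j" "j \<le> t" | "t < j" by linarith
  then show ?thesis
  proof cases
    case 1
    then show ?thesis by (simp add: multipliers_def monomial_series_def)
  next
    case 2
    have "var_exp j (2 * t + 1 - j) \<in> monomials ?V 1"
      using 2 by (auto simp: monomials_def skew_vars_def)
    from card_monomials_not_pdvd[OF finite_skew_vars this] 2 show ?thesis
      by (simp add: multipliers_def)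
  next
    case 3
    let ?v = "(2 * t - j, j)"
    have v: "?v \<in> ?V" using 3 assms by (auto simp: skew_vars_def)
    have "tail_exp t (2 * t - j) \<in> monomials (?V - {?v}) (j - t)"
    proof -
      have "total_degree (tail_exp t (2 * t - j)) = j - t"
        using 3 assms by (simp add: tail_exp_def total_degree_sum)
      then show ?thesis using 3 assms by (auto simp: monomials_def keys_tail_exp skew_vars_def)
    qed
    note card_monomials_not_pdvd[OF finite_Diff[OF finite_skew_vars] this]
    moreover have "{u \<in> monomials ?V m. multipliers t j u}
        = {u \<in> monomials (?V - {?v}) m. \<not> pdvd (tail_exp t (2 * t - j)) u}" for m
      unfolding monomials_remove_var[symmetric] using 3 by (auto simp: multipliers_def)
    ultimately show ?thesis
      using 3 monomial_series_remove_var[OF finite_skew_vars v] by (simp add: mult.assoc)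
  qed
qed

lemma geometric_fps: "(1 - fps_X) * (\<Sum>s<t. fps_X ^ s) = (1 - fps_X ^ t :: int fps)"
  by (simp add: one_diff_power_eq)

lemma sum_lessThan_add: "(\<Sum>j<m + n. g j) = (\<Sum>j<m. g j) + (\<Sum>s<n. g (m + s))"
  for g :: "nat \<Rightarrow> 'b::comm_monoid_add"
  by (induction n) (auto simp: add.assoc)

definition hilbert_numerator :: "nat \<Rightarrow> int fps" where
  "hilbert_numerator t = 1 - of_nat (2 * t + 1) * fps_X ^ t + of_nat (2 * t + 1) * fps_X ^ (t + 1) - fps_X ^ (2 * t + 1)"

lemma hilbert_series_pfaffian_ideal:
  assumes "1 \<le> t"
  shows "hilbert_series (skew_vars (2 * t + 1)) (pfaffian_ideal (2 * t + 1) t :: (nat \<times> nat, 'a::field) mpoly set)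
    * (1 - fps_X) ^ (t * (2 * t + 1)) = hilbert_numerator t"
proof -
  let ?V = "skew_vars (2 * t + 1)"
  interpret lowest_basis ?V "2 * t + 1" t "4 * t * t"
    "gen t :: nat \<Rightarrow> (nat \<times> nat, 'a) mpoly" "lead t" "multipliers t"
    by (rule lowest_basis_gen)
  let ?c = "\<lambda>j. if j = 0 then 1 else if j \<le> t then 1 - fps_X else (1 - fps_X) * (1 - fps_X ^ (j - t)) :: int fps"
  have aux: "x * b * y = b" if "x * y = 1" for x y b :: "int fps"
  proof -
    have "x * b * y = b * (x * y)" by (simp only: mult_ac)
    with that show ?thesis by simp
  qed
  have "hilbert_series ?V (pfaffian_ideal (2 * t + 1) t :: (nat \<times> nat, 'a) mpoly set)
      = Abs_fps (\<lambda>m. int (card (standard m)))"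
    unfolding hilbert_series_def pfaffian_ideal_combinations
    by (simp only: hilbert_function_combinations[OF finite_skew_vars assms])
  also have "\<dots> = monomial_series ?V
      - fps_X ^ t * (\<Sum>j<2 * t + 1. Abs_fps (\<lambda>m. int (card {u \<in> monomials ?V m. multipliers t j u})))"
  proof (rule card_standard[OF finite_skew_vars])
    fix j u assume "j < 2 * t + 1"
    then show "\<exists>i<2 * t + 1. \<exists>v. multipliers t i v \<and> lead t j + u = lead t i + v"
      using multipliers_cover[of j t u] by (auto simp: less_Suc_eq_le)
  qed
  also have "\<dots> = monomial_series ?V * (1 - fps_X ^ t * (\<Sum>j<2 * t + 1. ?c j))"
  proof -
    have "(\<Sum>j<2 * t + 1. Abs_fps (\<lambda>m. int (card {u \<in> monomials ?V m. multipliers t j u})))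
        = (\<Sum>j<2 * t + 1. monomial_series ?V * ?c j)"
      by (intro sum.cong refl multipliers_series) simp
    then show ?thesis
      by (simp only: sum_distrib_left[symmetric] right_diff_distrib mult_1_right mult.left_commute)
  qed
  finally have "hilbert_series ?V (pfaffian_ideal (2 * t + 1) t :: (nat \<times> nat, 'a) mpoly set)
      * (1 - fps_X) ^ (t * (2 * t + 1)) = 1 - fps_X ^ t * (\<Sum>j<2 * t + 1. ?c j)"
    using aux[OF monomial_series_power[OF finite_skew_vars[of "2 * t + 1"], unfolded card_skew_vars_odd]]
    by (simp only:)
  moreover have "(\<Sum>j<2 * t + 1. ?c j) = 1 + of_nat t * (1 - fps_X) + (\<Sum>s<t. (1 - fps_X) * (1 - fps_X ^ Suc s))"
  proof -
    have "(\<Sum>j<2 * t + 1. ?c j) = 1 + (\<Sum>j<t + t. ?c (Suc j))"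
      unfolding mult_2 Suc_eq_plus1[symmetric] sum.lessThan_Suc_shift by simp
    also have "\<dots> = 1 + ((\<Sum>j<t. ?c (Suc j)) + (\<Sum>s<t. ?c (Suc (t + s))))"
      unfolding sum_lessThan_add ..
    also have "(\<Sum>j<t. ?c (Suc j)) = of_nat t * (1 - fps_X)" by simp
    also have "(\<Sum>s<t. ?c (Suc (t + s))) = (\<Sum>s<t. (1 - fps_X) * (1 - fps_X ^ Suc s))"
      by (intro sum.cong) auto
    finally show ?thesis by (simp add: add.assoc)
  qed
  \<comment> \<open>Each summand is \<open>(1 - z) - z (1 - z) z^s\<close>, and the second parts
    form a geometric sum.\<close>
  moreover have "(\<Sum>s<t. (1 - fps_X) * (1 - fps_X ^ Suc s)) = of_nat t * (1 - fps_X) - fps_X * (1 - fps_X ^ t :: int fps)"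
  proof -
    have "(\<Sum>s<t. (1 - fps_X) * (1 - fps_X ^ Suc s)) = (\<Sum>s<t. (1 - fps_X) - fps_X * ((1 - fps_X) * fps_X ^ s) :: int fps)"
      by (intro sum.cong refl) (simp add: algebra_simps)
    also have "\<dots> = of_nat t * (1 - fps_X) - fps_X * ((1 - fps_X) * (\<Sum>s<t. fps_X ^ s))"
      by (simp only: sum_subtractf sum_distrib_left sum_constant card_lessThan right_diff_distrib[of "of_nat t"])
    finally show ?thesis unfolding geometric_fps .
  qed
  ultimately have "hilbert_series ?V (pfaffian_ideal (2 * t + 1) t :: (nat \<times> nat, 'a) mpoly set)
      * (1 - fps_X) ^ (t * (2 * t + 1)) = 1 - fps_X ^ t * (1 + of_nat t * (1 - fps_X)
        + (of_nat t * (1 - fps_X) - fps_X * (1 - fps_X ^ t)))"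
    by (simp only:)
  moreover have "1 - y * (1 + c * (1 - x) + (c * (1 - x) - x * (1 - y)))
      = 1 - (2 * c + 1) * y + (2 * c + 1) * (y * x) - y * y * x" for x y c :: "int fps"
    by (simp add: algebra_simps)
  moreover have "fps_X ^ (t + 1) = fps_X ^ t * (fps_X :: int fps)"
    "fps_X ^ (2 * t + 1) = fps_X ^ t * fps_X ^ t * (fps_X :: int fps)"
    "of_nat (2 * t + 1) = 2 * of_nat t + (1 :: int fps)"
    by (simp_all only: mult_2 power_add power_one_right of_nat_add of_nat_1)
  ultimately show ?thesis unfolding hilbert_numerator_def by (simp only:)
qed

section \<open>The h-vector and its generating function\<close>

definition triangular :: "nat \<Rightarrow> int" where
  "triangular k = (\<Sum>i\<le>k. int (Suc i))"

lemma triangular_simps [simp]: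
  "triangular 0 = 1" "triangular (Suc k) = triangular k + int k + 2"
  by (auto simp: triangular_def)

text \<open>\<open>triangular i\<close> is the binomial coefficient of \<open>i + 2\<close> over 2.
  The list climbs to its middle index \<open>t - 1\<close> and returns to 1 at the top index
  \<open>2 * t - 2\<close>.\<close>

definition h_vector :: "nat \<Rightarrow> int list" where
  "h_vector t = map (\<lambda>i. triangular (min i (2 * t - 2 - i))) [0..<2 * t - 1]"

lemma one_minus_X_mult_nth:
  "((1 - fps_X) * f) $ n = f $ n - (if n = 0 then 0 else f $ (n - 1))" for f :: "int fps"
  by (simp add: left_diff_distrib)

text \<open>Multiplication by \<open>1 - z\<close> takes differences. The first are
  \<open>1, ..., t, -t, ..., -1\<close>; the second are 1 up to index \<open>2t\<close>, except for
  \<open>-2t\<close> at index \<open>t\<close>; the third vanish except at \<open>0\<close>,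
  \<open>t\<close>, \<open>t + 1\<close> and \<open>2t + 1\<close>.\<close>

lemma h_vector_series:
  assumes "1 \<le> t"
  shows "(1 - fps_X) ^ 3 * fps_of_poly (Poly (h_vector t)) = hilbert_numerator t"
proof -
  define H where "H = fps_of_poly (Poly (h_vector t))"
  have H: "H $ n = (if n < 2 * t - 1 then triangular (min n (2 * t - 2 - n)) else 0)" for n
    by (simp add: H_def nth_default_def h_vector_def)
  have D1: "((1 - fps_X) * H) $ n = (if n < t then int n + 1 else if n < 2 * t then int n - 2 * int t else 0)" for n
  proof (cases n)
    case 0
    then show ?thesis using assms by (simp add: one_minus_X_mult_nth H)
  next
    case (Suc i)
    consider "n < t" | "t \<le> n" "n < 2 * t - 1" | "n = 2 * t - 1" | "2 * t \<le> n" by linarith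
    then show ?thesis
    proof cases
      case 1
      then have "min n (2 * t - 2 - n) = Suc i" "min i (2 * t - 2 - i) = i" using Suc by auto
      then show ?thesis using 1 Suc by (simp add: one_minus_X_mult_nth H del: One_nat_def)
    next
      case 2
      define k where "k = 2 * t - 2 - n"
      have "min n (2 * t - 2 - n) = k" "min i (2 * t - 2 - i) = Suc k" "int k = 2 * int t - 2 - int n"
        using 2 Suc by (auto simp: k_def)
      then show ?thesis using 2 Suc by (simp add: one_minus_X_mult_nth H del: One_nat_def)
    next
      case 3
      then have "min i (2 * t - 2 - i) = 0" using Suc by auto
      then show ?thesis using 3 Suc assms by (auto simp: one_minus_X_mult_nth H)
    next
      case 4
      then show ?thesis using Suc assms by (auto simp: one_minus_X_mult_nth H)
    qed
  qed
  have D2: "((1 - fps_X) * ((1 - fps_X) * H)) $ n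
      = (if n < t then 1 else if n = t then - 2 * int t else if n \<le> 2 * t then 1 else 0)" for n
    unfolding one_minus_X_mult_nth[of "(1 - fps_X) * H"] D1 using assms by (cases n) auto
  have "((1 - fps_X) ^ 3 * H) $ n = hilbert_numerator t $ n" for n
  proof -
    have "(1 - fps_X) ^ 3 * H = (1 - fps_X) * ((1 - fps_X) * ((1 - fps_X) * H))"
      by (simp add: power3_eq_cube mult.assoc)
    also have "\<dots> $ n = (if n = 0 then 1 else if n = t then - 2 * int t - 1 else if n = t + 1 then 2 * int t + 1
        else if n = 2 * t + 1 then -1 else 0)"
      unfolding one_minus_X_mult_nth[of "(1 - fps_X) * ((1 - fps_X) * H)"] D2 using assms by (cases n) auto
    also have "\<dots> = hilbert_numerator t $ n"
      using assms unfolding hilbert_numerator_def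
      by (auto simp: fps_of_nat[symmetric] fps_mult_left_const_nth simp del: of_nat_Suc of_nat_add of_nat_mult)
    finally show ?thesis .
  qed
  then show ?thesis unfolding H_def by (intro fps_ext)
qed

text \<open>Strict growth up to index \<open>t - 1\<close> and strict descent afterwards: a descent
  at \<open>i\<close> forces \<open>i >= t - 1\<close>, hence descents at all later indices.\<close>

lemma decreasing_type_h_vector: "decreasing_type (h_vector t)"
proof -
  have nth: "h_vector t ! i = triangular (min i (2 * t - 2 - i))" if "i < 2 * t - 1" for i
    using that by (simp add: h_vector_def)
  have less: "h_vector t ! i < h_vector t ! (i + 1)" if "i + 1 < t" for i
  proof -
    have "min i (2 * t - 2 - i) = i" "min (i + 1) (2 * t - 2 - (i + 1)) = Suc i" using that by auto
    then show ?thesis using that by (simp add: nth)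
  qed
  have greater: "h_vector t ! (i + 1) < h_vector t ! i" if "t \<le> i + 1" "i + 1 < 2 * t - 1" for i
  proof -
    define k where "k = 2 * t - 2 - (i + 1)"
    have "min i (2 * t - 2 - i) = Suc k" "min (i + 1) (2 * t - 2 - (i + 1)) = k" using that by (auto simp: k_def)
    then show ?thesis using that by (simp add: nth)
  qed
  have "length (h_vector t) = 2 * t - 1" by (simp add: h_vector_def)
  then show ?thesis
    unfolding decreasing_type_def using less greater by (metis add_lessD1 less_imp_not_less not_le le_trans less_imp_le add_le_mono1)
qed

lemma h_vector_last:
  assumes "1 \<le> t" shows "h_vector t \<noteq> [] \<and> last (h_vector t) \<noteq> 0"
proof -
  obtain s where "t = Suc s" using assms by (cases t) auto
  then show ?thesis by (simp add: h_vector_def)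
qed

section \<open>Krull dimension: upper bound\<close>

definition degree_le :: "nat \<Rightarrow> ('v, 'a::field) mpoly \<Rightarrow> bool" where
  "degree_le m f \<longleftrightarrow> (\<forall>e\<in>Poly_Mapping.keys f. total_degree e \<le> m)"

lemma degree_le_mult: "degree_le m f \<Longrightarrow> degree_le k g \<Longrightarrow> degree_le (m + k) (f * g)"
  unfolding degree_le_def by (auto elim!: mpoly_keys_mult intro!: add_le_mono)

lemma degree_le_one: "degree_le m 1"
  by (simp add: degree_le_def)

lemma degree_le_power: "degree_le e f \<Longrightarrow> degree_le (i * e) (f ^ i)"
  by (induction i) (auto simp: degree_le_one intro: degree_le_mult)

lemma degree_le_mono: "degree_le m f \<Longrightarrow> m \<le> k \<Longrightarrow> degree_le k f"
  unfolding degree_le_def by force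

lemma degree_le_exists: "\<exists>m. degree_le m f"
proof -
  have "degree_le (\<Sum>e\<in>Poly_Mapping.keys f. total_degree e) f"
    unfolding degree_le_def by (auto intro!: member_le_sum)
  then show ?thesis ..
qed

definition indep_mod :: "('v, 'a::field) mpoly set \<Rightarrow> 'i set \<Rightarrow> ('i \<Rightarrow> ('v, 'a) mpoly) \<Rightarrow> bool" where
  "indep_mod P X g \<longleftrightarrow> (\<forall>c. (\<Sum>x\<in>X. mpoly_const (c x) * g x) \<in> P \<longrightarrow> (\<forall>x\<in>X. c x = 0))"

lemma indep_mod_reindex:
  assumes "bij_betw h Y X" "indep_mod P X g" shows "indep_mod P Y (g \<circ> h)"
  unfolding indep_mod_def
proof (intro allI impI ballI)
  fix c y assume c: "(\<Sum>y\<in>Y. mpoly_const (c y) * (g \<circ> h) y) \<in> P" "y \<in> Y"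
  have inv: "inv_into Y h (h y) = y" if "y \<in> Y" for y
    using that assms(1) by (simp add: bij_betw_def inv_into_f_f)
  have "(\<Sum>y\<in>Y. mpoly_const (c y) * (g \<circ> h) y) = (\<Sum>x\<in>X. mpoly_const (c (inv_into Y h x)) * g x)"
    by (subst sum.reindex_bij_betw[OF assms(1), symmetric]) (auto simp: inv intro!: sum.cong)
  with c(1) have "\<forall>x\<in>X. c (inv_into Y h x) = 0"
    using spec[OF assms(2)[unfolded indep_mod_def], of "\<lambda>x. c (inv_into Y h x)"] by simp
  moreover have "h y \<in> X" using bij_betwE[OF assms(1)] c(2) by blast
  ultimately show "c y = 0" using inv[OF c(2)] by fastforce
qed

text \<open>The affine Hilbert function of \<open>P\<close> is O(m^d), phrased through sizes of
  families independent modulo \<open>P\<close>. Index sets are initial segments because a definition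
  cannot quantify over index types; \<open>growth_boundE\<close> passes to other finite
  sets.\<close>

definition growth_bound :: "'v set \<Rightarrow> ('v, 'a::field) mpoly set \<Rightarrow> nat \<Rightarrow> bool" where
  "growth_bound V P d \<longleftrightarrow> (\<exists>C. \<forall>m n g. (\<forall>i<n. g i \<in> carrier (poly_ring V) \<and> degree_le m (g i)) \<longrightarrow>
     indep_mod P {..<n} g \<longrightarrow> n \<le> C * (m + 1) ^ d)"

lemma growth_boundE:
  assumes "growth_bound V P d"
  obtains C where "\<And>m (X :: 'i set) g. finite X \<Longrightarrow> (\<And>x. x \<in> X \<Longrightarrow> g x \<in> carrier (poly_ring V)) \<Longrightarrow>
    (\<And>x. x \<in> X \<Longrightarrow> degree_le m (g x)) \<Longrightarrow> indep_mod P X g \<Longrightarrow> card X \<le> C * (m + 1) ^ d"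
proof -
  from assms obtain C where C: "\<And>m n g. (\<forall>i<n. g i \<in> carrier (poly_ring V) \<and> degree_le m (g i)) \<Longrightarrow>
     indep_mod P {..<n} g \<Longrightarrow> n \<le> C * (m + 1) ^ d" unfolding growth_bound_def by blast
  show ?thesis
  proof (rule that[of C])
    fix m and X :: "'i set" and g
    assume X: "finite X" "\<And>x. x \<in> X \<Longrightarrow> g x \<in> carrier (poly_ring V)"
      "\<And>x. x \<in> X \<Longrightarrow> degree_le m (g x)" "indep_mod P X g"
    obtain h where h: "bij_betw h {..<card X} X"
      using ex_bij_betw_nat_finite[OF X(1)] by (auto simp: atLeast0LessThan)
    have "\<forall>i<card X. (g \<circ> h) i \<in> carrier (poly_ring V) \<and> degree_le m ((g \<circ> h) i)"
      using bij_betwE[OF h] X(2,3) by auto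
    from C[OF this indep_mod_reindex[OF h X(4)]] show "card X \<le> C * (m + 1) ^ d" .
  qed
qed

lemma primeideal_facts:
  fixes P :: "('v, 'a::field) mpoly set"
  assumes "primeideal P (poly_ring V)"
  shows "P \<subseteq> carrier (poly_ring V)" "0 \<in> P" "1 \<notin> P"
    and "\<And>a b. a \<in> P \<Longrightarrow> b \<in> P \<Longrightarrow> a + b \<in> P"
    and "\<And>a. a \<in> P \<Longrightarrow> - a \<in> P"
    and "\<And>a r. a \<in> P \<Longrightarrow> r \<in> carrier (poly_ring V) \<Longrightarrow> r * a \<in> P"
    and "\<And>a b. a \<in> carrier (poly_ring V) \<Longrightarrow> b \<in> carrier (poly_ring V) \<Longrightarrow> a * b \<in> P \<Longrightarrow> a \<in> P \<or> b \<in> P"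
proof -
  interpret P: primeideal P "poly_ring V :: ('v, 'a) mpoly ring" by fact
  show sub: "P \<subseteq> carrier (poly_ring V)" by (rule P.a_subset)
  show "0 \<in> P" using additive_subgroup.zero_closed[OF P.additive_subgroup_axioms] by simp
  show "1 \<notin> P" using P.one_imp_carrier P.I_notcarr by auto
  show "a + b \<in> P" if "a \<in> P" "b \<in> P" for a b
    using additive_subgroup.a_closed[OF P.additive_subgroup_axioms that] by simp
  show "- a \<in> P" if "a \<in> P" for a
    using additive_subgroup.a_inv_closed[OF P.additive_subgroup_axioms that] poly_ring_a_inv[of a V] that sub by auto
  show "r * a \<in> P" if "a \<in> P" "r \<in> carrier (poly_ring V)" for a r
    using P.I_l_closed[OF that] by simp
  show "a \<in> P \<or> b \<in> P" if "a \<in> carrier (poly_ring V)" "b \<in> carrier (poly_ring V)" "a * b \<in> P" for a b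
    using P.I_prime[OF that(1,2)] that(3) by simp
qed

lemma poly_ring_add_closed:
  "f \<in> carrier (poly_ring V) \<Longrightarrow> g \<in> carrier (poly_ring V) \<Longrightarrow> f + g \<in> carrier (poly_ring V)"
  using cring.cring_simprules(1)[OF poly_ring_cring, of f V g] by simp

lemma poly_ring_mult_closed:
  "f \<in> carrier (poly_ring V) \<Longrightarrow> g \<in> carrier (poly_ring V) \<Longrightarrow> f * g \<in> carrier (poly_ring V)"
  using cring.cring_simprules(5)[OF poly_ring_cring, of f V g] by simp

lemma poly_ring_one_closed: "1 \<in> carrier (poly_ring V)"
  by (simp add: carrier_poly_ring_iff)

lemma poly_ring_power_closed: "f \<in> carrier (poly_ring V) \<Longrightarrow> f ^ i \<in> carrier (poly_ring V)"
  by (induction i) (auto intro: poly_ring_mult_closed poly_ring_one_closed)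

lemma poly_ring_sum_closed:
  "(\<And>x. x \<in> X \<Longrightarrow> f x \<in> carrier (poly_ring V)) \<Longrightarrow> sum f X \<in> carrier (poly_ring V)"
proof (induction X rule: infinite_finite_induct)
  case (insert x X)
  then show ?case by (simp add: poly_ring_add_closed)
qed (auto simp: carrier_poly_ring_iff)

text \<open>
  A family that is independent modulo \<open>Q\<close> can be multiplied by the powers of an element \<open>f\<close> of
  \<open>Q - P\<close> and stays independent modulo \<open>P\<close>; this lowers the growth exponent by one from \<open>P\<close> to \<open>Q\<close>.
\<close>

lemma indep_mod_powers:
  fixes P Q :: "('v, 'a::field) mpoly set" and g :: "'i \<Rightarrow> ('v, 'a) mpoly"
  assumes P: "primeideal P (poly_ring V)" and Q: "primeideal Q (poly_ring V)"
    and sub: "P \<subseteq> Q" and f: "f \<in> Q" "f \<notin> P"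
    and g: "\<And>x. x \<in> X \<Longrightarrow> g x \<in> carrier (poly_ring V)" and X: "finite X" "indep_mod Q X g"
  shows "indep_mod P ({..k} \<times> X) (\<lambda>(i, x). f ^ i * g x)"
proof -
  note PF = primeideal_facts[OF P] and QF = primeideal_facts[OF Q]
  have fR: "f \<in> carrier (poly_ring V)" using f(1) QF(1) by blast
  have main: "\<forall>i\<le>k. \<forall>x\<in>X. c i x = 0"
    if "(\<Sum>i\<le>k. f ^ i * (\<Sum>x\<in>X. mpoly_const (c i x) * g x)) \<in> P" for c :: "nat \<Rightarrow> 'i \<Rightarrow> 'a"
    using that
  proof (induction k arbitrary: c)
    case 0
    then have "(\<Sum>x\<in>X. mpoly_const (c 0 x) * g x) \<in> Q" using sub by auto
    with X(2) show ?case by (auto simp: indep_mod_def)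
  next
    case (Suc k)
    define s where "s i = (\<Sum>x\<in>X. mpoly_const (c i x) * g x)" for i
    define r where "r = (\<Sum>i\<le>k. f ^ i * s (Suc i))"
    have sR: "s i \<in> carrier (poly_ring V)" for i
      unfolding s_def by (intro poly_ring_sum_closed poly_ring_mult_closed mpoly_const_in_carrier g)
    have rR: "r \<in> carrier (poly_ring V)"
      unfolding r_def by (intro poly_ring_sum_closed poly_ring_mult_closed poly_ring_power_closed sR fR)
    have eq: "(\<Sum>i\<le>Suc k. f ^ i * s i) = s 0 + f * r"
      unfolding sum.atMost_Suc_shift r_def by (simp add: sum_distrib_left mult.assoc)
    with Suc.prems have in_P: "s 0 + f * r \<in> P" by (simp only: s_def)
    \<comment> \<open>Modulo \<open>Q\<close> only the summand without \<open>f\<close> survives.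
      Once its coefficients are zero, primality of \<open>P\<close> cancels one factor
      \<open>f\<close> from the rest.\<close>
    have "f * r \<in> Q" using QF(6)[OF f(1) rR] by (simp add: mult.commute)
    then have "(s 0 + f * r) + - (f * r) \<in> Q" using in_P sub QF(4,5) by blast
    then have "s 0 \<in> Q" by simp
    with X(2) have c0: "\<forall>x\<in>X. c 0 x = 0" by (auto simp: indep_mod_def s_def)
    then have "s 0 = 0" by (simp add: s_def)
    with in_P have "f * r \<in> P" by simp
    with PF(7)[OF fR rR] f(2) have "r \<in> P" by blast
    then have "\<forall>i\<le>k. \<forall>x\<in>X. c (Suc i) x = 0"
      by (intro Suc.IH) (simp add: r_def s_def)
    with c0 show ?case by (metis Suc_le_mono not0_implies_Suc)
  qed
  show ?thesis
    unfolding indep_mod_def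
  proof (intro allI impI ballI)
    fix c z assume c: "(\<Sum>z\<in>{..k} \<times> X. mpoly_const (c z) * (case z of (i, x) \<Rightarrow> f ^ i * g x)) \<in> P"
      "z \<in> {..k} \<times> X"
    have "(\<Sum>z\<in>{..k} \<times> X. mpoly_const (c z) * (case z of (i, x) \<Rightarrow> f ^ i * g x))
        = (\<Sum>i\<le>k. f ^ i * (\<Sum>x\<in>X. mpoly_const (c (i, x)) * g x))"
      by (simp add: sum.cartesian_product[symmetric] sum_distrib_left case_prod_unfold mult.left_commute
          sum.cartesian_product')
    with main[of "\<lambda>i x. c (i, x)"] c show "c z = 0" by auto
  qed
qed

lemma growth_bound_drop:
  fixes P Q :: "('v, 'a::field) mpoly set"
  assumes P: "primeideal P (poly_ring V)" and Q: "primeideal Q (poly_ring V)"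
    and sub: "P \<subset> Q" and bound: "growth_bound V P d"
  shows "1 \<le> d \<and> growth_bound V Q (d - 1)"
proof -
  from sub obtain f where f: "f \<in> Q" "f \<notin> P" by blast
  note QF = primeideal_facts[OF Q]
  have fR: "f \<in> carrier (poly_ring V)" using f(1) QF(1) by blast
  obtain e where e: "degree_le e f" using degree_le_exists by blast
  from growth_boundE[OF bound, where ?'i = "nat \<times> nat"] obtain C where C:
    "\<And>m (X :: (nat \<times> nat) set) g. finite X \<Longrightarrow> (\<And>x. x \<in> X \<Longrightarrow> g x \<in> carrier (poly_ring V)) \<Longrightarrow>
    (\<And>x. x \<in> X \<Longrightarrow> degree_le m (g x)) \<Longrightarrow> indep_mod P X g \<Longrightarrow> card X \<le> C * (m + 1) ^ d" by metis
  have key: "(k + 1) * n \<le> C * (k * e + m + 1) ^ d"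
    if g: "\<And>i. i < n \<Longrightarrow> g i \<in> carrier (poly_ring V)" "\<And>i. i < n \<Longrightarrow> degree_le m (g i)"
      "indep_mod Q {..<n} g" for k n m :: nat and g :: "nat \<Rightarrow> ('v, 'a) mpoly"
  proof -
    have "card ({..k} \<times> {..<n}) \<le> C * ((k * e + m) + 1) ^ d"
    proof (rule C)
      show "indep_mod P ({..k} \<times> {..<n}) (\<lambda>(i, x). f ^ i * g x)"
        by (rule indep_mod_powers[OF P Q _ f]) (use sub g in auto)
      fix z assume "z \<in> {..k} \<times> {..<n}"
      then obtain i x where z: "z = (i, x)" "i \<le> k" "x < n" by auto
      then show "(case z of (i, x) \<Rightarrow> f ^ i * g x) \<in> carrier (poly_ring V)"
        using g(1) fR by (auto intro!: poly_ring_mult_closed poly_ring_power_closed)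
      have "degree_le (i * e + m) (f ^ i * g x)" using degree_le_power[OF e] g(2) z(3) by (intro degree_le_mult)
      then show "degree_le (k * e + m) (case z of (i, x) \<Rightarrow> f ^ i * g x)"
        unfolding z(1) prod.case by (rule degree_le_mono) (use z(2) in simp)
    qed simp
    then show ?thesis by (simp add: card_cartesian_product algebra_simps)
  qed
  have d: "1 \<le> d"
  proof (rule ccontr)
    assume "\<not> 1 \<le> d"
    then have "d = 0" by simp
    have "indep_mod Q {..<1::nat} (\<lambda>_. 1)"
      unfolding indep_mod_def
    proof (intro allI impI)
      fix c :: "nat \<Rightarrow> 'a" assume "(\<Sum>x<1. mpoly_const (c x) * 1) \<in> Q"
      then have c: "mpoly_const (c 0) \<in> Q" by simp
      have "c 0 = 0"
      proof (rule ccontr)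
        assume "c 0 \<noteq> 0"
        then have "mpoly_const (inverse (c 0)) * mpoly_const (c 0) = (1 :: ('v, 'a) mpoly)"
          by (simp flip: mpoly_const_mult)
        with QF(6)[OF c mpoly_const_in_carrier[of "inverse (c 0)"]] QF(3) show False by simp
      qed
      then show "\<forall>x\<in>{..<1}. c x = 0" by simp
    qed
    \<comment> \<open>With exponent 0 the bound would be the constant \<open>C\<close>, but the
      powers of \<open>f\<close> up to the \<open>C\<close>-th form an independent family of
      \<open>C + 1\<close> elements.\<close>
    from key[of 1 "\<lambda>_. 1" 0 C, OF _ _ this] show False
      by (simp add: \<open>d = 0\<close> degree_le_one poly_ring_one_closed)
  qed
  moreover have "growth_bound V Q (d - 1)"
    unfolding growth_bound_def
  proof (intro exI allI impI)
    fix m n :: nat and g :: "nat \<Rightarrow> ('v, 'a) mpoly"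
    assume g: "\<forall>i<n. g i \<in> carrier (poly_ring V) \<and> degree_le m (g i)" "indep_mod Q {..<n} g"
    \<comment> \<open>Powers up to \<open>k = m\<close>: the degree grows only by the constant
      factor \<open>e + 1\<close>, the family by the factor \<open>m + 1\<close>, which is then
      divided out.\<close>
    have "(m + 1) * n \<le> C * (m * e + m + 1) ^ d" using key[of n g m m] g by simp
    also have "\<dots> \<le> C * ((e + 1) * (m + 1)) ^ d"
      by (intro mult_le_mono2 power_mono) auto
    also have "\<dots> = (m + 1) * (C * (e + 1) ^ d * (m + 1) ^ (d - 1))"
      using d by (cases d) (simp_all only: power_mult_distrib power_Suc diff_Suc_1 mult_ac)
    finally show "n \<le> (C * (e + 1) ^ d) * (m + 1) ^ (d - 1)" by (rule mult_left_le_imp_le) simp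
  qed
  ultimately show ?thesis by simp
qed

lemma prime_chain_length:
  assumes "\<And>i. i \<le> n \<Longrightarrow> primeideal (P i) (poly_ring V)" "\<And>i. i < n \<Longrightarrow> P i \<subset> P (Suc i)"
    and "growth_bound V (P 0) d"
  shows "n \<le> d"
proof -
  have "i \<le> d \<and> growth_bound V (P i) (d - i)" if "i \<le> n" for i
    using that
  proof (induction i)
    case (Suc i)
    then have "growth_bound V (P i) (d - i)" "i \<le> d" by auto
    with growth_bound_drop[OF assms(1)[of i] assms(1)[of "Suc i"] assms(2)[of i], of "d - i"] Suc.prems
    show ?case by auto
  qed (use assms(3) in simp)
  then show ?thesis by blast
qed

lemma growth_bound_mono:
  assumes "growth_bound V P d" "P \<subseteq> Q" shows "growth_bound V Q d"
proof -
  have "indep_mod P X g" if "indep_mod Q X g" for X :: "nat set" and g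
    using that assms(2) unfolding indep_mod_def by blast
  with assms(1) show ?thesis unfolding growth_bound_def by metis
qed

text \<open>Primes of the quotient pull back to primes above \<open>I\<close>, still strictly
  increasing since the projection is onto; the bound for \<open>I\<close> passes to the larger first
  prime.\<close>

lemma krull_dim_le:
  fixes I :: "('v, 'a::field) mpoly set"
  assumes I: "ideal I (poly_ring V)" and bound: "growth_bound V I d"
  shows "krull_dim (poly_ring V Quot I) \<le> enat d"
  unfolding krull_dim_def
proof (rule SUP_least, clarify)
  let ?R = "poly_ring V :: ('v, 'a) mpoly ring"
  let ?h = "\<lambda>f. I +>\<^bsub>?R\<^esub> f"
  interpret I: ideal I ?R by fact
  interpret h: ring_hom_ring ?R "?R Quot I" ?h by (rule I.rcos_ring_hom_ring)
  fix n P assume P: "\<forall>i\<le>n. primeideal (P i) (?R Quot I)" "\<forall>i<n. P i \<subset> P (Suc i)"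
  let ?P = "\<lambda>i. {r \<in> carrier ?R. ?h r \<in> P i}"
  have prime: "primeideal (?P i) ?R" if "i \<le> n" for i
    using P(1) that by (intro h.primeideal_vimage poly_ring_cring) auto
  moreover have "?P i \<subset> ?P (Suc i)" if i: "i < n" for i
  proof -
    obtain x where x: "x \<in> P (Suc i)" "x \<notin> P i" using P(2) i by blast
    interpret PS: primeideal "P (Suc i)" "?R Quot I" using P(1) i by simp
    have "x \<in> carrier (?R Quot I)" using x(1) PS.a_subset by blast
    then obtain r where "r \<in> carrier ?R" "x = ?h r" by (auto simp: FactRing_def A_RCOSETS_def')
    with x P(2) i show ?thesis by blast
  qed
  moreover have "growth_bound V (?P 0) d"
  proof (rule growth_bound_mono[OF bound], rule subsetI)
    fix x assume "x \<in> I"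
    then have "x \<in> carrier ?R" using I.a_subset by blast
    moreover have "?h x = ?h 0" using coset_eq_iff[OF I, of x 0] \<open>x \<in> I\<close> by simp
    moreover have "?h 0 = \<zero>\<^bsub>?R Quot I\<^esub>" using h.hom_zero by simp
    moreover have "\<zero>\<^bsub>?R Quot I\<^esub> \<in> P 0"
    proof -
      interpret P0: primeideal "P 0" "?R Quot I" using P(1) by simp
      show ?thesis by (rule additive_subgroup.zero_closed[OF P0.additive_subgroup_axioms])
    qed
    ultimately show "x \<in> ?P 0" by simp
  qed
  ultimately have "n \<le> d" by (intro prime_chain_length[of n ?P]) auto
  then show "enat n \<le> enat d" by simp
qed

text \<open>Division by \<open>1 - z\<close> is partial summation and raises the growth exponent by
  at most one. In the base case the partial sums of the coefficients of \<open>p\<close> are bounded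
  by the sum of their absolute values.\<close>

lemma fps_growth:
  fixes g :: "int fps"
  assumes "(1 - fps_X) ^ Suc d * g = fps_of_poly p"
  shows "\<exists>C\<ge>0. \<forall>m. \<bar>fps_nth g m\<bar> \<le> C * (int m + 1) ^ d"
  using assms
proof (induction d arbitrary: g)
  case 0
  let ?C = "\<Sum>i\<le>Polynomial.degree p. \<bar>poly.coeff p i\<bar>"
  have nth: "fps_nth g n - (if n = 0 then 0 else fps_nth g (n - 1)) = poly.coeff p n" for n
    using arg_cong[OF 0, of "\<lambda>f. fps_nth f n"] one_minus_X_mult_nth[of g n] by simp
  have "fps_nth g m = (\<Sum>i\<le>m. poly.coeff p i)" for m
  proof (induction m)
    case 0
    then show ?case using nth[of 0] by simp
  next
    case (Suc m)
    then show ?case using nth[of "Suc m"] by simp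
  qed
  moreover have "\<bar>\<Sum>i\<le>m. poly.coeff p i\<bar> \<le> ?C" for m
  proof -
    have "\<bar>\<Sum>i\<le>m. poly.coeff p i\<bar> \<le> (\<Sum>i\<le>m. \<bar>poly.coeff p i\<bar>)" by (rule sum_abs)
    also have "\<dots> \<le> (\<Sum>i\<le>m + Polynomial.degree p. \<bar>poly.coeff p i\<bar>)" by (rule sum_mono2) auto
    also have "\<dots> = ?C" by (rule sum.mono_neutral_right) (auto simp: coeff_eq_0)
    finally show ?thesis .
  qed
  moreover have "0 \<le> ?C" by (rule sum_nonneg) simp
  ultimately show ?case by (intro exI[of _ ?C]) simp
next
  case (Suc d)
  have "(1 - fps_X) ^ Suc d * ((1 - fps_X) * g) = fps_of_poly p"
    using Suc.prems by (simp add: mult_ac)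
  from Suc.IH[OF this] obtain C where C: "C \<ge> 0"
    "\<And>m. \<bar>fps_nth ((1 - fps_X) * g) m\<bar> \<le> C * (int m + 1) ^ d" by blast
  have "\<bar>fps_nth g m\<bar> \<le> C * (int m + 1) ^ Suc d" for m
  proof (induction m)
    case 0
    then show ?case using C(2)[of 0] by (simp add: one_minus_X_mult_nth)
  next
    case (Suc m)
    have "fps_nth g (Suc m) = fps_nth ((1 - fps_X) * g) (Suc m) + fps_nth g m"
      by (simp add: one_minus_X_mult_nth)
    then have "\<bar>fps_nth g (Suc m)\<bar> \<le> C * (int (Suc m) + 1) ^ d + C * (int m + 1) ^ Suc d"
      using C(2)[of "Suc m"] Suc.IH by linarith
    also have "C * (int m + 1) ^ Suc d \<le> C * ((int m + 1) * (int (Suc m) + 1) ^ d)"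
      using C(1) by (intro mult_left_mono) (auto intro!: mult_left_mono power_mono)
    finally show ?case by (simp add: algebra_simps)
  qed
  with C(1) show ?case by blast
qed

lemma vector_space_mpoly: "vector_space (\<lambda>c (f :: ('v, 'a::field) mpoly). mpoly_const c * f)"
  by unfold_locales (auto simp: algebra_simps mpoly_const_add mpoly_const_mult)

lemma indep_card_le:
  fixes r :: "nat \<Rightarrow> ('v, 'a::field) mpoly"
  assumes "finite A" "\<And>i. i < n \<Longrightarrow> Poly_Mapping.keys (r i) \<subseteq> A"
    and "\<And>c. (\<Sum>i<n. mpoly_const (c i) * r i) = 0 \<Longrightarrow> \<forall>i<n. c i = 0"
  shows "n \<le> card A"
proof -
  interpret vs: vector_space "\<lambda>c (f :: ('v, 'a) mpoly). mpoly_const c * f"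
    by (rule vector_space_mpoly)
  have inj: "inj_on r {..<n}"
  proof (rule inj_onI, rule ccontr)
    fix i j assume ij: "i \<in> {..<n}" "j \<in> {..<n}" "r i = r j" "i \<noteq> j"
    define c :: "nat \<Rightarrow> 'a" where "c k = (if k = i then 1 else if k = j then -1 else 0)" for k
    have "(\<Sum>k<n. mpoly_const (c k) * r k) = (\<Sum>k<n. (if k = i then r i else 0) + (if k = j then - r j else 0))"
      using ij(4) by (intro sum.cong) (auto simp: c_def mpoly_const_uminus)
    also have "\<dots> = 0" using ij by (simp add: sum.distrib)
    finally have "c i = 0" using assms(3) ij(1) by blast
    then show False by (simp add: c_def)
  qed
  have "vs.independent (r ` {..<n})"
  proof
    assume "vs.dependent (r ` {..<n})"
    then obtain u v where uv: "v \<in> r ` {..<n}" "u v \<noteq> 0" "(\<Sum>v\<in>r ` {..<n}. mpoly_const (u v) * v) = 0"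
      by (auto simp: vs.dependent_finite)
    from uv(3) have "(\<Sum>i<n. mpoly_const (u (r i)) * r i) = 0" by (simp add: sum.reindex[OF inj])
    then have "\<forall>i<n. u (r i) = 0" by (rule assms(3))
    with uv(1,2) show False by auto
  qed
  moreover have "r ` {..<n} \<subseteq> vs.span (monom_of ` A)"
  proof
    fix f assume "f \<in> r ` {..<n}"
    then obtain i where "i < n" "f = r i" by auto
    then have "f = (\<Sum>e\<in>Poly_Mapping.keys f. mpoly_const (coef f e) * monom_of e)" "Poly_Mapping.keys f \<subseteq> A"
      using poly_mapping_sum_single[of f] assms(2) by (auto simp: mpoly_const_def mult_single)
    then show "f \<in> vs.span (monom_of ` A)"
      by (metis (no_types, lifting) image_eqI subsetD vs.span_base vs.span_scale vs.span_sum)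
  qed
  ultimately have "card (r ` {..<n}) \<le> card (monom_of ` A :: ('v, 'a) mpoly set)"
    using vs.independent_span_bound[OF finite_imageI[OF assms(1)]] by blast
  also have "\<dots> \<le> card A" by (rule card_image_le[OF assms(1)])
  finally show ?thesis by (simp add: card_image[OF inj])
qed

context lowest_basis
begin

lemma reducible_degree_le:
  assumes "f \<in> carrier (poly_ring V)" "degree_le m f"
  shows "\<exists>r. Poly_Mapping.keys r \<subseteq> (\<Union>k\<le>m. standard k) \<and> f - r \<in> combinations"
proof -
  have "\<exists>r. Poly_Mapping.keys r \<subseteq> standard (total_degree e) \<and>
      mpoly_const (coef f e) * monom_of e - r \<in> combinations" if "e \<in> Poly_Mapping.keys f" for e
  proof -
    have "e \<in> monomials V (total_degree e)"
      using that assms(1) by (auto simp: monomials_def carrier_poly_ring_iff)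
    from reducible_const_mult[OF reducible_monom[OF this]] show ?thesis by (simp add: reducible_def)
  qed
  then obtain r where r: "\<And>e. e \<in> Poly_Mapping.keys f \<Longrightarrow> Poly_Mapping.keys (r e) \<subseteq> standard (total_degree e)"
    "\<And>e. e \<in> Poly_Mapping.keys f \<Longrightarrow> mpoly_const (coef f e) * monom_of e - r e \<in> combinations" by metis
  have "f = (\<Sum>e\<in>Poly_Mapping.keys f. mpoly_const (coef f e) * monom_of e)"
    using poly_mapping_sum_single[of f] by (simp add: mpoly_const_def mult_single)
  then have "f - (\<Sum>e\<in>Poly_Mapping.keys f. r e)
      = (\<Sum>e\<in>Poly_Mapping.keys f. mpoly_const (coef f e) * monom_of e - r e)"
    by (simp add: sum_subtractf)
  moreover have "(\<Sum>e\<in>E. mpoly_const (coef f e) * monom_of e - r e) \<in> combinations"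
    if "E \<subseteq> Poly_Mapping.keys f" for E
    using finite_subset[OF that finite_keys] that r(2)
    by (induction E rule: finite_induct) (auto intro: combinations_zero combinations_add)
  moreover have "Poly_Mapping.keys (\<Sum>e\<in>Poly_Mapping.keys f. r e) \<subseteq> (\<Union>k\<le>m. standard k)"
    using keys_sum_subset[of r "Poly_Mapping.keys f"] r(1) assms(2) unfolding degree_le_def by blast
  ultimately show ?thesis
    by (intro exI[of _ "\<Sum>e\<in>Poly_Mapping.keys f. r e"] conjI) (simp_all only: order_refl)
qed

text \<open>Polynomials of degree at most \<open>m\<close> reduce to combinations of standard
  monomials of degree at most \<open>m\<close>, whose number bounds independent families. That
  number is a partial sum of the Hilbert function, which costs one more division by
  \<open>1 - z\<close>.\<close>

lemma growth_bound_combinations: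
  assumes "finite V" and "Abs_fps (\<lambda>m. int (card (standard m))) * (1 - fps_X) ^ d = fps_of_poly q"
  shows "growth_bound V combinations d"
proof -
  define G where "G = Abs_fps (\<lambda>m. int (\<Sum>k\<le>m. card (standard k)))"
  have "(1 - fps_X) * G = Abs_fps (\<lambda>m. int (card (standard m)))"
  proof (rule fps_ext)
    fix m show "fps_nth ((1 - fps_X) * G) m = fps_nth (Abs_fps (\<lambda>m. int (card (standard m)))) m"
      by (cases m) (simp_all add: one_minus_X_mult_nth G_def)
  qed
  moreover have "(1 - fps_X) ^ Suc d * G = ((1 - fps_X) * G) * (1 - fps_X) ^ d"
    by (simp only: power_Suc mult_ac)
  ultimately have "(1 - fps_X) ^ Suc d * G = fps_of_poly q"
    using assms(2) by simp
  from fps_growth[OF this] obtain C where C: "C \<ge> 0" "\<And>m. \<bar>fps_nth G m\<bar> \<le> C * (int m + 1) ^ d"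
    by blast
  have sum_le: "int (\<Sum>k\<le>m. card (standard k)) \<le> C * (int m + 1) ^ d" for m
    using C(2)[of m] unfolding G_def fps_nth_Abs_fps by linarith
  have "n \<le> nat C * (m + 1) ^ d"
    if g: "\<forall>i<n. g i \<in> carrier (poly_ring V) \<and> degree_le m (g i)" "indep_mod combinations {..<n} g" for m n g
  proof -
    have "\<forall>i<n. \<exists>r. Poly_Mapping.keys r \<subseteq> (\<Union>k\<le>m. standard k) \<and> g i - r \<in> combinations"
      using g(1) reducible_degree_le by blast
    then obtain r where r: "\<And>i. i < n \<Longrightarrow> Poly_Mapping.keys (r i) \<subseteq> (\<Union>k\<le>m. standard k)"
      "\<And>i. i < n \<Longrightarrow> g i - r i \<in> combinations" by metis
    have "n \<le> card (\<Union>k\<le>m. standard k)"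
    proof (rule indep_card_le)
      show "finite (\<Union>k\<le>m. standard k)"
        using finite_monomials[OF assms(1)] by (auto simp: standard_def)
      fix c assume c: "(\<Sum>i<n. mpoly_const (c i) * r i) = 0"
      have "(\<Sum>i<k. mpoly_const (c i) * (g i - r i)) \<in> combinations" if "k \<le> n" for k
        using that
      proof (induction k)
        case (Suc k)
        then show ?case
          using combinations_add combinations_mult[OF r(2) const_carrier, of k "c k"] by simp
      qed (simp add: combinations_zero)
      from this[OF order_refl] have "(\<Sum>i<n. mpoly_const (c i) * g i) \<in> combinations"
        by (simp add: right_diff_distrib sum_subtractf c)
      with g(2) show "\<forall>i<n. c i = 0" by (auto simp: indep_mod_def)
    qed (use r(1) in auto)
    also have "\<dots> \<le> (\<Sum>k\<le>m. card (standard k))" by (rule card_UN_le) simp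
    finally have "int n \<le> C * (int m + 1) ^ d" using sum_le[of m] by linarith
    also have "\<dots> = int (nat C * (m + 1) ^ d)" using C(1) by (simp add: add.commute)
    finally show ?thesis by linarith
  qed
  then show ?thesis unfolding growth_bound_def by blast
qed

end

section \<open>Krull dimension: lower bound\<close>

lemma quotient_prime:
  fixes I P :: "('v, 'a::field) mpoly set"
  assumes I: "ideal I (poly_ring V)" and P: "primeideal P (poly_ring V)" and sub: "I \<subseteq> P"
  shows "primeideal ((\<lambda>f. I +>\<^bsub>poly_ring V\<^esub> f) ` P) (poly_ring V Quot I)"
proof -
  let ?R = "poly_ring V :: ('v, 'a) mpoly ring" and ?h = "\<lambda>f. I +>\<^bsub>poly_ring V\<^esub> f"
  interpret R: cring ?R by (rule poly_ring_cring)
  interpret I: ideal I ?R by fact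
  interpret P: primeideal P ?R by fact
  interpret h: ring_hom_ring ?R "?R Quot I" ?h by (rule I.rcos_ring_hom_ring)
  note PF = primeideal_facts[OF P]
  have mem: "f \<in> P" if "?h f \<in> ?h ` P" for f
  proof -
    from that obtain g where "g \<in> P" "f - g \<in> I" by (auto simp: coset_eq_iff[OF I])
    then have "(f - g) + g \<in> P" using sub PF(4) by blast
    then show ?thesis by simp
  qed
  show ?thesis
  proof (rule primeidealI)
    show "ideal (?h ` P) (?R Quot I)" by (rule R.ring_ideal_imp_quot_ideal[OF I P.ideal_axioms])
    show "cring (?R Quot I)" by (rule I.quotient_is_cring[OF poly_ring_cring])
    show "carrier (?R Quot I) \<noteq> ?h ` P"
    proof
      assume "carrier (?R Quot I) = ?h ` P"
      then have "?h 1 \<in> ?h ` P" using h.hom_closed[of 1] by (simp add: poly_ring_one_closed)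
      with mem PF(3) show False by blast
    qed
    fix a b assume ab: "a \<in> carrier (?R Quot I)" "b \<in> carrier (?R Quot I)" "a \<otimes>\<^bsub>?R Quot I\<^esub> b \<in> ?h ` P"
    then obtain f g where fg: "f \<in> carrier ?R" "g \<in> carrier ?R" "a = ?h f" "b = ?h g"
      by (auto simp: FactRing_def A_RCOSETS_def')
    with h.hom_mult[OF fg(1,2)] ab(3) have "?h (f * g) \<in> ?h ` P" by simp
    with mem have "f * g \<in> P" by blast
    with PF(7)[OF fg(1,2)] fg show "a \<in> ?h ` P \<or> b \<in> ?h ` P" by blast
  qed
qed

lemma krull_dim_ge:
  fixes I :: "('v, 'a::field) mpoly set"
  assumes I: "ideal I (poly_ring V)"
    and P: "\<And>i. i \<le> n \<Longrightarrow> primeideal (P i) (poly_ring V)" "\<And>i. i \<le> n \<Longrightarrow> I \<subseteq> P i"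
    and chain: "\<And>i. i < n \<Longrightarrow> P i \<subset> P (Suc i)"
  shows "enat n \<le> krull_dim (poly_ring V Quot I)"
  unfolding krull_dim_def
proof (rule SUP_upper, intro CollectI exI conjI allI impI)
  let ?h = "\<lambda>f. I +>\<^bsub>poly_ring V\<^esub> f"
  show "primeideal (?h ` P i) (poly_ring V Quot I)" if "i \<le> n" for i
    by (rule quotient_prime[OF I P[OF that]])
  show "?h ` P i \<subset> ?h ` P (Suc i)" if i: "i < n" for i
  proof
    show "?h ` P i \<subseteq> ?h ` P (Suc i)" using chain[OF i] by blast
    obtain f where f: "f \<in> P (Suc i)" "f \<notin> P i" using chain[OF i] by blast
    have "?h f \<notin> ?h ` P i"
    proof
      assume "?h f \<in> ?h ` P i"
      then obtain g where g: "g \<in> P i" "f - g \<in> I" by (auto simp: coset_eq_iff[OF I])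
      have "primeideal (P i) (poly_ring V)" "f - g \<in> P i" using P(1,2)[of i] g(2) i by auto
      from primeideal_facts(4)[OF this g(1)] f show False by simp
    qed
    with f(1) show "?h ` P i \<noteq> ?h ` P (Suc i)" by blast
  qed
qed

section \<open>Substitution homomorphisms\<close>

definition monom_subst :: "('v \<Rightarrow> ('w, 'a::field) mpoly) \<Rightarrow> ('v \<Rightarrow>\<^sub>0 nat) \<Rightarrow> ('w, 'a) mpoly" where
  "monom_subst \<sigma> e = (\<Prod>v\<in>Poly_Mapping.keys e. \<sigma> v ^ Poly_Mapping.lookup e v)"

definition subst :: "('v \<Rightarrow> ('w, 'a::field) mpoly) \<Rightarrow> ('v, 'a) mpoly \<Rightarrow> ('w, 'a) mpoly" where
  "subst \<sigma> f = (\<Sum>e\<in>Poly_Mapping.keys f. mpoly_const (coef f e) * monom_subst \<sigma> e)"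

lemma monom_subst_superset:
  assumes "finite W" "Poly_Mapping.keys e \<subseteq> W"
  shows "monom_subst \<sigma> e = (\<Prod>v\<in>W. \<sigma> v ^ Poly_Mapping.lookup e v)"
  unfolding monom_subst_def by (rule prod.mono_neutral_left) (use assms in \<open>auto simp: in_keys_iff\<close>)

lemma monom_subst_add: "monom_subst \<sigma> (e + u) = monom_subst \<sigma> e * monom_subst \<sigma> u"
proof -
  let ?W = "Poly_Mapping.keys e \<union> Poly_Mapping.keys u"
  have "finite ?W" by simp
  then show ?thesis
    using monom_subst_superset[of ?W e \<sigma>] monom_subst_superset[of ?W u \<sigma>]
      monom_subst_superset[of ?W "e + u" \<sigma>]
    by (simp add: keys_add_nat lookup_add power_add prod.distrib)
qed

lemma subst_superset:
  assumes "finite E" "Poly_Mapping.keys f \<subseteq> E"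
  shows "subst \<sigma> f = (\<Sum>e\<in>E. mpoly_const (coef f e) * monom_subst \<sigma> e)"
  unfolding subst_def by (rule sum.mono_neutral_left) (use assms in \<open>auto simp: in_keys_iff\<close>)

lemma subst_zero [simp]: "subst \<sigma> 0 = 0"
  by (simp add: subst_def)

lemma subst_add: "subst \<sigma> (f + g) = subst \<sigma> f + subst \<sigma> g"
proof -
  let ?E = "Poly_Mapping.keys f \<union> Poly_Mapping.keys g"
  have "finite ?E" by simp
  then show ?thesis
    using subst_superset[of ?E f \<sigma>] subst_superset[of ?E g \<sigma>] subst_superset[of ?E "f + g" \<sigma>]
      Poly_Mapping.keys_add[of f g]
    by (simp add: lookup_add mpoly_const_add sum.distrib distrib_right)
qed

lemma subst_sum: "subst \<sigma> (sum f A) = (\<Sum>a\<in>A. subst \<sigma> (f a))"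
  by (induction A rule: infinite_finite_induct) (auto simp: subst_add)

lemma subst_single: "subst \<sigma> (Poly_Mapping.single e c) = mpoly_const c * monom_subst \<sigma> e"
  by (cases "c = 0") (auto simp: subst_def)

lemma subst_mult: "subst \<sigma> (f * g) = subst \<sigma> f * subst \<sigma> g"
proof -
  have "f * g = (\<Sum>e\<in>Poly_Mapping.keys f. Poly_Mapping.single e (coef f e)) *
      (\<Sum>u\<in>Poly_Mapping.keys g. Poly_Mapping.single u (coef g u))"
    using poly_mapping_sum_single[of f] poly_mapping_sum_single[of g] by simp
  also have "\<dots> = (\<Sum>e\<in>Poly_Mapping.keys f. \<Sum>u\<in>Poly_Mapping.keys g.
      Poly_Mapping.single (e + u) (coef f e * coef g u))"
    by (simp add: sum_product mult_single)
  finally have "subst \<sigma> (f * g) = (\<Sum>e\<in>Poly_Mapping.keys f. \<Sum>u\<in>Poly_Mapping.keys g.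
      (mpoly_const (coef f e) * monom_subst \<sigma> e) * (mpoly_const (coef g u) * monom_subst \<sigma> u))"
    by (simp add: subst_sum subst_single mpoly_const_mult monom_subst_add mult_ac)
  then show ?thesis by (simp add: subst_def sum_product)
qed

lemma subst_const [simp]: "subst \<sigma> (mpoly_const c) = mpoly_const c"
  by (simp add: mpoly_const_def[of c] subst_single monom_subst_def)

lemma subst_one [simp]: "subst \<sigma> 1 = 1"
  using subst_const[of \<sigma> 1] by simp

lemma subst_uminus: "subst \<sigma> (- f) = - subst \<sigma> f"
  using subst_add[of \<sigma> f "- f"] by (simp add: eq_neg_iff_add_eq_0 add.commute)

lemma subst_diff: "subst \<sigma> (f - g) = subst \<sigma> f - subst \<sigma> g"
  using subst_add[of \<sigma> f "- g"] by (simp add: subst_uminus)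

lemma subst_var [simp]: "subst \<sigma> (mpoly_var v) = \<sigma> v"
  by (simp add: mpoly_var_def subst_single monom_subst_def)

lemma subst_power: "subst \<sigma> (f ^ n) = subst \<sigma> f ^ n"
  by (induction n) (auto simp: subst_mult)

lemma subst_prod: "subst \<sigma> (prod f A) = (\<Prod>a\<in>A. subst \<sigma> (f a))"
  by (induction A rule: infinite_finite_induct) (auto simp: subst_mult)

lemma subst_subst: "subst \<tau> (subst \<sigma> f) = subst (\<lambda>v. subst \<tau> (\<sigma> v)) f"
  by (simp add: subst_def[of \<sigma>] subst_def[of "\<lambda>v. subst \<tau> (\<sigma> v)"] subst_sum subst_mult
      monom_subst_def subst_prod subst_power)

lemma subst_contract: "subst \<sigma> (contract v L G) = contract (\<lambda>x. subst \<sigma> (v x)) L (\<lambda>M. subst \<sigma> (G M))"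
  by (induction L arbitrary: G) (auto simp: subst_diff subst_mult)

lemma subst_pf: "subst \<sigma> (pf A L) = pf (\<lambda>a b. subst \<sigma> (A a b)) L"
proof (induction "length L" arbitrary: L rule: less_induct)
  case less
  then show ?case
    by (cases L) (auto simp: subst_contract intro!: contract_cong)
qed

text \<open>
  The skew-symmetric matrices of rank at most \<open>2t - 2\<close> are parametrized by sums
  \<open>\<Sum>\<^sub>r v\<^sub>r \<and> w\<^sub>r\<close> of \<open>t - 1\<close> decomposable forms in echelon shape: \<open>v\<^sub>r\<close> starts with a \<open>1\<close>
  in position \<open>2r\<close> and a \<open>0\<close> in position \<open>2r + 1\<close>, and \<open>w\<^sub>r\<close> starts in position \<open>2r + 1\<close>. The
  remaining entries are variables, named so that the variable \<open>(i, j)\<close> governs \<open>x\<^sub>i\<^sub>j\<close>; those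
  outside the set \<open>K\<close> are put to \<open>0\<close>.
\<close>

definition live_var :: "(nat \<times> nat) set \<Rightarrow> nat \<times> nat \<Rightarrow> (nat \<times> nat, 'a::field) mpoly" where
  "live_var K v = (if v \<in> K then mpoly_var v else 0)"

definition vvec :: "(nat \<times> nat) set \<Rightarrow> nat \<Rightarrow> nat \<Rightarrow> (nat \<times> nat, 'a::field) mpoly" where
  "vvec K r j = (if j = 2 * r then 1 else if 2 * r + 2 \<le> j then live_var K (2 * r + 1, j) else 0)"

definition wvec :: "(nat \<times> nat) set \<Rightarrow> nat \<Rightarrow> nat \<Rightarrow> (nat \<times> nat, 'a::field) mpoly" where
  "wvec K r j = (if 2 * r + 1 \<le> j then live_var K (2 * r, j) else 0)"

definition low_rank :: "nat \<Rightarrow> (nat \<times> nat) set \<Rightarrow> nat \<Rightarrow> nat \<Rightarrow> (nat \<times> nat, 'a::field) mpoly" where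
  "low_rank t K i j = (\<Sum>r<t - 1. vvec K r i * wvec K r j - wvec K r i * vvec K r j)"

definition low_rank_hom :: "nat \<Rightarrow> (nat \<times> nat) set \<Rightarrow> (nat \<times> nat, 'a::field) mpoly \<Rightarrow> (nat \<times> nat, 'a) mpoly" where
  "low_rank_hom t K = subst (\<lambda>(i, j). low_rank t K i j)"

lemma low_rank_hom_skew_matrix:
  "low_rank_hom t K (skew_matrix i j) = (low_rank t K i j :: (nat \<times> nat, 'a::field) mpoly)"
proof -
  have neg: "low_rank t K j i = - (low_rank t K i j :: (nat \<times> nat, 'a) mpoly)"
    by (simp add: low_rank_def sum_negf[symmetric] mult.commute)
  moreover have "low_rank t K i i = (0 :: (nat \<times> nat, 'a) mpoly)" by (simp add: low_rank_def mult.commute)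
  ultimately show ?thesis
    by (auto simp: low_rank_hom_def skew_matrix_def subst_uminus not_less)
qed

text \<open>The matrix is a sum of \<open>t - 1\<close> rank-two forms, and \<open>2 (t - 1)\<close>
  is less than the size \<open>2t\<close> of the pfaffians.\<close>

lemma low_rank_hom_gen:
  assumes "1 \<le> t" "j \<le> 2 * t"
  shows "low_rank_hom t K (gen t j) = (0 :: (nat \<times> nat, 'a::field) mpoly)"
proof -
  have "low_rank_hom t K (gen t j :: (nat \<times> nat, 'a) mpoly)
      = pf (\<lambda>a b. low_rank_hom t K (skew_matrix a b)) (del j [0..<2 * t + 1])"
    unfolding gen_def low_rank_hom_def subst_pf ..
  also have "\<dots> = pf (\<lambda>a b. \<Sum>r<t - 1. vvec K r a * wvec K r b - wvec K r a * vvec K r b) (del j [0..<2 * t + 1])"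
    unfolding low_rank_hom_skew_matrix low_rank_def ..
  also have "\<dots> = 0" by (rule pf_low_rank) (use assms in \<open>simp del: upt_Suc\<close>)
  finally show ?thesis .
qed

definition low_rank_kernel :: "nat \<Rightarrow> (nat \<times> nat) set \<Rightarrow> (nat \<times> nat, 'a::field) mpoly set" where
  "low_rank_kernel t K = {f \<in> carrier (poly_ring (skew_vars (2 * t + 1))). low_rank_hom t K f = 0}"

text \<open>The kernel of a homomorphism into a polynomial ring, which is an integral
  domain.\<close>

lemma primeideal_low_rank_kernel:
  "primeideal (low_rank_kernel t K :: (nat \<times> nat, 'a::field) mpoly set) (poly_ring (skew_vars (2 * t + 1)))"
proof -
  let ?R = "poly_ring (skew_vars (2 * t + 1)) :: (nat \<times> nat, 'a) mpoly ring"
  let ?P = "low_rank_kernel t K :: (nat \<times> nat, 'a) mpoly set"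
  interpret R: cring ?R by (rule poly_ring_cring)
  show ?thesis
  proof (rule primeidealI2)
    show "additive_subgroup ?P ?R"
    proof (rule additive_subgroup.intro, rule group.subgroupI[OF R.a_group])
      show "?P \<noteq> {}" by (auto simp: low_rank_kernel_def low_rank_hom_def carrier_poly_ring_iff intro!: exI[of _ 0])
      show "inv\<^bsub>add_monoid ?R\<^esub> f \<in> ?P" if "f \<in> ?P" for f
      proof -
        have f: "f \<in> carrier ?R" using that by (simp add: low_rank_kernel_def)
        then have "inv\<^bsub>add_monoid ?R\<^esub> f = - f" using poly_ring_a_inv by (simp add: a_inv_def)
        with that show ?thesis
          by (simp add: low_rank_kernel_def low_rank_hom_def subst_uminus poly_ring_uminus_closed)
      qed
    qed (auto simp: low_rank_kernel_def low_rank_hom_def subst_add poly_ring_add_closed)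
    show "carrier ?R \<noteq> ?P"
    proof
      assume "carrier ?R = ?P"
      then have "1 \<in> ?P" using poly_ring_one_closed by blast
      then show False by (simp add: low_rank_kernel_def low_rank_hom_def)
    qed
  qed (auto simp: poly_ring_cring low_rank_kernel_def low_rank_hom_def subst_mult poly_ring_mult_closed)
qed

lemma pfaffian_ideal_le_kernel:
  assumes "1 \<le> t"
  shows "pfaffian_ideal (2 * t + 1) t \<subseteq> (low_rank_kernel t K :: (nat \<times> nat, 'a::field) mpoly set)"
proof -
  interpret P: primeideal "low_rank_kernel t K :: (nat \<times> nat, 'a) mpoly set" "poly_ring (skew_vars (2 * t + 1))"
    by (rule primeideal_low_rank_kernel)
  have "gen t ` {..2 * t} \<subseteq> (low_rank_kernel t K :: (nat \<times> nat, 'a) mpoly set)"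
    using gen_graded graded_part_carrier low_rank_hom_gen[OF assms]
    by (fastforce simp: low_rank_kernel_def)
  then show ?thesis
    unfolding pfaffian_ideal_def pfaffian_generators by (rule P.genideal_minimal[OF P.is_ideal])
qed

text \<open>Killing the variables outside \<open>K'\<close> after the substitution for
  \<open>K\<close> gives the substitution for \<open>K'\<close>, so one homomorphism factors through
  the other.\<close>

lemma low_rank_kernel_mono:
  assumes "K' \<subseteq> K"
  shows "low_rank_kernel t K \<subseteq> (low_rank_kernel t K' :: (nat \<times> nat, 'a::field) mpoly set)"
proof -
  let ?\<tau> = "live_var K' :: nat \<times> nat \<Rightarrow> (nat \<times> nat, 'a) mpoly"
  have live: "subst ?\<tau> (live_var K v) = live_var K' v" for v
    using assms by (auto simp: live_var_def)
  have "subst ?\<tau> (vvec K r j) = vvec K' r j" "subst ?\<tau> (wvec K r j) = wvec K' r j" for r j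
    by (simp_all add: vvec_def wvec_def live)
  then have "subst ?\<tau> (low_rank t K i j) = low_rank t K' i j" for i j
    by (simp add: low_rank_def subst_sum subst_diff subst_mult)
  then have "low_rank_hom t K' f = subst ?\<tau> (low_rank_hom t K f)" for f
    by (simp add: low_rank_hom_def subst_subst case_prod_unfold)
  then show ?thesis by (auto simp: low_rank_kernel_def)
qed

text \<open>For \<open>s < r\<close> the vector \<open>wvec K s\<close> is zero, as its variables
  are dead; for \<open>s > r\<close> both vectors start beyond position \<open>2 * r\<close>. In the
  summand \<open>s = r\<close>, \<open>vvec\<close> has its leading 1 there and \<open>wvec\<close>
  is zero.\<close>

lemma low_rank_even_row:
  assumes "r < t - 1" "2 * r < j" "\<And>v. v \<in> K \<Longrightarrow> 2 * r \<le> fst v"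
  shows "low_rank t K (2 * r) j = (live_var K (2 * r, j) :: (nat \<times> nat, 'a::field) mpoly)"
proof -
  have "vvec K s (2 * r) * wvec K s j - wvec K s (2 * r) * vvec K s j
      = (if s = r then live_var K (2 * r, j) else 0 :: (nat \<times> nat, 'a) mpoly)" for s
    using assms(2,3) assms(3)[of "(2 * s, _)"]
    by (cases s r rule: linorder_cases) (force simp: vvec_def wvec_def live_var_def)+
  then show ?thesis using assms(1) by (simp add: low_rank_def)
qed

text \<open>Only \<open>s = r\<close> contributes again; now \<open>vvec\<close> vanishes in
  position \<open>2 * r + 1\<close> and \<open>wvec\<close> has the pivot there.\<close>

lemma low_rank_odd_row:
  assumes "r < t - 1" "2 * r + 2 \<le> j" "\<And>v. v \<in> K \<Longrightarrow> 2 * r \<le> fst v"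
  shows "low_rank t K (2 * r + 1) j
    = - (live_var K (2 * r, 2 * r + 1) * live_var K (2 * r + 1, j) :: (nat \<times> nat, 'a::field) mpoly)"
proof -
  have "vvec K s (2 * r + 1) * wvec K s j - wvec K s (2 * r + 1) * vvec K s j
      = (if s = r then - (live_var K (2 * r, 2 * r + 1) * live_var K (2 * r + 1, j))
         else 0 :: (nat \<times> nat, 'a) mpoly)" for s
    using assms(2,3) assms(3)[of "(2 * s, _)"]
    by (cases s r rule: linorder_cases) (force simp: vvec_def wvec_def live_var_def)+
  then show ?thesis using assms(1) by (simp add: low_rank_def)
qed

lemma mpoly_var_nonzero: "mpoly_var v \<noteq> (0 :: ('v, 'a::field) mpoly)"
proof
  assume "mpoly_var v = (0 :: ('v, 'a) mpoly)"
  then have "Poly_Mapping.keys (mpoly_var v :: ('v, 'a) mpoly) = {}" by simp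
  then show False by (simp add: mpoly_var_def)
qed

text \<open>The rows \<open>2r\<close> and \<open>2r + 1\<close> for \<open>r < t - 1\<close>. Left
  out are the three indeterminates of the last three indices, whence the codimension 3.\<close>

definition param_vars :: "nat \<Rightarrow> (nat \<times> nat) set" where
  "param_vars t = {(i, j). i < j \<and> j < 2 * t + 1 \<and> i + 3 \<le> 2 * t}"

text \<open>By \<open>low_rank_odd_row\<close>, variables of an odd row show up only as multiples of
  the pivot \<open>(2r, 2r + 1)\<close>, so the pivot must stay alive as long as any of them
  does.\<close>

definition pivots_live :: "(nat \<times> nat) set \<Rightarrow> bool" where
  "pivots_live K \<longleftrightarrow> (\<forall>r j. (2 * r + 1, j) \<in> K \<longrightarrow> (2 * r, 2 * r + 1) \<in> K)"

text \<open>
  Killing the variables in a suitable order makes the kernel strictly larger at each step: the new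
  element of the kernel is \<open>x\<^sub>i\<^sub>j\<close> when the variable \<open>(i, j)\<close> is killed.
\<close>

lemma low_rank_kernel_step:
  assumes "K \<subseteq> param_vars t" "finite K" "K \<noteq> {}" "pivots_live K"
  obtains u where "u \<in> K" "pivots_live (K - {u})"
    "low_rank_kernel t K \<subset> (low_rank_kernel t (K - {u}) :: (nat \<times> nat, 'a::field) mpoly set)"
proof -
  note obtained = that
  \<comment> \<open>The first pair of rows with a live variable: all earlier ones are dead, so
    \<open>low_rank_even_row\<close> and \<open>low_rank_odd_row\<close> apply.\<close>
  define r where "r = Min ((\<lambda>v. fst v div 2) ` K)"
  have "r \<in> (\<lambda>v. fst v div 2) ` K" unfolding r_def using assms by (intro Min_in) auto
  then obtain u0 where u0: "u0 \<in> K" "fst u0 div 2 = r" by auto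
  have "r \<le> fst v div 2" if "v \<in> K" for v
    unfolding r_def using that assms(2) by (intro Min_le) auto
  then have le: "2 * r \<le> fst v" if "v \<in> K" for v using that by fastforce
  obtain i0 j0 where ij0: "u0 = (i0, j0)" by (cases u0)
  have i0: "i0 = 2 * r \<or> i0 = 2 * r + 1" using u0(2) ij0 by auto
  have "i0 + 3 \<le> 2 * t" "i0 < j0" using u0(1) ij0 assms(1) by (auto simp: param_vars_def)
  then have r: "r < t - 1" using i0 by auto
  have step: ?thesis if u: "(i, j) \<in> K" "pivots_live (K - {(i, j)})"
    "low_rank t K i j \<noteq> (0 :: (nat \<times> nat, 'a) mpoly)" "low_rank t (K - {(i, j)}) i j = (0 :: (nat \<times> nat, 'a) mpoly)"
    for i j
  proof (rule obtained[OF u(1,2)])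
    have "(i, j) \<in> skew_vars (2 * t + 1)" using u(1) assms(1) by (auto simp: param_vars_def skew_vars_def)
    then have "mpoly_var (i, j) \<in> carrier (poly_ring (skew_vars (2 * t + 1)) :: (nat \<times> nat, 'a) mpoly ring)"
      by (auto simp: mpoly_var_def carrier_poly_ring_iff)
    then have "mpoly_var (i, j) \<in> (low_rank_kernel t (K - {(i, j)}) :: (nat \<times> nat, 'a) mpoly set)"
      "mpoly_var (i, j) \<notin> (low_rank_kernel t K :: (nat \<times> nat, 'a) mpoly set)"
      using u(3,4) by (auto simp: low_rank_kernel_def low_rank_hom_def)
    with low_rank_kernel_mono[of "K - {(i, j)}" K t]
    show "low_rank_kernel t K \<subset> (low_rank_kernel t (K - {(i, j)}) :: (nat \<times> nat, 'a) mpoly set)" by blast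
  qed
  have even: "low_rank t K' (2 * r) j = (live_var K' (2 * r, j) :: (nat \<times> nat, 'a) mpoly)"
    if "K' \<subseteq> K" "2 * r < j" for K' j
    by (rule low_rank_even_row[OF r that(2)]) (use that(1) le in blast)
  have odd: "low_rank t K' (2 * r + 1) j
      = - (live_var K' (2 * r, 2 * r + 1) * live_var K' (2 * r + 1, j) :: (nat \<times> nat, 'a) mpoly)"
    if "K' \<subseteq> K" "2 * r + 2 \<le> j" for K' j
    by (rule low_rank_odd_row[OF r that(2)]) (use that(1) le in blast)
  \<comment> \<open>Order of killing within the pair of rows: the even row beyond the pivot, then
    the odd row, whose entries carry the pivot as a factor, and the pivot last.\<close>
  show ?thesis
  proof (cases "\<exists>j\<ge>2 * r + 2. (2 * r, j) \<in> K")
    case True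
    then obtain j where j: "j \<ge> 2 * r + 2" "(2 * r, j) \<in> K" by blast
    have "pivots_live (K - {(2 * r, j)})"
      using assms(4) j(1) by (auto simp: pivots_live_def)
    with j show ?thesis
      using even[of K j] even[of "K - {(2 * r, j)}" j]
      by (intro step[of "2 * r" j]) (auto simp: live_var_def mpoly_var_nonzero)
  next
    case no_even: False
    show ?thesis
    proof (cases "\<exists>j. (2 * r + 1, j) \<in> K")
      case True
      then obtain j where j: "(2 * r + 1, j) \<in> K" by blast
      have j2: "2 * r + 2 \<le> j" using j assms(1) by (auto simp: param_vars_def)
      have piv: "(2 * r, 2 * r + 1) \<in> K" using assms(4) j by (auto simp: pivots_live_def)
      \<comment> \<open>Pivots have an even first index, so removing a variable of an odd row loses
        none.\<close>
      have "pivots_live (K - {(2 * r + 1, j)})"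
        using assms(4) unfolding pivots_live_def by auto presburger+
      with j j2 piv show ?thesis
        using odd[of K j] odd[of "K - {(2 * r + 1, j)}" j]
        by (intro step[of "2 * r + 1" j]) (auto simp: live_var_def mpoly_var_nonzero)
    next
      case no_odd: False
      with u0(1) ij0 i0 have i0': "i0 = 2 * r" by auto
      with no_even u0(1) ij0 \<open>i0 < j0\<close> have "j0 = 2 * r + 1" by (metis Suc_eq_plus1 Suc_leI add_2_eq_Suc' le_neq_implies_less)
      with u0(1) ij0 i0' have piv: "(2 * r, 2 * r + 1) \<in> K" by simp
      have "pivots_live (K - {(2 * r, 2 * r + 1)})"
        using assms(4) no_odd unfolding pivots_live_def by auto
      with piv show ?thesis
        using even[of K "2 * r + 1"] even[of "K - {(2 * r, 2 * r + 1)}" "2 * r + 1"]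
        by (intro step[of "2 * r" "2 * r + 1"]) (auto simp: live_var_def mpoly_var_nonzero)
    qed
  qed
qed

lemma low_rank_kernel_chain:
  assumes "K \<subseteq> param_vars t" "finite K" "pivots_live K"
  shows "\<exists>P. P 0 = K \<and> (\<forall>i<card K.
    low_rank_kernel t (P i) \<subset> (low_rank_kernel t (P (Suc i)) :: (nat \<times> nat, 'a::field) mpoly set))"
  using assms
proof (induction "card K" arbitrary: K)
  case 0
  then show ?case by auto
next
  case (Suc n)
  then have "K \<noteq> {}" by auto
  from low_rank_kernel_step[OF Suc.prems(1,2) this Suc.prems(3), where ?'a = 'a] obtain u where
    u: "u \<in> K" "pivots_live (K - {u})"
    "low_rank_kernel t K \<subset> (low_rank_kernel t (K - {u}) :: (nat \<times> nat, 'a) mpoly set)" by metis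
  have n: "n = card (K - {u})" using Suc.hyps(2) u(1) Suc.prems(2) by simp
  have "\<exists>P. P 0 = K - {u} \<and> (\<forall>i<card (K - {u}).
    low_rank_kernel t (P i) \<subset> (low_rank_kernel t (P (Suc i)) :: (nat \<times> nat, 'a) mpoly set))"
    by (rule Suc.hyps(1)[OF n]) (use Suc.prems u in auto)
  then obtain P where P: "P 0 = K - {u}"
    "\<And>i. i < n \<Longrightarrow> low_rank_kernel t (P i) \<subset> (low_rank_kernel t (P (Suc i)) :: (nat \<times> nat, 'a) mpoly set)"
    unfolding n by blast
  define P' where "P' i = (case i of 0 \<Rightarrow> K | Suc i \<Rightarrow> P i)" for i
  have "low_rank_kernel t (P' i) \<subset> (low_rank_kernel t (P' (Suc i)) :: (nat \<times> nat, 'a) mpoly set)"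
    if "i < card K" for i
    using that Suc.hyps(2) u(3) P by (cases i) (auto simp: P'_def)
  then show ?case by (intro exI[of _ P']) (simp add: P'_def)
qed

lemma card_param_vars:
  assumes "1 \<le> t" shows "card (param_vars t) = t * (2 * t + 1) - 3" "finite (param_vars t)"
proof -
  let ?B = "{(2 * t - 2, 2 * t - 1), (2 * t - 2, 2 * t), (2 * t - 1, 2 * t)}"
  have "param_vars t = skew_vars (2 * t + 1) - ?B"
    using assms by (auto simp: param_vars_def skew_vars_def)
  moreover have "?B \<subseteq> skew_vars (2 * t + 1)" using assms by (auto simp: skew_vars_def)
  moreover have "card ?B = 3" using assms by simp
  ultimately show "card (param_vars t) = t * (2 * t + 1) - 3" "finite (param_vars t)"
    using finite_skew_vars[of "2 * t + 1"] by (simp_all add: card_Diff_subset card_skew_vars_odd[simplified])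
qed

lemma krull_dim_pfaffian_ideal_ge:
  assumes "1 \<le> t"
  shows "enat (t * (2 * t + 1) - 3) \<le> krull_dim (poly_ring (skew_vars (2 * t + 1)) Quot
    (pfaffian_ideal (2 * t + 1) t :: (nat \<times> nat, 'a::field) mpoly set))"
proof -
  interpret lowest_basis "skew_vars (2 * t + 1)" "2 * t + 1" t "4 * t * t"
    "gen t :: nat \<Rightarrow> (nat \<times> nat, 'a) mpoly" "lead t" "multipliers t"
    by (rule lowest_basis_gen)
  have "pivots_live (param_vars t)" by (auto simp: pivots_live_def param_vars_def)
  from low_rank_kernel_chain[OF order_refl card_param_vars(2)[OF assms] this, where ?'a = 'a]
  obtain P where P: "\<And>i. i < t * (2 * t + 1) - 3 \<Longrightarrow>
    low_rank_kernel t (P i) \<subset> (low_rank_kernel t (P (Suc i)) :: (nat \<times> nat, 'a) mpoly set)"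
    unfolding card_param_vars(1)[OF assms] by blast
  show ?thesis
  proof (rule krull_dim_ge[where P = "\<lambda>i. low_rank_kernel t (P i)"])
    show "ideal (pfaffian_ideal (2 * t + 1) t :: (nat \<times> nat, 'a) mpoly set) (poly_ring (skew_vars (2 * t + 1)))"
      unfolding pfaffian_ideal_combinations by (rule ideal_combinations)
  qed (rule primeideal_low_rank_kernel pfaffian_ideal_le_kernel[OF assms] P, assumption?)+
qed

lemma krull_dim_pfaffian_ideal_le:
  assumes "1 \<le> t" and "hilbert_series (skew_vars (2 * t + 1))
      (pfaffian_ideal (2 * t + 1) t :: (nat \<times> nat, 'a::field) mpoly set) * (1 - fps_X) ^ d = fps_of_poly q"
  shows "krull_dim (poly_ring (skew_vars (2 * t + 1)) Quot
    (pfaffian_ideal (2 * t + 1) t :: (nat \<times> nat, 'a) mpoly set)) \<le> enat d"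
proof -
  interpret lowest_basis "skew_vars (2 * t + 1)" "2 * t + 1" t "4 * t * t"
    "gen t :: nat \<Rightarrow> (nat \<times> nat, 'a) mpoly" "lead t" "multipliers t"
    by (rule lowest_basis_gen)
  have "growth_bound (skew_vars (2 * t + 1)) combinations d"
    by (rule growth_bound_combinations[OF finite_skew_vars, of _ q])
      (use assms(2) hilbert_function_combinations[OF finite_skew_vars assms(1)]
        in \<open>simp only: hilbert_series_def pfaffian_ideal_combinations\<close>)
  then show ?thesis
    unfolding pfaffian_ideal_combinations by (rule krull_dim_le[OF ideal_combinations])
qed

theorem proposition4p2:
  fixes t :: nat and M :: "(nat \<times> nat, 'k::field) mpoly set"
  assumes "t \<ge> 1"
    and "M = pfaffian_ideal (2 * t + 1) t"
  shows "\<exists>h. is_h_vector (skew_vars (2 * t + 1)) M h \<and> decreasing_type h"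
proof (intro exI conjI)
  let ?V = "skew_vars (2 * t + 1)" and ?N = "t * (2 * t + 1)"
  \<comment> \<open>Makes \<open>?N - 3\<close> a true difference; it is 0 for
    \<open>t = 1\<close>.\<close>
  have "1 * 3 \<le> ?N" using assms(1) by (intro mult_le_mono) auto
  then have N: "?N = (?N - 3) + 3" by simp
  have "hilbert_series ?V M * (1 - fps_X) ^ ((?N - 3) + 3)
      = (1 - fps_X) ^ 3 * fps_of_poly (Poly (h_vector t))"
    using hilbert_series_pfaffian_ideal[OF assms(1), where ?'a = 'k] h_vector_series[OF assms(1)] N assms(2)
    by simp
  then have "(1 - fps_X) ^ 3 * (hilbert_series ?V M * (1 - fps_X) ^ (?N - 3))
      = (1 - fps_X) ^ 3 * fps_of_poly (Poly (h_vector t))"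
    unfolding power_add by (simp only: mult_ac)
  \<comment> \<open>Integer power series form a domain, so the factor of exponent 3 cancels, and the
    exponent that remains is the Krull dimension.\<close>
  moreover have "(1 - fps_X :: int fps) ^ 3 \<noteq> 0"
  proof -
    have "fps_nth (1 - fps_X :: int fps) 0 = 1" by simp
    then have "1 - fps_X \<noteq> (0 :: int fps)" by force
    then show ?thesis by simp
  qed
  ultimately have series: "hilbert_series ?V M * (1 - fps_X) ^ (?N - 3) = fps_of_poly (Poly (h_vector t))"
    by (metis mult_left_cancel)
  have "krull_dim (poly_ring ?V Quot M) = enat (?N - 3)"
    using krull_dim_pfaffian_ideal_ge[OF assms(1), where ?'a = 'k]
      krull_dim_pfaffian_ideal_le[OF assms(1) series[unfolded assms(2)]] assms(2) by (intro antisym) auto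
  with series h_vector_last[OF assms(1)] show "is_h_vector ?V M (h_vector t)"
    unfolding is_h_vector_def by blast
  show "decreasing_type (h_vector t)" by (rule decreasing_type_h_vector)
qed

end
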